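(* For every integer $k\ge 1$ there exist constants $\alpha_2>0$ and $\beta_2>0$ depending only on $k$ such that for all integers $n\ge 2$, $$\beta_2 n^{-k/2} \;\leq\; \left(\frac{\mathrm{Vol}\, \widetilde{Sq}}{\mathrm{Vol}\, B_M}\right)^{1/D_M} \;\leq\; \alpha_2 n^{-k/2},$$ where $\widetilde{Sq}=\widetilde{Sq}_{n,2k}$ is the translated section of the cone of sums of squares of degree $2k$ in $n$ variables, and $B_M$, $D_M$ are the $L^2$ unit ball and the dimension of the space $M_{n,2k}$ of forms of integral zero on the sphere.
   Context: $P_{n,m}$ is the real vector space of real homogeneous polynomials (forms) of degree $m$ in $n$ variables. $S^{n-1}$ is the unit sphere in $\mathbb{R}^n$ and $\sigma$ is the rotation invariant probability measure on it. $P_{n,2k}$ carries the inner product $\langle f,g\rangle=\int_{S^{n-1}} fg\,d\sigma$. $M=M_{n,2k}=\{f\in P_{n,2k} : \int_{S^{n-1}} f\,d\sigma=0\}$, $D_M=\dim M_{n,2k}$, and $B_M$ is the unit ball of $M_{n,2k}$ in the inner product $\langle\,,\rangle$; $\mathrm{Vol}$ is Lebesgue measure on $M_{n,2k}$ for this inner product. Let $r^{2k}=(x_1^2+\dots+x_n^2)^k$. The cone of sums of squares is $Sq=\{f\in P_{n,2k} : f=\sum_i f_i^2 \text{ for some (finitely many) } f_i\in P_{n,k}\}$, and $\widetilde{Sq}=\{f\in M_{n,2k} : f+r^{2k}\in Sq\}$. *)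

theory Defs
  imports "HOL-Probability.Probability" "HOL-Library.Poly_Mapping"
begin

instantiation poly_mapping :: (type, real_vector) real_vector
begin

lift_definition scaleR_poly_mapping :: "real \<Rightarrow> ('a \<Rightarrow>\<^sub>0 'b) \<Rightarrow> ('a \<Rightarrow>\<^sub>0 'b)"
  is "\<lambda>c p k. c *\<^sub>R p k"
  by (rule finite_subset[rotated]) auto

instance
  by standard (transfer; simp add: fun_eq_iff scaleR_add_right scaleR_add_left)+

end

text \<open>
  Real polynomials in the variables \<open>x\<^sub>0, x\<^sub>1, \<dots>\<close>: an exponent vector \<open>\<nu> :: nat \<Rightarrow>\<^sub>0 nat\<close>
  is mapped to the coefficient of \<open>x^\<nu>\<close>; multiplication is the convolution product of the library.
  The number \<open>n\<close> of variables has to vary inside a statement, so it is not encoded in a type: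
  the variables of a form in \<open>n\<close> variables are those with index below \<open>n\<close>, and points of \<open>\<real>^n\<close> are
  elements of \<open>{..<n} \<rightarrow>\<^sub>E UNIV\<close>.
\<close>

type_synonym rpoly = "(nat \<Rightarrow>\<^sub>0 nat) \<Rightarrow>\<^sub>0 real"

definition var :: "nat \<Rightarrow> rpoly" where
  "var i = Poly_Mapping.single (Poly_Mapping.single i 1) 1"

definition eval_poly :: "rpoly \<Rightarrow> (nat \<Rightarrow> real) \<Rightarrow> real" where
  "eval_poly p x =
     (\<Sum>\<nu>\<in>Poly_Mapping.keys p. Poly_Mapping.lookup p \<nu> *
        (\<Prod>i\<in>Poly_Mapping.keys \<nu>. x i ^ Poly_Mapping.lookup \<nu> i))"

definition forms :: "nat \<Rightarrow> nat \<Rightarrow> rpoly set" where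
  "forms n m = {p. \<forall>\<nu>\<in>Poly_Mapping.keys p.
     Poly_Mapping.keys \<nu> \<subseteq> {..<n} \<and> (\<Sum>i\<in>Poly_Mapping.keys \<nu>. Poly_Mapping.lookup \<nu> i) = m}"

definition euclid_norm :: "nat \<Rightarrow> (nat \<Rightarrow> real) \<Rightarrow> real" where
  "euclid_norm n x = sqrt (\<Sum>i<n. (x i)\<^sup>2)"

definition unit_sphere :: "nat \<Rightarrow> (nat \<Rightarrow> real) set" where
  "unit_sphere n = {x \<in> {..<n} \<rightarrow>\<^sub>E UNIV. euclid_norm n x = 1}"

definition punctured_ball :: "nat \<Rightarrow> (nat \<Rightarrow> real) set" where
  "punctured_ball n = {x \<in> {..<n} \<rightarrow>\<^sub>E UNIV. 0 < euclid_norm n x \<and> euclid_norm n x \<le> 1}"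

abbreviation lebesgue_n :: "nat \<Rightarrow> (nat \<Rightarrow> real) measure" where
  "lebesgue_n n \<equiv> (\<Pi>\<^sub>M i\<in>{..<n}. lborel)"

text \<open>
  The rotation invariant probability measure on the sphere, as the distribution of \<open>x / |x|\<close>
  for a uniformly distributed point \<open>x \<noteq> 0\<close> of the unit ball; that it is a rotation invariant
  probability measure is shown in \<open>prob_space_sphere_measure\<close> and
  \<open>sphere_measure_rotation_invariant\<close> below.
\<close>

definition sphere_measure :: "nat \<Rightarrow> (nat \<Rightarrow> real) measure" where
  "sphere_measure n =
     distr (uniform_measure (restrict_space (lebesgue_n n) (punctured_ball n)) (punctured_ball n))
       (restrict_space (lebesgue_n n) (unit_sphere n))
       (\<lambda>x. \<lambda>i\<in>{..<n}. x i / euclid_norm n x)"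

definition form_inner :: "nat \<Rightarrow> rpoly \<Rightarrow> rpoly \<Rightarrow> real" where
  "form_inner n f g = (LINT x|sphere_measure n. eval_poly f x * eval_poly g x)"

definition zero_mean_forms :: "nat \<Rightarrow> nat \<Rightarrow> rpoly set" where
  "zero_mean_forms n k = {f \<in> forms n (2 * k). (LINT x|sphere_measure n. eval_poly f x) = 0}"

definition zero_mean_ball :: "nat \<Rightarrow> nat \<Rightarrow> rpoly set" where
  "zero_mean_ball n k = {f \<in> zero_mean_forms n k. form_inner n f f \<le> 1}"

definition orthonormal_basis :: "nat \<Rightarrow> nat \<Rightarrow> (nat \<Rightarrow> rpoly) \<Rightarrow> bool" where
  "orthonormal_basis n k b \<longleftrightarrow>
     span (b ` {..<dim (zero_mean_forms n k)}) = zero_mean_forms n k \<and>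
     (\<forall>i<dim (zero_mean_forms n k). \<forall>j<dim (zero_mean_forms n k).
        form_inner n (b i) (b j) = (if i = j then 1 else 0))"

text \<open>
  Lebesgue measure on \<open>M\<close> for the inner product: the Lebesgue measure of the set of coordinate
  vectors with respect to an orthonormal basis, which does not depend on the choice of that basis
  (see \<open>lebesgue_n_orthogonal\<close> below).
\<close>

definition form_vol :: "nat \<Rightarrow> nat \<Rightarrow> rpoly set \<Rightarrow> real" where
  "form_vol n k A =
     (let D = dim (zero_mean_forms n k); b = (SOME b. orthonormal_basis n k b)
      in measure (completion (lebesgue_n D))
           {c \<in> {..<D} \<rightarrow>\<^sub>E UNIV. (\<Sum>i<D. c i *\<^sub>R b i) \<in> A})"

definition Sq :: "nat \<Rightarrow> nat \<Rightarrow> rpoly set" where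
  "Sq n k = {f \<in> forms n (2 * k).
     \<exists>(N::nat) g. (\<forall>j<N. g j \<in> forms n k) \<and> f = (\<Sum>j<N. (g j)\<^sup>2)}"

definition Sq_tilde :: "nat \<Rightarrow> nat \<Rightarrow> rpoly set" where
  "Sq_tilde n k = {f \<in> zero_mean_forms n k. f + (\<Sum>i<n. (var i)\<^sup>2) ^ k \<in> Sq n k}"

text \<open>
  The Lebesgue measure on \<open>{..<n} \<rightarrow>\<^sub>E UNIV\<close> is invariant under orthogonal matrices: its image under
  such a matrix is again translation invariant and gives the unit ball the same mass, so Fubini's
  theorem identifies the two measures.
\<close>

definition mat_apply :: "nat \<Rightarrow> (nat \<Rightarrow> nat \<Rightarrow> real) \<Rightarrow> (nat \<Rightarrow> real) \<Rightarrow> nat \<Rightarrow> real" where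
  "mat_apply n Q x = (\<lambda>i\<in>{..<n}. \<Sum>j<n. Q i j * x j)"

definition orthogonal_mat :: "nat \<Rightarrow> (nat \<Rightarrow> nat \<Rightarrow> real) \<Rightarrow> bool" where
  "orthogonal_mat n Q \<longleftrightarrow> (\<forall>i<n. \<forall>j<n.
     (\<Sum>l<n. Q i l * Q j l) = (if i = j then 1 else 0) \<and>
     (\<Sum>l<n. Q l i * Q l j) = (if i = j then 1 else 0))"

lemma mat_apply_measurable [measurable]: "mat_apply n Q \<in> lebesgue_n n \<rightarrow>\<^sub>M lebesgue_n n"
  unfolding mat_apply_def by (rule measurable_restrict) (simp, measurable)

lemma mat_apply_PiE: "mat_apply n Q x \<in> {..<n} \<rightarrow>\<^sub>E UNIV"
  by (simp add: mat_apply_def)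

lemma mat_apply_transpose:
  assumes "orthogonal_mat n Q" "x \<in> {..<n} \<rightarrow>\<^sub>E UNIV"
  shows "mat_apply n Q (mat_apply n (\<lambda>i j. Q j i) x) = x"
proof
  fix i
  show "mat_apply n Q (mat_apply n (\<lambda>i j. Q j i) x) i = x i"
  proof (cases "i < n")
    case True
    have "(\<Sum>j<n. Q i j * (\<Sum>l<n. Q l j * x l)) = (\<Sum>j<n. \<Sum>l<n. Q i j * Q l j * x l)"
      by (simp add: sum_distrib_left mult.assoc)
    also have "\<dots> = (\<Sum>l<n. (\<Sum>j<n. Q i j * Q l j) * x l)"
      by (subst sum.swap) (simp add: sum_distrib_right)
    also have "\<dots> = (\<Sum>l<n. if i = l then x l else 0)"
      using assms(1) True by (intro sum.cong) (auto simp: orthogonal_mat_def)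
    finally show ?thesis using True by (simp add: mat_apply_def)
  qed (use assms(2) in \<open>auto simp: mat_apply_def PiE_def extensional_def\<close>)
qed

lemma euclid_norm_mat_apply:
  assumes "orthogonal_mat n Q"
  shows "euclid_norm n (mat_apply n Q x) = euclid_norm n x"
proof -
  have "(\<Sum>i<n. (mat_apply n Q x i)\<^sup>2) = (\<Sum>i<n. \<Sum>j<n. \<Sum>l<n. Q i j * Q i l * (x j * x l))"
    by (simp add: mat_apply_def power2_eq_square sum_product mult_ac)
  also have "\<dots> = (\<Sum>j<n. \<Sum>i<n. \<Sum>l<n. Q i j * Q i l * (x j * x l))"
    by (rule sum.swap)
  also have "\<dots> = (\<Sum>j<n. \<Sum>l<n. (\<Sum>i<n. Q i j * Q i l) * (x j * x l))"
    by (rule sum.cong[OF refl], subst sum.swap) (simp add: sum_distrib_right)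
  also have "\<dots> = (\<Sum>j<n. \<Sum>l<n. if j = l then x j * x l else 0)"
    using assms by (intro sum.cong refl) (auto simp: orthogonal_mat_def)
  finally show ?thesis by (simp add: euclid_norm_def power2_eq_square)
qed

definition vec_affine :: "nat \<Rightarrow> real \<Rightarrow> (nat \<Rightarrow> real) \<Rightarrow> (nat \<Rightarrow> real) \<Rightarrow> nat \<Rightarrow> real" where
  "vec_affine n c t x = (\<lambda>i\<in>{..<n}. t i + c * x i)"

lemma vec_affine_measurable [measurable (raw)]:
  assumes u: "u \<in> N \<rightarrow>\<^sub>M lebesgue_n n" and v: "v \<in> N \<rightarrow>\<^sub>M lebesgue_n n"
  shows "(\<lambda>\<omega>. vec_affine n c (u \<omega>) (v \<omega>)) \<in> N \<rightarrow>\<^sub>M lebesgue_n n"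
  unfolding vec_affine_def
proof (rule measurable_restrict)
  fix i assume i: "i \<in> {..<n}"
  have [measurable]: "(\<lambda>\<omega>. u \<omega> i) \<in> N \<rightarrow>\<^sub>M borel" "(\<lambda>\<omega>. v \<omega> i) \<in> N \<rightarrow>\<^sub>M borel"
    using measurable_compose[OF u measurable_component_singleton[OF i]]
      measurable_compose[OF v measurable_component_singleton[OF i]] by simp_all
  show "(\<lambda>\<omega>. u \<omega> i + c * v \<omega> i) \<in> N \<rightarrow>\<^sub>M lborel" by measurable
qed

lemma vec_affine_measurable' [measurable]: "vec_affine n c t \<in> lebesgue_n n \<rightarrow>\<^sub>M lebesgue_n n"
  unfolding vec_affine_def by (rule measurable_restrict) measurable

lemma lborel_shift_reflect:
  assumes "\<bar>c\<bar> = 1"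
  shows "distr lborel lborel (\<lambda>y::real. t + c * y) = lborel"
proof -
  have "lborel = density (distr lborel borel (\<lambda>y::real. t + c * y)) (\<lambda>_. ennreal \<bar>c\<bar>)"
    using assms by (intro lborel_real_affine) auto
  moreover have "distr lborel borel (\<lambda>y::real. t + c * y) = distr lborel lborel (\<lambda>y::real. t + c * y)"
    by (rule distr_cong) auto
  ultimately show ?thesis using assms by (simp add: density_1)
qed

lemma lebesgue_n_shift_reflect:
  assumes "\<bar>c\<bar> = 1"
  shows "distr (lebesgue_n n) (lebesgue_n n) (vec_affine n c t) = lebesgue_n n"
proof -
  interpret product_sigma_finite "\<lambda>_::nat. lborel :: real measure" ..
  show ?thesis
  proof (rule PiM_eqI)
    fix A :: "nat \<Rightarrow> real set" assume A: "\<And>i. i \<in> {..<n} \<Longrightarrow> A i \<in> sets lborel"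
    have pre: "(vec_affine n c t) -` Pi\<^sub>E {..<n} A \<inter> space (lebesgue_n n) =
        Pi\<^sub>E {..<n} (\<lambda>i. (\<lambda>y. t i + c * y) -` A i \<inter> space lborel)"
      by (auto simp: vec_affine_def space_PiM PiE_iff)
    have m: "(\<lambda>y. t i + c * y) -` A i \<inter> space lborel \<in> sets lborel" if "i < n" for i
      using A[of i] that by (intro measurable_sets[of _ lborel lborel]) auto
    have "emeasure (distr (lebesgue_n n) (lebesgue_n n) (vec_affine n c t)) (Pi\<^sub>E {..<n} A)
      = (\<Prod>i<n. emeasure lborel ((\<lambda>y. t i + c * y) -` A i \<inter> space lborel))"
      using A m emeasure_PiM[of "{..<n}" "\<lambda>i. (\<lambda>y. t i + c * y) -` A i \<inter> space lborel"]
      by (subst emeasure_distr) (simp_all add: pre sets_PiM_I_finite del: space_lborel)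
    also have "\<dots> = (\<Prod>i<n. emeasure (distr lborel lborel (\<lambda>y. t i + c * y)) (A i))"
      using A by (intro prod.cong refl, subst emeasure_distr) auto
    finally show "emeasure (distr (lebesgue_n n) (lebesgue_n n) (vec_affine n c t)) (Pi\<^sub>E {..<n} A)
      = (\<Prod>i<n. emeasure lborel (A i))"
      using assms by (simp add: lborel_shift_reflect)
  qed auto
qed

lemma nn_integral_shift_reflect:
  assumes "\<bar>c\<bar> = 1" "f \<in> borel_measurable (lebesgue_n n)"
  shows "(\<integral>\<^sup>+x. f (vec_affine n c t x) \<partial>lebesgue_n n) = integral\<^sup>N (lebesgue_n n) f"
proof -
  have "integral\<^sup>N (lebesgue_n n) f =
      integral\<^sup>N (distr (lebesgue_n n) (lebesgue_n n) (vec_affine n c t)) f"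
    by (simp only: lebesgue_n_shift_reflect[OF assms(1)])
  also have "\<dots> = (\<integral>\<^sup>+x. f (vec_affine n c t x) \<partial>lebesgue_n n)"
    by (rule nn_integral_distr[OF vec_affine_measurable']) (simp add: assms(2))
  finally show ?thesis by simp
qed

lemma euclid_norm_measurable [measurable]: "euclid_norm n \<in> borel_measurable (lebesgue_n n)"
  unfolding euclid_norm_def by measurable

lemma punctured_ball_sets [measurable]: "punctured_ball n \<in> sets (lebesgue_n n)"
proof -
  have "punctured_ball n = {x \<in> space (lebesgue_n n). 0 < euclid_norm n x \<and> euclid_norm n x \<le> 1}"
    by (auto simp: punctured_ball_def space_PiM)
  then show ?thesis by simp
qed

lemma unit_sphere_sets [measurable]: "unit_sphere n \<in> sets (lebesgue_n n)"
proof -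
  have "unit_sphere n = {x \<in> space (lebesgue_n n). euclid_norm n x = 1}"
    by (auto simp: unit_sphere_def space_PiM)
  then show ?thesis by simp
qed

lemma punctured_ball_pos_finite:
  assumes "n \<ge> 1"
  shows "emeasure (lebesgue_n n) (punctured_ball n) \<noteq> 0"
        "emeasure (lebesgue_n n) (punctured_ball n) \<noteq> \<infinity>"
proof -
  interpret product_sigma_finite "\<lambda>_::nat. lborel :: real measure" ..
  let ?B = "{f. sqrt (\<Sum>i<n. (f i)\<^sup>2) \<le> 1} \<inter> space (lebesgue_n n)"
  let ?O = "Pi\<^sub>E {..<n} (\<lambda>_. {0::real})"
  have "emeasure (lebesgue_n n) ?O = (\<Prod>i<n. emeasure lborel {0::real})"
    by (subst emeasure_PiM) auto
  also have "\<dots> = 0" using assms by auto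
  finally have O: "emeasure (lebesgue_n n) ?O = 0" .
  have Os: "?O \<in> sets (lebesgue_n n)" by (intro sets_PiM_I_finite) auto
  have eq: "punctured_ball n = ?B - ?O"
  proof (intro set_eqI)
    fix x :: "nat \<Rightarrow> real"
    have "0 < euclid_norm n x \<longleftrightarrow> euclid_norm n x \<noteq> 0"
      by (auto simp: euclid_norm_def sum_nonneg less_le)
    also have "\<dots> \<longleftrightarrow> \<not> (\<forall>i\<in>{..<n}. x i = 0)"
      by (simp add: euclid_norm_def sum_nonneg_eq_0_iff)
    finally have "0 < euclid_norm n x \<longleftrightarrow> \<not> (\<forall>i\<in>{..<n}. x i = 0)" .
    then show "x \<in> punctured_ball n \<longleftrightarrow> x \<in> ?B - ?O"
      by (auto simp: punctured_ball_def space_PiM PiE_iff euclid_norm_def fun_eq_iff extensional_def)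
  qed
  have "?B \<in> sets (lebesgue_n n)"
    using measurable_sets[OF euclid_norm_measurable[of n], of "{..1}"]
    by (auto simp: euclid_norm_def vimage_def)
  then have "emeasure (lebesgue_n n) (punctured_ball n) = emeasure (lebesgue_n n) ?B"
    unfolding eq using O Os by (intro emeasure_Diff_null_set) auto
  also have "\<dots> = ennreal (unit_ball_vol (real n))"
    using emeasure_cball_aux[of "{..<n}" 1] by simp
  finally show "emeasure (lebesgue_n n) (punctured_ball n) \<noteq> 0"
        "emeasure (lebesgue_n n) (punctured_ball n) \<noteq> \<infinity>"
    using unit_ball_vol_pos[of "real n"] by (auto simp: ennreal_eq_0_iff not_le[symmetric] simp del: unit_ball_vol_pos)
qed

lemma lebesgue_n_orthogonal:
  assumes Q: "orthogonal_mat n Q" and n: "n \<ge> 1"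
  shows "distr (lebesgue_n n) (lebesgue_n n) (mat_apply n Q) = lebesgue_n n" (is "?D = ?L")
proof (rule measure_eqI)
  fix S assume "S \<in> sets ?D"
  then have S [measurable]: "S \<in> sets ?L" by simp
  interpret product_sigma_finite "\<lambda>_::nat. lborel :: real measure" ..
  interpret sigma_finite_measure ?L by (rule sigma_finite) simp
  interpret P: pair_sigma_finite ?L ?L ..
  let ?T = "mat_apply n Q" and ?T' = "mat_apply n (\<lambda>i j. Q j i)"
  define f :: "(nat \<Rightarrow> real) \<Rightarrow> ennreal" where "f = indicator (punctured_ball n)"
  define g :: "(nat \<Rightarrow> real) \<Rightarrow> ennreal" where "g = indicator S"
  define V where "V = emeasure ?L (punctured_ball n)"
  have fm [measurable]: "f \<in> borel_measurable ?L" and gm [measurable]: "g \<in> borel_measurable ?L"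
    by (auto simp: f_def g_def)
  have Tm: "(\<lambda>p. ?T (fst p)) \<in> ?L \<Otimes>\<^sub>M ?L \<rightarrow>\<^sub>M ?L"
    by (rule measurable_compose[OF measurable_fst mat_apply_measurable])
  have m1: "(\<lambda>(x, y). f (?T x) * g (vec_affine n 1 (?T x) y)) \<in> borel_measurable (?L \<Otimes>\<^sub>M ?L)"
    unfolding case_prod_beta
    by (intro borel_measurable_times_ennreal fm[THEN measurable_compose[rotated]]
        gm[THEN measurable_compose[rotated]] vec_affine_measurable Tm measurable_snd)
  have m2: "(\<lambda>(x, y). f (vec_affine n (- 1) (?T x) y) * g (?T x)) \<in> borel_measurable (?L \<Otimes>\<^sub>M ?L)"
    unfolding case_prod_beta
    by (intro borel_measurable_times_ennreal fm[THEN measurable_compose[rotated]]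
        gm[THEN measurable_compose[rotated]] vec_affine_measurable Tm measurable_snd)
  have fV: "integral\<^sup>N ?L f = V" by (simp add: f_def V_def)
  have fT: "f (?T x) = f x" if "x \<in> space ?L" for x
  proof -
    have "?T x \<in> {..<n} \<rightarrow>\<^sub>E UNIV" by (simp add: mat_apply_def)
    then have "?T x \<in> punctured_ball n \<longleftrightarrow> x \<in> punctured_ball n"
      using that by (simp add: punctured_ball_def euclid_norm_mat_apply[OF Q] space_PiM)
    then show ?thesis by (simp add: f_def indicator_def)
  qed
  have sub: "?T (vec_affine n 1 (?T' y) x) = vec_affine n 1 (?T x) y"
    if "y \<in> space ?L" for x y
  proof -
    have "?T (vec_affine n 1 (?T' y) x) = vec_affine n 1 (?T x) (?T (?T' y))"
      by (auto simp: mat_apply_def vec_affine_def fun_eq_iff ring_distribs sum.distrib)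
    then show ?thesis using mat_apply_transpose[OF Q, of y] that by (simp add: space_PiM)
  qed
  have add_sub: "vec_affine n (- 1) (vec_affine n 1 x y) y = x" if "x \<in> space ?L" for x y
    using that by (auto simp: vec_affine_def fun_eq_iff space_PiM PiE_def extensional_def)
  have "V * integral\<^sup>N ?L g = (\<integral>\<^sup>+x. f (?T x) * integral\<^sup>N ?L g \<partial>?L)"
    by (subst nn_integral_multc) (auto simp: fT fV cong: nn_integral_cong)
  also have "\<dots> = (\<integral>\<^sup>+x. \<integral>\<^sup>+y. f (?T x) * g (vec_affine n 1 (?T x) y) \<partial>?L \<partial>?L)"
    by (subst nn_integral_cmult, measurable, subst nn_integral_shift_reflect) auto
  also have "\<dots> = (\<integral>\<^sup>+y. \<integral>\<^sup>+x. f (?T x) * g (vec_affine n 1 (?T x) y) \<partial>?L \<partial>?L)"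
    by (rule P.Fubini'[OF m1, symmetric])
  also have "\<dots> = (\<integral>\<^sup>+y. \<integral>\<^sup>+x. f (vec_affine n (- 1) (?T x) y) * g (?T x) \<partial>?L \<partial>?L)"
  proof (rule nn_integral_cong)
    fix y assume y: "y \<in> space ?L"
    let ?h = "\<lambda>x. f (vec_affine n (- 1) (?T x) y) * g (?T x)"
    have hm: "?h \<in> borel_measurable ?L"
      by (intro borel_measurable_times_ennreal fm[THEN measurable_compose[rotated]]
          gm[THEN measurable_compose[rotated]] vec_affine_measurable mat_apply_measurable
          measurable_const y)
    have "integral\<^sup>N ?L ?h = (\<integral>\<^sup>+x. ?h (vec_affine n 1 (?T' y) x) \<partial>?L)"
      by (rule nn_integral_shift_reflect[symmetric]) (simp, rule hm)
    also have "\<dots> = (\<integral>\<^sup>+x. f (?T x) * g (vec_affine n 1 (?T x) y) \<partial>?L)"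
    proof (rule nn_integral_cong)
      fix x assume "x \<in> space ?L"
      then have "?T x \<in> space ?L" by (rule measurable_space[OF mat_apply_measurable])
      from add_sub[OF this, of y] show "?h (vec_affine n 1 (?T' y) x) =
          f (?T x) * g (vec_affine n 1 (?T x) y)"
        unfolding sub[OF y] by simp
    qed
    finally show "(\<integral>\<^sup>+x. f (?T x) * g (vec_affine n 1 (?T x) y) \<partial>?L) = integral\<^sup>N ?L ?h"
      by simp
  qed
  also have "\<dots> = (\<integral>\<^sup>+x. \<integral>\<^sup>+y. f (vec_affine n (- 1) (?T x) y) * g (?T x) \<partial>?L \<partial>?L)"
    by (rule P.Fubini'[OF m2])
  also have "\<dots> = (\<integral>\<^sup>+x. V * g (?T x) \<partial>?L)"
    by (subst nn_integral_multc, measurable, subst nn_integral_shift_reflect) (auto simp: fV)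
  also have "\<dots> = V * (\<integral>\<^sup>+x. g (?T x) \<partial>?L)"
    by (rule nn_integral_cmult) measurable
  finally have "integral\<^sup>N ?L g = (\<integral>\<^sup>+x. g (?T x) \<partial>?L)"
    using punctured_ball_pos_finite[OF n] by (simp add: V_def ennreal_mult_cancel_left)
  also have "\<dots> = integral\<^sup>N ?D g"
    by (rule nn_integral_distr[symmetric]) simp_all
  finally show "emeasure ?D S = emeasure ?L S"
    by (simp add: g_def)
qed simp

lemma radial_projection_measurable:
  "(\<lambda>x. \<lambda>i\<in>{..<n}. x i / euclid_norm n x)
     \<in> restrict_space (lebesgue_n n) (punctured_ball n) \<rightarrow>\<^sub>M restrict_space (lebesgue_n n) (unit_sphere n)"
proof (rule measurable_restrict_space2)
  show "(\<lambda>x. \<lambda>i\<in>{..<n}. x i / euclid_norm n x)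
     \<in> restrict_space (lebesgue_n n) (punctured_ball n) \<rightarrow>\<^sub>M lebesgue_n n"
    by (intro measurable_restrict_space1 measurable_restrict) measurable
  show "(\<lambda>x. \<lambda>i\<in>{..<n}. x i / euclid_norm n x)
     \<in> space (restrict_space (lebesgue_n n) (punctured_ball n)) \<rightarrow> unit_sphere n"
  proof (rule funcsetI)
    fix x assume "x \<in> space (restrict_space (lebesgue_n n) (punctured_ball n))"
    then have x: "0 < euclid_norm n x" by (auto simp: space_restrict_space punctured_ball_def)
    have "euclid_norm n (\<lambda>i\<in>{..<n}. x i / euclid_norm n x) = euclid_norm n x / \<bar>euclid_norm n x\<bar>"
      by (subst (1 2) euclid_norm_def)
         (simp add: power_divide real_sqrt_divide flip: sum_divide_distrib)
    then show "(\<lambda>i\<in>{..<n}. x i / euclid_norm n x) \<in> unit_sphere n"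
      using x by (simp add: unit_sphere_def)
  qed
qed

lemma emeasure_sphere_measure:
  assumes "A \<in> sets (restrict_space (lebesgue_n n) (unit_sphere n))"
  shows "emeasure (sphere_measure n) A =
    emeasure (lebesgue_n n) {x \<in> punctured_ball n. (\<lambda>i\<in>{..<n}. x i / euclid_norm n x) \<in> A}
      / emeasure (lebesgue_n n) (punctured_ball n)"
proof -
  let ?R = "restrict_space (lebesgue_n n) (punctured_ball n)"
  let ?p = "\<lambda>x. \<lambda>i\<in>{..<n}. x i / euclid_norm n x"
  have sp: "space ?R = punctured_ball n"
    by (auto simp: space_restrict_space punctured_ball_def space_PiM)
  have m: "?p -` A \<inter> space ?R \<in> sets ?R"
    by (rule measurable_sets[OF radial_projection_measurable assms])
  have "emeasure (sphere_measure n) A = emeasure (uniform_measure ?R (punctured_ball n)) (?p -` A \<inter> space ?R)"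
    unfolding sphere_measure_def
    by (subst emeasure_distr) (use assms radial_projection_measurable in \<open>simp_all add: uniform_measure_def\<close>)
  also have "\<dots> = emeasure ?R (punctured_ball n \<inter> (?p -` A \<inter> space ?R)) / emeasure ?R (punctured_ball n)"
    using m sets.top[of ?R] by (intro emeasure_uniform_measure) (simp_all only: sp)
  also have "punctured_ball n \<inter> (?p -` A \<inter> space ?R) = {x \<in> punctured_ball n. ?p x \<in> A}"
    by (auto simp: sp)
  finally show ?thesis
    by (simp add: emeasure_restrict_space)
qed

lemma prob_space_sphere_measure:
  assumes "n \<ge> 1"
  shows "prob_space (sphere_measure n)"
proof
  have sp: "space (sphere_measure n) = unit_sphere n"
    by (auto simp: sphere_measure_def space_restrict_space unit_sphere_def space_PiM)
  have top: "unit_sphere n \<in> sets (restrict_space (lebesgue_n n) (unit_sphere n))"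
    by (simp add: sets_restrict_space_iff sets.sets_into_space Int_absorb2)
  have "{x \<in> punctured_ball n. (\<lambda>i\<in>{..<n}. x i / euclid_norm n x) \<in> unit_sphere n} = punctured_ball n"
    using measurable_space[OF radial_projection_measurable[of n]]
    by (auto simp: space_restrict_space punctured_ball_def space_PiM)
  then show "emeasure (sphere_measure n) (space (sphere_measure n)) = 1"
    using punctured_ball_pos_finite[OF assms]
    by (simp add: sp emeasure_sphere_measure[OF top] less_top)
qed

lemma sphere_measure_rotation_invariant:
  assumes Q: "orthogonal_mat n Q" and n: "n \<ge> 1"
  shows "distr (sphere_measure n) (sphere_measure n) (mat_apply n Q) = sphere_measure n"
proof (rule measure_eqI)
  let ?S = "restrict_space (lebesgue_n n) (unit_sphere n)"
  let ?p = "\<lambda>x. \<lambda>i\<in>{..<n}. x i / euclid_norm n x"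
  have sets [measurable_cong]: "sets (sphere_measure n) = sets ?S" by (simp add: sphere_measure_def)
  have sp: "space (sphere_measure n) = unit_sphere n"
    by (auto simp: sphere_measure_def space_restrict_space unit_sphere_def space_PiM)
  have "mat_apply n Q x \<in> unit_sphere n" if "x \<in> unit_sphere n" for x
    using that by (simp add: unit_sphere_def euclid_norm_mat_apply[OF Q] mat_apply_PiE)
  then have T: "mat_apply n Q \<in> ?S \<rightarrow>\<^sub>M ?S"
    by (intro measurable_restrict_space3 mat_apply_measurable funcsetI)
  then have T': "mat_apply n Q \<in> sphere_measure n \<rightarrow>\<^sub>M sphere_measure n"
    by (simp cong: measurable_cong_sets add: sets)
  fix A assume "A \<in> sets (distr (sphere_measure n) (sphere_measure n) (mat_apply n Q))"
  then have A: "A \<in> sets ?S" by (simp add: sets)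
  let ?A = "mat_apply n Q -` A \<inter> unit_sphere n"
  have A': "?A \<in> sets ?S"
    using measurable_sets[OF T' , of A] A by (simp add: sets sp)
  let ?C = "\<lambda>A. {x \<in> punctured_ball n. ?p x \<in> A}"
  have C: "?C A \<in> sets (lebesgue_n n)"
    using measurable_sets[OF radial_projection_measurable A]
    by (auto simp: sets_restrict_space_iff space_restrict_space vimage_def Int_def conj_commute
        punctured_ball_def space_PiM cong: conj_cong)
  have comm: "?p (mat_apply n Q x) = mat_apply n Q (?p x)" for x
    unfolding euclid_norm_mat_apply[OF Q]
    by (auto simp: fun_eq_iff mat_apply_def sum_divide_distrib)
  have pS: "?p x \<in> unit_sphere n" if "x \<in> punctured_ball n" for x
    using that measurable_space[OF radial_projection_measurable[of n], of x]
    by (auto simp: space_restrict_space punctured_ball_def space_PiM)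
  have eq: "?C ?A = mat_apply n Q -` ?C A \<inter> space (lebesgue_n n)"
  proof (intro set_eqI)
    fix x
    have "mat_apply n Q x \<in> {..<n} \<rightarrow>\<^sub>E UNIV" by (simp add: mat_apply_def)
    then have "mat_apply n Q x \<in> punctured_ball n \<longleftrightarrow> x \<in> punctured_ball n" if "x \<in> space (lebesgue_n n)"
      using that by (simp add: punctured_ball_def euclid_norm_mat_apply[OF Q] space_PiM)
    moreover have "x \<in> space (lebesgue_n n)" if "x \<in> punctured_ball n"
      using that by (simp add: punctured_ball_def space_PiM)
    ultimately show "x \<in> ?C ?A \<longleftrightarrow> x \<in> mat_apply n Q -` ?C A \<inter> space (lebesgue_n n)"
      unfolding vimage_def Int_iff mem_Collect_eq comm using pS by blast
  qed
  have "emeasure (lebesgue_n n) (?C A) = emeasure (distr (lebesgue_n n) (lebesgue_n n) (mat_apply n Q)) (?C A)"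
    by (simp only: lebesgue_n_orthogonal[OF Q n])
  also have "\<dots> = emeasure (lebesgue_n n) (?C ?A)"
    unfolding eq by (rule emeasure_distr[OF mat_apply_measurable C])
  finally have "emeasure (sphere_measure n) ?A = emeasure (sphere_measure n) A"
    by (simp add: emeasure_sphere_measure[OF A] emeasure_sphere_measure[OF A'])
  then show "emeasure (distr (sphere_measure n) (sphere_measure n) (mat_apply n Q)) A = emeasure (sphere_measure n) A"
    using A by (subst emeasure_distr[OF T']) (simp_all add: sets sp)
qed simp

end

theory Submission
  imports Defs
begin

text \<open>
  Integration by parts on the sphere, a consequence of rotation invariance, gives two facts with
  constants independent of \<open>n\<close>: hypercontractivity \<open>\<parallel>g h\<parallel> \<le> C \<parallel>g\<parallel> \<parallel>h\<parallel>\<close> for \<open>g\<close>, \<open>h\<close> of degree \<open>k\<close>,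
  and the bound \<open>C n\<^sup>k \<parallel>f\<parallel>\<close> for the Euclidean norm of the coefficient tensor of \<open>f\<close> of degree \<open>2 k\<close>.
  Furthermore \<open>dim M\<close> is at least of order \<open>n\<^sup>2\<^sup>k\<close>, while forms of degree \<open>k\<close> have only \<open>d \<le> n\<^sup>k\<close> coordinates,
  so that their unit ball lies in the convex hull of \<open>exp (O(d))\<close> lattice points.

  Upper bound: every \<open>f + r\<^sup>2\<^sup>k\<close> with \<open>f\<close> in the section is a convex combination of \<open>exp (O(d))\<close> products of
  lattice points, each of norm \<open>O(1)\<close>. By Maurey's empirical method it is within \<open>O(1 / \<surd>m)\<close> of an
  average of \<open>m\<close> of them, so \<open>exp (O(d m))\<close> balls of that radius cover the section; take \<open>m \<approx> dim M / d\<close>.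

  Lower bound: if the symmetric tensor of \<open>f\<close>, read as a Gram matrix, is bounded below by \<open>- 1\<close> on
  \<open>exp (O(d))\<close> pairs of lattice points, then \<open>f + r\<^sup>2\<^sup>k\<close> is a sum of squares. For \<open>f\<close> in a ball of radius of
  order \<open>n powr (- k / 2)\<close> each such condition removes only an exponentially small cap, so that at least
  half of the ball lies in the section.
\<close>

section \<open>Integration by parts on the sphere\<close>

text \<open>The rate is \<open>sqrt (d / D)\<close>, with \<open>d\<close> of order
  \<open>n^k\<close> and \<open>D = dim M\<close> of order \<open>n^(2k)\<close>. Factors
  \<open>exp (O(D))\<close> disappear in the \<open>D\<close>-th root, so a cover by
  \<open>exp (O(d m))\<close> balls is affordable for \<open>m\<close> up to order
  \<open>D / d\<close>, where the radius \<open>1 / sqrt m\<close> becomes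
  \<open>sqrt (d / D)\<close>. Conversely a cap at relative height \<open>t\<close> has relative
  volume at most \<open>exp (- t^2 D / 2)\<close>, so \<open>exp (O(d))\<close> caps are affordable
  once \<open>t\<close> is of order \<open>sqrt (d / D)\<close>; constraint vectors of norm
  \<open>O(n^(2k))\<close> and the threshold \<open>n^k\<close> then give the radius
  \<open>n^k / (t n^(2k))\<close>, again of this order.

  The norm inequalities must not lose powers of \<open>n\<close>.

  Volume refers to the completed Lebesgue measure, where \<open>measure\<close> of a nonmeasurable
  set is 0; the lower bound therefore includes a proof that the section, a convex set, is
  measurable.\<close>

definition sphere_mean :: "nat \<Rightarrow> ((nat \<Rightarrow> real) \<Rightarrow> real) \<Rightarrow> real" where
  "sphere_mean n f = (LINT x|sphere_measure n. f x)"

text \<open>A homogeneous polynomial function with its formal gradient, generated by the rules of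
  differentiation. Carrying the gradient as data replaces differentiability by induction over the
  construction. By \<open>cong\<close> only the components below \<open>n\<close> count.\<close>

inductive hom_grad ::
  "nat \<Rightarrow> nat \<Rightarrow> ((nat \<Rightarrow> real) \<Rightarrow> real) \<Rightarrow> (nat \<Rightarrow> (nat \<Rightarrow> real) \<Rightarrow> real) \<Rightarrow> bool"
  for n where
  zero: "hom_grad n m (\<lambda>x. 0) (\<lambda>i x. 0)"
| const: "hom_grad n 0 (\<lambda>x. c) (\<lambda>i x. 0)"
| var: "i < n \<Longrightarrow> hom_grad n 1 (\<lambda>x. x i) (\<lambda>j x. if i = j then 1 else 0)"
| add: "hom_grad n m f f' \<Longrightarrow> hom_grad n m g g' \<Longrightarrow>
    hom_grad n m (\<lambda>x. f x + g x) (\<lambda>i x. f' i x + g' i x)"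
| mult: "hom_grad n p f f' \<Longrightarrow> hom_grad n q g g' \<Longrightarrow>
    hom_grad n (p + q) (\<lambda>x. f x * g x) (\<lambda>i x. f' i x * g x + f x * g' i x)"
| cong: "hom_grad n m f f' \<Longrightarrow> (\<And>i x. i < n \<Longrightarrow> f' i x = g' i x) \<Longrightarrow> hom_grad n m f g'"

lemma unit_sphere_component_le:
  assumes "x \<in> unit_sphere n" "i < n"
  shows "\<bar>x i\<bar> \<le> 1"
proof -
  have "(\<Sum>j<n. (x j)\<^sup>2) = 1"
    using assms by (simp add: unit_sphere_def euclid_norm_def)
  moreover have "(x i)\<^sup>2 \<le> (\<Sum>j<n. (x j)\<^sup>2)"
    using assms by (intro member_le_sum) auto
  ultimately show ?thesis by (simp add: abs_square_le_1)
qed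

lemma hom_grad_measurable:
  assumes "hom_grad n m f f'"
  shows "f \<in> borel_measurable (lebesgue_n n)" "i < n \<Longrightarrow> f' i \<in> borel_measurable (lebesgue_n n)"
  using assms
proof (induction arbitrary: i)
  case (var j)
  { case 1 then show ?case using var by simp }
  { case 2 then show ?case by simp }
next
  case (cong m f f' g')
  { case 1 then show ?case using cong by simp }
  { case 2
    have "f' i = g' i" using cong 2 by auto
    then show ?case using cong.IH(2)[OF 2(1)] by simp }
qed simp_all

text \<open>Supplies the bounds behind the integrability claims on the sphere and behind the
  remainder constants in \<open>hom_grad_rot\<close>.\<close>

lemma hom_grad_bounded:
  assumes "hom_grad n m f f'"
  shows "\<exists>C. \<forall>x\<in>unit_sphere n. \<bar>f x\<bar> \<le> C \<and> (\<forall>i<n. \<bar>f' i x\<bar> \<le> C)"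
  using assms
proof induction
  case (const c)
  then show ?case by (intro exI[of _ "\<bar>c\<bar>"]) auto
next
  case (var i)
  then show ?case by (intro exI[of _ 1]) (auto simp: unit_sphere_component_le)
next
  case (add m f f' g g')
  then obtain C D where C: "\<forall>x\<in>unit_sphere n. \<bar>f x\<bar> \<le> C \<and> (\<forall>i<n. \<bar>f' i x\<bar> \<le> C)"
    and D: "\<forall>x\<in>unit_sphere n. \<bar>g x\<bar> \<le> D \<and> (\<forall>i<n. \<bar>g' i x\<bar> \<le> D)" by blast
  show ?case
    by (intro exI[of _ "C + D"]) (smt (verit) C D)
next
  case (mult p f f' q g g')
  then obtain C D where C: "\<forall>x\<in>unit_sphere n. \<bar>f x\<bar> \<le> C \<and> (\<forall>i<n. \<bar>f' i x\<bar> \<le> C)"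
    and D: "\<forall>x\<in>unit_sphere n. \<bar>g x\<bar> \<le> D \<and> (\<forall>i<n. \<bar>g' i x\<bar> \<le> D)" by blast
  have prod: "\<bar>a * b\<bar> \<le> \<bar>C\<bar> * \<bar>D\<bar>" if "\<bar>a\<bar> \<le> C" "\<bar>b\<bar> \<le> D" for a b
    using that by (simp add: abs_mult mult_mono)
  show ?case
  proof (intro exI[of _ "2 * (\<bar>C\<bar> * \<bar>D\<bar>)"] ballI conjI allI impI)
    fix x assume x: "x \<in> unit_sphere n"
    show "\<bar>f x * g x\<bar> \<le> 2 * (\<bar>C\<bar> * \<bar>D\<bar>)"
      using prod[of "f x" "g x"] C D x by fastforce
    fix i assume i: "i < n"
    show "\<bar>f' i x * g x + f x * g' i x\<bar> \<le> 2 * (\<bar>C\<bar> * \<bar>D\<bar>)"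
      using prod[of "f' i x" "g x"] prod[of "f x" "g' i x"] C D x i by fastforce
  qed
qed auto

lemma hom_grad_euler:
  assumes "hom_grad n m f f'"
  shows "(\<Sum>i<n. x i * f' i x) = real m * f x"
  using assms
proof induction
  case (mult p f f' q g g')
  have "(\<Sum>i<n. x i * (f' i x * g x + f x * g' i x)) =
      (\<Sum>i<n. x i * f' i x) * g x + f x * (\<Sum>i<n. x i * g' i x)"
    by (simp add: sum.distrib sum_distrib_left sum_distrib_right algebra_simps)
  then show ?case using mult by (simp add: algebra_simps)
next
  case (cong m f f' g')
  then show ?case by (auto intro: sum.cong)
qed (auto simp: algebra_simps sum.distrib if_distrib cong: if_cong)

text \<open>The rotation of the \<open>(i, j)\<close>-plane whose angle \<open>\<theta>\<close> has \<open>tan (\<theta> / 2) = t\<close>, so that the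
  matrix entries are rational in \<open>t\<close>.\<close>

definition rot_mat :: "nat \<Rightarrow> nat \<Rightarrow> real \<Rightarrow> nat \<Rightarrow> nat \<Rightarrow> real" where
  "rot_mat i j t a b =
    (if a = i then (if b = i then (1 - t\<^sup>2) / (1 + t\<^sup>2) else if b = j then - (2 * t / (1 + t\<^sup>2)) else 0)
     else if a = j then (if b = i then 2 * t / (1 + t\<^sup>2) else if b = j then (1 - t\<^sup>2) / (1 + t\<^sup>2) else 0)
     else if a = b then 1 else 0)"

lemma sum_two:
  fixes f :: "nat \<Rightarrow> real"
  assumes "i < n" "j < n" "i \<noteq> j" "\<And>l. l < n \<Longrightarrow> l \<noteq> i \<Longrightarrow> l \<noteq> j \<Longrightarrow> f l = 0"
  shows "(\<Sum>l<n. f l) = f i + f j"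
proof -
  have "(\<Sum>l<n. f l) = (\<Sum>l\<in>{i, j}. f l)"
    using assms by (intro sum.mono_neutral_right) auto
  then show ?thesis using assms by simp
qed

lemma orthogonal_rot_mat:
  assumes ij: "i < n" "j < n" "i \<noteq> j"
  shows "orthogonal_mat n (rot_mat i j t)"
proof -
  define c where "c = (1 - t\<^sup>2) / (1 + t\<^sup>2)"
  define s where "s = 2 * t / (1 + t\<^sup>2)"
  have nz: "1 + t\<^sup>2 \<noteq> 0" by (smt (verit) zero_le_power2)
  have "c\<^sup>2 + s\<^sup>2 = ((1 - t\<^sup>2)\<^sup>2 + (2 * t)\<^sup>2) / (1 + t\<^sup>2)\<^sup>2"
    unfolding c_def s_def by (simp add: power_divide add_divide_distrib)
  also have "(1 - t\<^sup>2)\<^sup>2 + (2 * t)\<^sup>2 = (1 + t\<^sup>2)\<^sup>2" by (simp add: power2_eq_square algebra_simps)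
  finally have cs: "c * c + s * s = 1" using nz by (simp add: power2_eq_square)
  have R: "rot_mat i j t a b =
    (if a = i then (if b = i then c else if b = j then - s else 0)
     else if a = j then (if b = i then s else if b = j then c else 0)
     else if a = b then 1 else 0)" for a b
    by (simp add: rot_mat_def c_def s_def)
  have single: "(\<Sum>l<n. f l) = f a" if "a < n" "\<And>l. l < n \<Longrightarrow> l \<noteq> a \<Longrightarrow> f l = 0" for f :: "nat \<Rightarrow> real" and a
    using that by (subst sum.mono_neutral_right[of _ "{a}"]) auto
  have row: "(\<Sum>l<n. rot_mat i j t a l * rot_mat i j t b l) = (if a = b then 1 else 0)"
    if "a < n" "b < n" for a b
  proof (cases "a \<noteq> i \<and> a \<noteq> j")
    case True
    then show ?thesis using that ij by (subst single[of a]) (auto simp: R)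
  next
    case False
    then show ?thesis using that ij cs by (subst sum_two[OF ij]) (auto simp: R algebra_simps)
  qed
  have col: "(\<Sum>l<n. rot_mat i j t l a * rot_mat i j t l b) = (if a = b then 1 else 0)"
    if "a < n" "b < n" for a b
  proof (cases "a \<noteq> i \<and> a \<noteq> j")
    case True
    then show ?thesis using that ij by (subst single[of a]) (auto simp: R)
  next
    case False
    then show ?thesis using that ij cs by (subst sum_two[OF ij]) (auto simp: R algebra_simps)
  qed
  show ?thesis using row col by (simp add: orthogonal_mat_def)
qed

lemma mat_apply_rot_mat:
  assumes "i < n" "j < n" "i \<noteq> j" "l < n"
  shows "mat_apply n (rot_mat i j t) x l =
    (if l = i then (1 - t\<^sup>2) / (1 + t\<^sup>2) * x i - 2 * t / (1 + t\<^sup>2) * x j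
     else if l = j then 2 * t / (1 + t\<^sup>2) * x i + (1 - t\<^sup>2) / (1 + t\<^sup>2) * x j else x l)"
proof (cases "l = i \<or> l = j")
  case True
  then show ?thesis using assms
    by (simp add: mat_apply_def) (subst sum_two[OF assms(1-3)]; auto simp: rot_mat_def)+
next
  case False
  then show ?thesis using assms
    by (simp add: mat_apply_def rot_mat_def sum.delta if_distrib[of "\<lambda>u. u * _"] cong: if_cong)
qed

lemma mat_apply_unit_sphere:
  assumes "orthogonal_mat n Q" "x \<in> unit_sphere n"
  shows "mat_apply n Q x \<in> unit_sphere n"
  using assms by (simp add: unit_sphere_def euclid_norm_mat_apply mat_apply_PiE)

text \<open>Cosine and sine to first order: the angle is \<open>2 * t\<close> up to higher order,
  because \<open>t\<close> is the tangent of its half.\<close>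

lemma rot_mat_entries:
  assumes "0 \<le> t" "t \<le> (1::real)"
  shows "\<bar>(1 - t\<^sup>2) / (1 + t\<^sup>2) - 1\<bar> \<le> 2 * t\<^sup>2" "\<bar>2 * t / (1 + t\<^sup>2) - 2 * t\<bar> \<le> 2 * t\<^sup>2"
proof -
  have p: "1 + t\<^sup>2 \<ge> 1" by simp
  have pos: "0 < 1 + t\<^sup>2" using p by linarith
  then have nz: "1 + t\<^sup>2 \<noteq> 0" by linarith
  have "(1 - t\<^sup>2) / (1 + t\<^sup>2) - 1 = - (2 * t\<^sup>2 / (1 + t\<^sup>2))" 
  proof -
    have "(1 - t\<^sup>2) / (1 + t\<^sup>2) - 1 = ((1 - t\<^sup>2) - (1 + t\<^sup>2)) / (1 + t\<^sup>2)"
      using nz by (subst diff_divide_distrib) simp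
    then show ?thesis by simp
  qed
  moreover have "2 * t\<^sup>2 / (1 + t\<^sup>2) \<le> 2 * t\<^sup>2 / 1" using p pos by (intro divide_left_mono) auto
  ultimately show "\<bar>(1 - t\<^sup>2) / (1 + t\<^sup>2) - 1\<bar> \<le> 2 * t\<^sup>2" by simp
  have "2 * t / (1 + t\<^sup>2) - 2 * t = - (2 * t\<^sup>2 * t / (1 + t\<^sup>2))"

  proof -
    have "2 * t / (1 + t\<^sup>2) - 2 * t = (2 * t - 2 * t * (1 + t\<^sup>2)) / (1 + t\<^sup>2)"
      using nz by (subst diff_divide_distrib) simp
    then show ?thesis by (simp add: algebra_simps)
  qed
  moreover have "2 * t\<^sup>2 * t / (1 + t\<^sup>2) \<le> 2 * t\<^sup>2 * t / 1"
    using p pos assms by (intro divide_left_mono) auto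
  moreover have "2 * t\<^sup>2 * t \<le> 2 * t\<^sup>2 * 1" using assms by (intro mult_left_mono) auto
  ultimately show "\<bar>2 * t / (1 + t\<^sup>2) - 2 * t\<bar> \<le> 2 * t\<^sup>2" using assms by simp
qed

text \<open>First-order expansion along the rotation, with the angular derivative as linear term;
  sums and products inherit it by induction. The remainder is uniform over the sphere because the
  estimate gets integrated at fixed \<open>t\<close>.\<close>

lemma hom_grad_rot:
  assumes "hom_grad n m f f'" "i < n" "j < n" "i \<noteq> j"
  shows "\<exists>C. \<forall>t. 0 \<le> t \<longrightarrow> t \<le> 1 \<longrightarrow> (\<forall>x\<in>unit_sphere n.
    \<bar>f (mat_apply n (rot_mat i j t) x) - f x - 2 * t * (x i * f' j x - x j * f' i x)\<bar> \<le> C * t\<^sup>2)"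
  using assms
proof induction
  case (var l)
  show ?case
  proof (intro exI[of _ 4] allI impI ballI)
    fix t :: real and x assume t: "0 \<le> t" "t \<le> 1" and x: "x \<in> unit_sphere n"
    let ?c = "(1 - t\<^sup>2) / (1 + t\<^sup>2)" and ?s = "2 * t / (1 + t\<^sup>2)"
    have b: "\<bar>(?c - 1) * x a\<bar> \<le> 2 * t\<^sup>2" "\<bar>(?s - 2 * t) * x a\<bar> \<le> 2 * t\<^sup>2" if "a < n" for a
    proof -
      have "\<bar>?c - 1\<bar> * \<bar>x a\<bar> \<le> 2 * t\<^sup>2 * 1" "\<bar>?s - 2 * t\<bar> * \<bar>x a\<bar> \<le> 2 * t\<^sup>2 * 1"
        by (rule mult_mono[OF rot_mat_entries(1)[OF t] unit_sphere_component_le[OF x that]]; simp)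
          (rule mult_mono[OF rot_mat_entries(2)[OF t] unit_sphere_component_le[OF x that]]; simp)
      then show "\<bar>(?c - 1) * x a\<bar> \<le> 2 * t\<^sup>2" "\<bar>(?s - 2 * t) * x a\<bar> \<le> 2 * t\<^sup>2"
        by (simp_all add: abs_mult)
    qed
    have abs2: "\<bar>p - q\<bar> \<le> 4 * M" "\<bar>p + q\<bar> \<le> 4 * M"
      if "\<bar>p\<bar> \<le> 2 * M" "\<bar>q\<bar> \<le> 2 * M" for p q M :: real
      using that by linarith+
    consider "l = i" | "l = j" | "l \<noteq> i" "l \<noteq> j" by blast
    then show "\<bar>mat_apply n (rot_mat i j t) x l - x l - 2 * t *
      (x i * (if l = j then 1 else 0) - x j * (if l = i then 1 else 0))\<bar> \<le> 4 * t\<^sup>2"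
    proof cases
      case 1
      then have "mat_apply n (rot_mat i j t) x l - x l - 2 * t *
        (x i * (if l = j then 1 else 0) - x j * (if l = i then 1 else 0)) =
        (?c - 1) * x i - (?s - 2 * t) * x j"
        using var by (simp add: mat_apply_rot_mat left_diff_distrib)
      then show ?thesis using abs2[OF b(1)[of i] b(2)[of j]] var by simp
    next
      case 2
      then have "mat_apply n (rot_mat i j t) x l - x l - 2 * t *
        (x i * (if l = j then 1 else 0) - x j * (if l = i then 1 else 0)) =
        (?c - 1) * x j + (?s - 2 * t) * x i"
        using var by (simp add: mat_apply_rot_mat left_diff_distrib)
      then show ?thesis using abs2[OF b(1)[of j] b(2)[of i]] var by simp
    next
      case 3
      then show ?thesis using var by (simp add: mat_apply_rot_mat)
    qed
  qed
next
  case (add m f f' g g')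
  then obtain C D where C: "\<And>t x. 0 \<le> t \<Longrightarrow> t \<le> 1 \<Longrightarrow> x\<in>unit_sphere n \<Longrightarrow>
    \<bar>f (mat_apply n (rot_mat i j t) x) - f x - 2 * t * (x i * f' j x - x j * f' i x)\<bar> \<le> C * t\<^sup>2"
    and D: "\<And>t x. 0 \<le> t \<Longrightarrow> t \<le> 1 \<Longrightarrow> x\<in>unit_sphere n \<Longrightarrow>
    \<bar>g (mat_apply n (rot_mat i j t) x) - g x - 2 * t * (x i * g' j x - x j * g' i x)\<bar> \<le> D * t\<^sup>2"
    by metis
  show ?case
  proof (intro exI[of _ "C + D"] allI impI ballI)
    fix t :: real and x assume t: "0 \<le> t" "t \<le> 1" and x: "x \<in> unit_sphere n"
    show "\<bar>f (mat_apply n (rot_mat i j t) x) + g (mat_apply n (rot_mat i j t) x) - (f x + g x) -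
      2 * t * (x i * (f' j x + g' j x) - x j * (f' i x + g' i x))\<bar> \<le> (C + D) * t\<^sup>2"
      using C[OF t x] D[OF t x] by (simp add: algebra_simps)
  qed
next
  case (mult p f f' q g g')
  let ?R = "\<lambda>t x. mat_apply n (rot_mat i j t) x"
  obtain C D where C: "\<And>t x. 0 \<le> t \<Longrightarrow> t \<le> 1 \<Longrightarrow> x\<in>unit_sphere n \<Longrightarrow>
    \<bar>f (?R t x) - f x - 2 * t * (x i * f' j x - x j * f' i x)\<bar> \<le> C * t\<^sup>2"
    and D: "\<And>t x. 0 \<le> t \<Longrightarrow> t \<le> 1 \<Longrightarrow> x\<in>unit_sphere n \<Longrightarrow>
    \<bar>g (?R t x) - g x - 2 * t * (x i * g' j x - x j * g' i x)\<bar> \<le> D * t\<^sup>2"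
    using mult by metis
  obtain A where A: "\<forall>x\<in>unit_sphere n. \<bar>f x\<bar> \<le> A \<and> (\<forall>i<n. \<bar>f' i x\<bar> \<le> A)"
    using hom_grad_bounded[OF mult(1)] by blast
  obtain B where B: "\<forall>x\<in>unit_sphere n. \<bar>g x\<bar> \<le> B \<and> (\<forall>i<n. \<bar>g' i x\<bar> \<le> B)"
    using hom_grad_bounded[OF mult(2)] by blast
  show ?case
  \<comment> \<open>The three terms bound the second-order product \<open>4 * t^2 * u * v\<close>
    with \<open>\<bar>u\<bar> \<le> 2 * A\<close> and \<open>\<bar>v\<bar> \<le> 2 * B\<close>, the
    error of \<open>f\<close> times the rotated \<open>g\<close>, and the error of \<open>g\<close>
    times \<open>f + 2 * t * u\<close>, which is at most \<open>A + 4 * A\<close>.\<close>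
  proof (intro exI[of _ "4 * A * (4 * B) + C * B + 5 * A * D"] allI impI ballI)
    fix t :: real and x assume t: "0 \<le> t" "t \<le> 1" and x: "x \<in> unit_sphere n"
    define u where "u = x i * f' j x - x j * f' i x"
    define v where "v = x i * g' j x - x j * g' i x"
    define e where "e = f (?R t x) - f x - 2 * t * u"
    define e' where "e' = g (?R t x) - g x - 2 * t * v"
    have Rx: "?R t x \<in> unit_sphere n"
      by (rule mat_apply_unit_sphere[OF orthogonal_rot_mat x]) (use mult in auto)
    have A0: "0 \<le> A" and B0: "0 \<le> B" using A B x by (auto intro: order_trans[OF abs_ge_zero])
    have diff: "\<bar>x i * a - x j * b\<bar> \<le> 2 * M" if "\<bar>a\<bar> \<le> M" "\<bar>b\<bar> \<le> M" for a b M
    proof -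
      have "\<bar>x i\<bar> * \<bar>a\<bar> \<le> 1 * M" "\<bar>x j\<bar> * \<bar>b\<bar> \<le> 1 * M"
        by (rule mult_mono[OF unit_sphere_component_le[OF x mult.prems(1)] that(1)]; simp)
          (rule mult_mono[OF unit_sphere_component_le[OF x mult.prems(2)] that(2)]; simp)
      then show ?thesis using abs_triangle_ineq4[of "x i * a" "x j * b"] by (simp add: abs_mult)
    qed
    have u: "\<bar>u\<bar> \<le> 2 * A" unfolding u_def using A x mult.prems by (intro diff) auto
    have v: "\<bar>v\<bar> \<le> 2 * B" unfolding v_def using B x mult.prems by (intro diff) auto
    have e: "\<bar>e\<bar> \<le> C * t\<^sup>2" and e': "\<bar>e'\<bar> \<le> D * t\<^sup>2"
      using C[OF t x] D[OF t x] by (simp_all add: e_def e'_def u_def v_def)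
    have "f (?R t x) = f x + 2 * t * u + e" "g (?R t x) = g x + 2 * t * v + e'"
      by (simp_all add: e_def e'_def)
    then have "f (?R t x) * g (?R t x) = (f x + 2 * t * u) * (g x + 2 * t * v + e') + e * g (?R t x)"
      by (metis distrib_right)
    moreover have "x i * (f' j x * g x + f x * g' j x) - x j * (f' i x * g x + f x * g' i x) = u * g x + f x * v"
      by (simp add: u_def v_def algebra_simps)
    ultimately have "f (?R t x) * g (?R t x) - f x * g x -
      2 * t * (x i * (f' j x * g x + f x * g' j x) - x j * (f' i x * g x + f x * g' i x))
      = 4 * t\<^sup>2 * (u * v) + e * g (?R t x) + (f x + 2 * t * u) * e'"
      by (simp add: algebra_simps power2_eq_square)
    moreover have "\<bar>4 * t\<^sup>2 * (u * v)\<bar> \<le> (4 * A * (4 * B)) * t\<^sup>2"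
    proof -
      have "\<bar>u\<bar> * \<bar>v\<bar> \<le> (2 * A) * (2 * B)" using u v A0 by (intro mult_mono) auto
      then have "4 * t\<^sup>2 * (\<bar>u\<bar> * \<bar>v\<bar>) \<le> 4 * t\<^sup>2 * ((2 * A) * (2 * B))" by (intro mult_left_mono) auto
      then show ?thesis by (simp add: abs_mult algebra_simps)
    qed
    moreover have "\<bar>e * g (?R t x)\<bar> \<le> C * B * t\<^sup>2"
    proof -
      have "\<bar>e\<bar> * \<bar>g (?R t x)\<bar> \<le> (C * t\<^sup>2) * B" using e B Rx by (intro mult_mono) auto
      then show ?thesis by (simp add: abs_mult algebra_simps)
    qed
    moreover have "\<bar>(f x + 2 * t * u) * e'\<bar> \<le> 5 * A * D * t\<^sup>2"
    proof -
      have "t * \<bar>u\<bar> \<le> 1 * (2 * A)" using t u by (intro mult_mono) auto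
      then have "\<bar>f x + 2 * t * u\<bar> \<le> 5 * A"
        using A x t abs_triangle_ineq[of "f x" "2 * t * u"] by (fastforce simp: abs_mult)
      then have "\<bar>f x + 2 * t * u\<bar> * \<bar>e'\<bar> \<le> (5 * A) * (D * t\<^sup>2)" using e' A0 by (intro mult_mono) auto
      then show ?thesis by (simp only: abs_mult mult_ac)
    qed
    ultimately show "\<bar>f (?R t x) * g (?R t x) - f x * g x -
      2 * t * (x i * (f' j x * g x + f x * g' j x) - x j * (f' i x * g x + f x * g' i x))\<bar>
      \<le> (4 * A * (4 * B) + C * B + 5 * A * D) * t\<^sup>2"
      by (simp only: distrib_right)
  qed
next
  case (cong m f f' g')
  then show ?case by (metis (no_types, lifting))
qed (auto intro: exI[of _ 0])

section \<open>Integrability and rotation invariance of means over the sphere\<close>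

lemma space_sphere_measure: "space (sphere_measure n) = unit_sphere n"
  by (auto simp: sphere_measure_def space_restrict_space unit_sphere_def space_PiM)

lemma measurable_sphere_measure:
  assumes "f \<in> borel_measurable (lebesgue_n n)"
  shows "f \<in> borel_measurable (sphere_measure n)"
  using measurable_restrict_space1[OF assms, of "unit_sphere n"]
  by (simp add: sphere_measure_def)

lemma integrable_sphere_measure:
  fixes f :: "(nat \<Rightarrow> real) \<Rightarrow> real"
  assumes "n \<ge> 1" "f \<in> borel_measurable (lebesgue_n n)" "\<And>x. x \<in> unit_sphere n \<Longrightarrow> \<bar>f x\<bar> \<le> C"
  shows "integrable (sphere_measure n) f"
proof -
  interpret prob_space "sphere_measure n" by (rule prob_space_sphere_measure[OF assms(1)])
  show ?thesis
    using assms by (intro integrable_const_bound[of _ C] AE_I2 measurable_sphere_measure)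
      (auto simp: space_sphere_measure)
qed

lemma integrable_hom_grad:
  assumes "n \<ge> 1" "hom_grad n m f f'"
  shows "integrable (sphere_measure n) f" "i < n \<Longrightarrow> integrable (sphere_measure n) (f' i)"
proof -
  obtain C where "\<forall>x\<in>unit_sphere n. \<bar>f x\<bar> \<le> C \<and> (\<forall>i<n. \<bar>f' i x\<bar> \<le> C)"
    using hom_grad_bounded[OF assms(2)] by blast
  then show "integrable (sphere_measure n) f" "i < n \<Longrightarrow> integrable (sphere_measure n) (f' i)"
    using hom_grad_measurable[OF assms(2)] by (auto intro!: integrable_sphere_measure[OF assms(1), of _ C])
qed

lemma integrable_coord_mult:
  assumes "n \<ge> 1" "hom_grad n m f f'" "i < n" "j < n"
  shows "integrable (sphere_measure n) (\<lambda>x. x i * f' j x)"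
proof -
  obtain C where C: "\<forall>x\<in>unit_sphere n. \<bar>f x\<bar> \<le> C \<and> (\<forall>i<n. \<bar>f' i x\<bar> \<le> C)"
    using hom_grad_bounded[OF assms(2)] by blast
  have "\<bar>x i * f' j x\<bar> \<le> 1 * C" if "x \<in> unit_sphere n" for x
    unfolding abs_mult using that C assms unit_sphere_component_le[OF that] by (intro mult_mono) auto
  moreover have "(\<lambda>x. x i * f' j x) \<in> borel_measurable (lebesgue_n n)"
    using hom_grad_measurable(2)[OF assms(2,4)] assms(3) by simp
  ultimately show ?thesis using assms(1) by (intro integrable_sphere_measure) auto
qed

lemma sphere_mean_rotation_invariant:
  assumes Q: "orthogonal_mat n Q" and n: "n \<ge> 1" and f: "f \<in> borel_measurable (sphere_measure n)"
  shows "sphere_mean n (\<lambda>x. f (mat_apply n Q x)) = sphere_mean n f"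
proof -
  have sets: "sets (sphere_measure n) = sets (restrict_space (lebesgue_n n) (unit_sphere n))"
    by (simp add: sphere_measure_def)
  have "mat_apply n Q \<in> restrict_space (lebesgue_n n) (unit_sphere n) \<rightarrow>\<^sub>M
      restrict_space (lebesgue_n n) (unit_sphere n)"
    by (intro measurable_restrict_space3 mat_apply_measurable funcsetI mat_apply_unit_sphere Q)
  then have T: "mat_apply n Q \<in> sphere_measure n \<rightarrow>\<^sub>M sphere_measure n"
    by (simp cong: measurable_cong_sets add: sets)
  have "sphere_mean n f = (LINT x|distr (sphere_measure n) (sphere_measure n) (mat_apply n Q). f x)"
    unfolding sphere_mean_def sphere_measure_rotation_invariant[OF Q n] ..
  also have "\<dots> = sphere_mean n (\<lambda>x. f (mat_apply n Q x))"
    unfolding sphere_mean_def by (rule integral_distr[OF T f])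
  finally show ?thesis ..
qed

text \<open>A rotation does not change the mean of \<open>f\<close>, so the linear term of the
  expansion, \<open>2 * t\<close> times the mean of the angular derivative, is \<open>O(t^2)\<close>
  for all small \<open>t\<close> and must vanish.\<close>

lemma sphere_mean_rot_deriv:
  assumes "n \<ge> 1" "hom_grad n m f f'" "i < n" "j < n"
  shows "sphere_mean n (\<lambda>x. x i * f' j x) = sphere_mean n (\<lambda>x. x j * f' i x)"
proof (cases "i = j")
  case False
  interpret prob_space "sphere_measure n" by (rule prob_space_sphere_measure[OF assms(1)])
  obtain C where C: "\<And>t x. 0 \<le> t \<Longrightarrow> t \<le> 1 \<Longrightarrow> x\<in>unit_sphere n \<Longrightarrow>
    \<bar>f (mat_apply n (rot_mat i j t) x) - f x - 2 * t * (x i * f' j x - x j * f' i x)\<bar> \<le> C * t\<^sup>2"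
    using hom_grad_rot[OF assms(2-4) False] by blast
  define g where "g x = x i * f' j x - x j * f' i x" for x
  have gi: "integrable (sphere_measure n) g"
    unfolding g_def using assms by (intro Bochner_Integration.integrable_diff integrable_coord_mult)
  have fi: "integrable (sphere_measure n) f" by (rule integrable_hom_grad[OF assms(1,2)])
  have key: "\<bar>2 * t * sphere_mean n g\<bar> \<le> C * t\<^sup>2" if t: "0 \<le> t" "t \<le> 1" for t
  proof -
    let ?R = "mat_apply n (rot_mat i j t)"
    have Q: "orthogonal_mat n (rot_mat i j t)" using assms False by (intro orthogonal_rot_mat)
    obtain B where B: "\<forall>x\<in>unit_sphere n. \<bar>f x\<bar> \<le> B \<and> (\<forall>i<n. \<bar>f' i x\<bar> \<le> B)"
      using hom_grad_bounded[OF assms(2)] by blast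
    have fRi: "integrable (sphere_measure n) (\<lambda>x. f (?R x))"
      by (rule integrable_sphere_measure[OF assms(1), of _ B])
        (use B mat_apply_unit_sphere[OF Q] measurable_compose[OF mat_apply_measurable hom_grad_measurable(1)[OF assms(2)]]
         in auto)
    have "sphere_mean n (\<lambda>x. f (?R x)) = sphere_mean n f"
      using fi by (intro sphere_mean_rotation_invariant[OF Q assms(1)]) auto
    then have "- (2 * t * sphere_mean n g) = (LINT x|sphere_measure n. f (?R x) - f x - 2 * t * g x)"
      using fi fRi gi by (simp add: sphere_mean_def)
    also have "\<bar>\<dots>\<bar> \<le> (LINT x|sphere_measure n. \<bar>f (?R x) - f x - 2 * t * g x\<bar>)"
      by (rule integral_abs_bound)
    also have "\<dots> \<le> (LINT x|sphere_measure n. C * t\<^sup>2)"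
      using fi fRi gi C[OF t] by (intro integral_mono) (auto simp: space_sphere_measure g_def[symmetric])
    finally show ?thesis by (simp add: prob_space)
  qed
  have "sphere_mean n g = 0"
  proof (rule ccontr)
    assume nz: "sphere_mean n g \<noteq> 0"
    define a where "a = \<bar>sphere_mean n g\<bar>"
    have a: "a > 0" using nz by (simp add: a_def)
    have b: "2 * a \<le> C * t" if "0 < t" "t \<le> 1" for t
    proof -
      have "2 * t * a \<le> C * t\<^sup>2" using key[of t] that by (simp add: a_def abs_mult)
      then have "t * (2 * a) \<le> t * (C * t)" by (simp add: power2_eq_square algebra_simps)
      then show ?thesis using that by simp
    qed
    have C0: "C > 0" using b[of 1] a by simp
    define t where "t = min 1 (a / C)"
    have t: "0 < t" "t \<le> 1" "t \<le> a / C" using a C0 by (auto simp: t_def)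
    then have "C * t \<le> a" using C0 by (simp add: field_simps)
    with b[OF t(1,2)] a show False by simp
  qed
  moreover have "sphere_mean n g = sphere_mean n (\<lambda>x. x i * f' j x) - sphere_mean n (\<lambda>x. x j * f' i x)"
    unfolding g_def sphere_mean_def using assms
    by (intro Bochner_Integration.integral_diff integrable_coord_mult)
  ultimately show ?thesis by simp
qed simp

text \<open>Integration by parts on the sphere: sum over \<open>i\<close> the infinitesimal rotation invariance in the
  \<open>(i, j)\<close>-plane applied to \<open>x\<^sub>i h\<close>, and use Euler's identity and \<open>\<Sum>\<^sub>i x\<^sub>i\<^sup>2 = 1\<close>.\<close>

lemma sphere_mean_coord_mult:
  assumes n: "n \<ge> 1" and h: "hom_grad n m h h'" and j: "j < n"
  shows "(real n + real m - 1) * sphere_mean n (\<lambda>x. x j * h x) = sphere_mean n (h' j)"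
proof -
  let ?M = "sphere_measure n"
  have hg: "hom_grad n (1 + m) (\<lambda>x. x i * h x) (\<lambda>l x. (if i = l then 1 else 0) * h x + x i * h' l x)"
    if "i < n" for i
    using hom_grad.mult[OF hom_grad.var[OF that] h] .
  have jh: "integrable ?M (\<lambda>x. x j * h x)" using integrable_hom_grad(1)[OF n hg[OF j]] .
  have hj: "integrable ?M (h' j)" using integrable_hom_grad(2)[OF n h j] .
  have "(\<Sum>i<n. sphere_mean n (\<lambda>x. x i * ((if i = j then 1 else 0) * h x + x i * h' j x)))
     = (\<Sum>i<n. sphere_mean n (\<lambda>x. x j * ((if i = i then 1 else 0) * h x + x i * h' i x)))"
    using sphere_mean_rot_deriv[OF n hg _ j] by (intro sum.cong refl) auto
  also have "\<dots> = sphere_mean n (\<lambda>x. \<Sum>i<n. x j * ((if i = i then 1 else 0) * h x + x i * h' i x))"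
    unfolding sphere_mean_def
    by (rule Bochner_Integration.integral_sum[symmetric]) (rule integrable_coord_mult[OF n hg j]; simp)
  also have "\<dots> = sphere_mean n (\<lambda>x. (real n + real m) * (x j * h x))"
  proof -
    have "(\<Sum>i<n. x j * ((if i = i then 1 else 0) * h x + x i * h' i x)) =
       real n * (x j * h x) + x j * (\<Sum>i<n. x i * h' i x)" for x
      by (simp add: distrib_left sum.distrib sum_distrib_left)
    then show ?thesis by (simp add: hom_grad_euler[OF h] algebra_simps)
  qed
  also have "\<dots> = (real n + real m) * sphere_mean n (\<lambda>x. x j * h x)"
    by (simp add: sphere_mean_def)
  finally have 1: "(\<Sum>i<n. sphere_mean n (\<lambda>x. x i * ((if i = j then 1 else 0) * h x + x i * h' j x))) =
    (real n + real m) * sphere_mean n (\<lambda>x. x j * h x)" .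
  have "(\<Sum>i<n. sphere_mean n (\<lambda>x. x i * ((if i = j then 1 else 0) * h x + x i * h' j x))) =
     sphere_mean n (\<lambda>x. \<Sum>i<n. x i * ((if i = j then 1 else 0) * h x + x i * h' j x))"
    unfolding sphere_mean_def
    by (rule Bochner_Integration.integral_sum[symmetric]) (rule integrable_coord_mult[OF n hg _ j]; simp)
  also have "\<dots> = sphere_mean n (\<lambda>x. x j * h x + h' j x)"
    unfolding sphere_mean_def
  proof (rule Bochner_Integration.integral_cong[OF refl])
    fix x assume "x \<in> space ?M"
    then have 1: "(\<Sum>i<n. (x i)\<^sup>2) = 1"
      by (simp add: space_sphere_measure unit_sphere_def euclid_norm_def)
    have "(\<Sum>i<n. x i * ((if i = j then 1 else 0) * h x + x i * h' j x)) =
      (\<Sum>i<n. if i = j then x i * h x else 0) + (\<Sum>i<n. (x i)\<^sup>2) * h' j x"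
      unfolding sum_distrib_right sum.distrib[symmetric]
      by (intro sum.cong) (auto simp: power2_eq_square algebra_simps)
    also have "\<dots> = x j * h x + h' j x" using j by (simp add: 1)
    finally show "(\<Sum>i<n. x i * ((if i = j then 1 else 0) * h x + x i * h' j x)) = x j * h x + h' j x" .
  qed
  also have "\<dots> = sphere_mean n (\<lambda>x. x j * h x) + sphere_mean n (h' j)"
    unfolding sphere_mean_def using jh hj by simp
  finally show ?thesis using 1 by (simp add: algebra_simps)
qed

section \<open>Forms as symmetric tensors\<close>

lemma hom_grad_sum:
  assumes "\<And>\<alpha>. \<alpha> \<in> A \<Longrightarrow> hom_grad n m (f \<alpha>) (f' \<alpha>)"
  shows "hom_grad n m (\<lambda>x. \<Sum>\<alpha>\<in>A. f \<alpha> x) (\<lambda>i x. \<Sum>\<alpha>\<in>A. f' \<alpha> i x)"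
  using assms
proof (induction A rule: infinite_finite_induct)
  case (insert \<alpha> A)
  then have "hom_grad n m (\<lambda>x. f \<alpha> x + (\<Sum>\<alpha>\<in>A. f \<alpha> x)) (\<lambda>i x. f' \<alpha> i x + (\<Sum>\<alpha>\<in>A. f' \<alpha> i x))"
    by (intro hom_grad.add) auto
  with insert show ?case by simp
qed (auto intro: hom_grad.zero)

lemma sphere_mean_sum:
  assumes "\<And>\<alpha>. \<alpha> \<in> A \<Longrightarrow> integrable (sphere_measure n) (f \<alpha>)"
  shows "sphere_mean n (\<lambda>x. \<Sum>\<alpha>\<in>A. f \<alpha> x) = (\<Sum>\<alpha>\<in>A. sphere_mean n (f \<alpha>))"
  unfolding sphere_mean_def using assms by (rule Bochner_Integration.integral_sum)

lemma sphere_mean_add: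
  assumes "integrable (sphere_measure n) f" "integrable (sphere_measure n) g"
  shows "sphere_mean n (\<lambda>x. f x + g x) = sphere_mean n f + sphere_mean n g"
  unfolding sphere_mean_def using assms by (rule Bochner_Integration.integral_add)

lemma sphere_mean_cmult: "sphere_mean n (\<lambda>x. c * f x) = c * sphere_mean n f"
  by (simp add: sphere_mean_def)

lemma sphere_mean_const: "n \<ge> 1 \<Longrightarrow> sphere_mean n (\<lambda>x. c) = c"
  using prob_space.prob_space[OF prob_space_sphere_measure] by (simp add: sphere_mean_def)

lemma sphere_mean_mono:
  assumes "integrable (sphere_measure n) f" "integrable (sphere_measure n) g"
    "\<And>x. x \<in> unit_sphere n \<Longrightarrow> f x \<le> g x"
  shows "sphere_mean n f \<le> sphere_mean n g"
  unfolding sphere_mean_def using assms by (intro integral_mono) (auto simp: space_sphere_measure)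

lemma sphere_mean_nonneg:
  assumes "\<And>x. x \<in> unit_sphere n \<Longrightarrow> 0 \<le> f x"
  shows "0 \<le> sphere_mean n f"
  unfolding sphere_mean_def using assms by (intro integral_nonneg_AE AE_I2) (auto simp: space_sphere_measure)

text \<open>Ordered index lists instead of monomials: a form becomes a full tensor with
  \<open>n ^ m\<close> entries, and fixing a slot, contracting two slots or splitting a tensor into
  a matrix are operations on lists.\<close>

definition idx :: "nat \<Rightarrow> nat \<Rightarrow> nat list set" where
  "idx n m = {I. set I \<subseteq> {..<n} \<and> length I = m}"

lemma finite_idx [simp]: "finite (idx n m)"
  by (simp add: idx_def finite_lists_length_eq)

lemma card_idx: "card (idx n m) = n ^ m"
  by (simp add: idx_def card_lists_length_eq)

lemma idx_0 [simp]: "idx n 0 = {[]}"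
  by (auto simp: idx_def)

lemma sum_idx_Suc: "(\<Sum>I\<in>idx n (Suc m). g I) = (\<Sum>i<n. \<Sum>J\<in>idx n m. g (i # J))"
proof -
  have "idx n (Suc m) = (\<lambda>(i, J). i # J) ` ({..<n} \<times> idx n m)"
    by (auto simp: idx_def image_iff length_Suc_conv)
  then have "(\<Sum>I\<in>idx n (Suc m). g I) = (\<Sum>(i, J)\<in>{..<n} \<times> idx n m. g (i # J))"
    by (simp add: sum.reindex inj_on_def case_prod_beta)
  then show ?thesis by (simp add: sum.cartesian_product)
qed

definition tform :: "nat \<Rightarrow> nat \<Rightarrow> (nat list \<Rightarrow> real) \<Rightarrow> (nat \<Rightarrow> real) \<Rightarrow> real" where
  "tform n m a x = (\<Sum>I\<in>idx n m. a I * (\<Prod>i\<leftarrow>I. x i))"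

definition sym_tensor :: "(nat list \<Rightarrow> real) \<Rightarrow> bool" where
  "sym_tensor a \<longleftrightarrow> (\<forall>I J. mset I = mset J \<longrightarrow> a I = a J)"

text \<open>For a symmetric tensor of degree \<open>m\<close> this is the tensor of the Laplacian,
  divided by \<open>m * (m - 1)\<close>.\<close>

definition tensor_tr :: "nat \<Rightarrow> (nat list \<Rightarrow> real) \<Rightarrow> nat list \<Rightarrow> real" where
  "tensor_tr n a = (\<lambda>J. \<Sum>i<n. a (i # i # J))"

lemma tform_0: "tform n 0 a x = a []"
  by (simp add: tform_def)

lemma tform_Suc: "tform n (Suc m) a x = (\<Sum>i<n. x i * tform n m (\<lambda>J. a (i # J)) x)"
  by (simp add: tform_def sum_idx_Suc sum_distrib_left mult_ac)

lemma tform_tensor_tr: "tform n m (tensor_tr n a) x = (\<Sum>i<n. tform n m (\<lambda>J. a (i # i # J)) x)"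
  unfolding tform_def tensor_tr_def sum_distrib_right by (rule sum.swap)

lemma sym_tensor_Cons: "sym_tensor a \<Longrightarrow> sym_tensor (\<lambda>J. a (i # J))"
  by (simp add: sym_tensor_def)

lemma sym_tensor_tr: "sym_tensor a \<Longrightarrow> sym_tensor (tensor_tr n a)"
  unfolding sym_tensor_def tensor_tr_def
  by (intro allI impI sum.cong refl) simp

lemma sym_tensor_tr_pow: "sym_tensor a \<Longrightarrow> sym_tensor ((tensor_tr n ^^ \<alpha>) a)"
  by (induction \<alpha>) (auto intro: sym_tensor_tr)

lemma sym_tensor_swap: "sym_tensor a \<Longrightarrow> a (i # j # J) = a (j # i # J)"
  by (simp add: sym_tensor_def)

lemma tensor_tr_Cons:
  assumes "sym_tensor a"
  shows "(\<lambda>J. tensor_tr n a (i # J)) = tensor_tr n (\<lambda>J. a (i # J))"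
  unfolding tensor_tr_def
proof (intro ext sum.cong refl)
  fix J l
  have "mset (l # l # i # J) = mset (i # l # l # J)" by simp
  then show "a (l # l # i # J) = a (i # l # l # J)"
    using assms unfolding sym_tensor_def by blast
qed

lemma tensor_tr_pow_Cons:
  assumes "sym_tensor a"
  shows "(\<lambda>J. (tensor_tr n ^^ \<alpha>) a (i # J)) = (tensor_tr n ^^ \<alpha>) (\<lambda>J. a (i # J))"
proof (induction \<alpha>)
  case (Suc \<alpha>)
  have "(\<lambda>J. (tensor_tr n ^^ Suc \<alpha>) a (i # J)) = tensor_tr n (\<lambda>J. (tensor_tr n ^^ \<alpha>) a (i # J))"
    using tensor_tr_Cons[OF sym_tensor_tr_pow[OF assms]] by simp
  then show ?case by (simp add: Suc)
qed simp

text \<open>By symmetry each of the \<open>m\<close> slots contributes the same derivative. For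
  \<open>m = 0\<close> the factor vanishes, so the truncated \<open>m - 1\<close> does no
  harm.\<close>

lemma hom_grad_tform:
  assumes "sym_tensor a"
  shows "hom_grad n m (tform n m a) (\<lambda>i x. real m * tform n (m - 1) (\<lambda>J. a (i # J)) x)"
  using assms
proof (induction m arbitrary: a)
  case 0
  have "tform n 0 a = (\<lambda>x. a [])" by (simp add: fun_eq_iff tform_0)
  then show ?case using hom_grad.const[of n "a []"] by simp
next
  case (Suc m)
  let ?b = "\<lambda>i J. a (i # J)"
  have "hom_grad n (1 + m) (\<lambda>x. x i * tform n m (?b i) x)
     (\<lambda>j x. (if i = j then 1 else 0) * tform n m (?b i) x +
            x i * (real m * tform n (m - 1) (\<lambda>J. a (i # j # J)) x))" if "i < n" for i
    using hom_grad.mult[OF hom_grad.var[OF that] Suc.IH[OF sym_tensor_Cons[OF Suc.prems, of i]]] .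
  then have "hom_grad n (1 + m) (\<lambda>x. \<Sum>i<n. x i * tform n m (?b i) x)
     (\<lambda>j x. \<Sum>i<n. (if i = j then 1 else 0) * tform n m (?b i) x +
            x i * (real m * tform n (m - 1) (\<lambda>J. a (i # j # J)) x))"
    by (intro hom_grad_sum) simp
  then have "hom_grad n (1 + m) (\<lambda>x. \<Sum>i<n. x i * tform n m (?b i) x)
     (\<lambda>j x. real (Suc m) * tform n (Suc m - 1) (?b j) x)"
  proof (rule hom_grad.cong)
    fix j x assume j: "j < n"
    have "(\<Sum>i<n. x i * (real m * tform n (m - 1) (\<lambda>J. a (i # j # J)) x)) = real m * tform n m (?b j) x"
    proof (cases m)
      case (Suc l)
      then show ?thesis
        by (simp add: tform_Suc sum_distrib_left mult_ac sym_tensor_swap[OF Suc.prems, of _ j])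
    qed simp
    moreover have "(\<Sum>i<n. (if i = j then 1 else 0) * tform n m (?b i) x) = tform n m (?b j) x"
      using j by (simp add: if_distrib[of "\<lambda>u. u * _"] cong: if_cong)
    ultimately show "(\<Sum>i<n. (if i = j then 1 else 0) * tform n m (?b i) x +
        x i * (real m * tform n (m - 1) (\<lambda>J. a (i # j # J)) x))
      = real (Suc m) * tform n (Suc m - 1) (?b j) x"
      by (simp add: sum.distrib distrib_right)
  qed
  then show ?case by (simp add: tform_Suc[abs_def])
qed

text \<open>Forgets degree and gradient, so that integrability of products and powers follows from
  introduction rules.\<close>

definition hom_fun :: "nat \<Rightarrow> ((nat \<Rightarrow> real) \<Rightarrow> real) \<Rightarrow> bool" where
  "hom_fun n f \<longleftrightarrow> (\<exists>m f'. hom_grad n m f f')"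

lemma integrable_hom_fun: "n \<ge> 1 \<Longrightarrow> hom_fun n f \<Longrightarrow> integrable (sphere_measure n) f"
  by (auto simp: hom_fun_def intro: integrable_hom_grad)

lemma hom_fun_mult: "hom_fun n f \<Longrightarrow> hom_fun n g \<Longrightarrow> hom_fun n (\<lambda>x. f x * g x)"
  unfolding hom_fun_def by (blast intro: hom_grad.mult)

lemma hom_fun_power2: "hom_fun n f \<Longrightarrow> hom_fun n (\<lambda>x. (f x)\<^sup>2)"
  unfolding power2_eq_square by (rule hom_fun_mult)

lemma hom_fun_tform: "sym_tensor a \<Longrightarrow> hom_fun n (tform n m a)"
  unfolding hom_fun_def by (blast intro: hom_grad_tform)

section \<open>Second moments of symmetric tensors and their traces\<close>

definition tmean :: "nat \<Rightarrow> nat \<Rightarrow> (nat list \<Rightarrow> real) \<Rightarrow> nat \<Rightarrow> (nat list \<Rightarrow> real) \<Rightarrow> real" where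
  "tmean n p b q c = sphere_mean n (\<lambda>x. tform n p b x * tform n q c x)"

lemma tmean_commute: "tmean n p b q c = tmean n q c p b"
  by (simp add: tmean_def mult.commute)

lemma tmean_square_nonneg: "0 \<le> tmean n p b p b"
  unfolding tmean_def by (rule sphere_mean_nonneg) simp

lemma integrable_tform_mult:
  assumes "n \<ge> 1" "sym_tensor b" "sym_tensor c"
  shows "integrable (sphere_measure n) (\<lambda>x. tform n p b x * tform n q c x)"
  using assms by (intro integrable_hom_fun hom_fun_mult hom_fun_tform)

text \<open>Split one variable off the left factor and integrate it by parts against the remaining
  product of degree \<open>p + q\<close>. The derivative hits either the left factor, producing a
  trace, or the right one, producing a contraction; in both terms the total degree has dropped by
  two.\<close>

lemma tmean_by_parts:
  assumes n: "n \<ge> 1" and b: "sym_tensor b" and c: "sym_tensor c"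
  shows "(real n + real p + real q - 1) * tmean n (Suc p) b q c =
    real p * tmean n (p - 1) (tensor_tr n b) q c +
    real q * (\<Sum>i<n. tmean n p (\<lambda>J. b (i # J)) (q - 1) (\<lambda>J. c (i # J)))"
proof -
  let ?b = "\<lambda>i J. b (i # J)" and ?c = "\<lambda>i J. c (i # J)"
  let ?h = "\<lambda>i x. tform n p (?b i) x * tform n q c x"
  let ?h' = "\<lambda>i x. (real p * tform n (p - 1) (\<lambda>J. b (i # i # J)) x) * tform n q c x
      + tform n p (?b i) x * (real q * tform n (q - 1) (?c i) x)"
  have hg: "hom_grad n (p + q) (?h i) (\<lambda>j x. (real p * tform n (p - 1) (\<lambda>J. b (i # j # J)) x) * tform n q c x
      + tform n p (?b i) x * (real q * tform n (q - 1) (?c j) x))" for i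
    by (intro hom_grad.mult hom_grad_tform c sym_tensor_Cons b)
  have "tmean n (Suc p) b q c = sphere_mean n (\<lambda>x. \<Sum>i<n. x i * ?h i x)"
    by (simp add: tmean_def tform_Suc sum_distrib_right mult.assoc)
  also have "\<dots> = (\<Sum>i<n. sphere_mean n (\<lambda>x. x i * ?h i x))"
  proof (rule sphere_mean_sum)
    fix i assume "i \<in> {..<n}"
    then show "integrable (sphere_measure n) (\<lambda>x. x i * ?h i x)"
      by (intro integrable_hom_grad(1)[OF n hom_grad.mult[OF hom_grad.var hg]]) simp
  qed
  finally have "(real n + real p + real q - 1) * tmean n (Suc p) b q c =
      (\<Sum>i<n. (real n + real (p + q) - 1) * sphere_mean n (\<lambda>x. x i * ?h i x))"
    by (simp add: sum_distrib_left add.assoc)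
  also have "\<dots> = (\<Sum>i<n. sphere_mean n (?h' i))"
    by (intro sum.cong refl, subst sphere_mean_coord_mult[OF n hg]) auto
  also have "\<dots> = (\<Sum>i<n. real p * tmean n (p - 1) (\<lambda>J. b (i # i # J)) q c +
      real q * tmean n p (?b i) (q - 1) (?c i))"
  proof (intro sum.cong refl)
    fix i
    have "sphere_mean n (?h' i) = sphere_mean n (\<lambda>x.
        real p * (tform n (p - 1) (\<lambda>J. b (i # i # J)) x * tform n q c x) +
        real q * (tform n p (?b i) x * tform n (q - 1) (?c i) x))"
      by (simp add: mult_ac)
    also have "\<dots> = real p * tmean n (p - 1) (\<lambda>J. b (i # i # J)) q c +
      real q * tmean n p (?b i) (q - 1) (?c i)"
      unfolding tmean_def sphere_mean_cmult[symmetric]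
      by (intro sphere_mean_add Bochner_Integration.integrable_mult_right integrable_tform_mult n
          sym_tensor_Cons[OF sym_tensor_Cons[OF b]] sym_tensor_Cons[OF b] sym_tensor_Cons[OF c] c)
    finally show "sphere_mean n (?h' i) = real p * tmean n (p - 1) (\<lambda>J. b (i # i # J)) q c +
      real q * tmean n p (?b i) (q - 1) (?c i)" .
  qed
  also have "\<dots> = real p * (\<Sum>i<n. tmean n (p - 1) (\<lambda>J. b (i # i # J)) q c) +
      real q * (\<Sum>i<n. tmean n p (?b i) (q - 1) (?c i))"
    by (simp add: sum.distrib sum_distrib_left)
  also have "(\<Sum>i<n. tmean n (p - 1) (\<lambda>J. b (i # i # J)) q c) = tmean n (p - 1) (tensor_tr n b) q c"
    unfolding tmean_def tform_tensor_tr sum_distrib_right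
    by (intro sphere_mean_sum[symmetric] integrable_tform_mult n c
        sym_tensor_Cons[OF sym_tensor_Cons[OF b]])
  finally show ?thesis .
qed

text \<open>Stands in for the decomposition into harmonic components. Both terms of
  \<open>tmean_by_parts\<close> are again means of two iterated traces of one symmetric tensor, of
  lower total degree, and the recursion ends in squares of constants. The balance
  \<open>p + 2 * \<alpha> = q + 2 * \<beta>\<close> says that both factors stem from a tensor of the
  same degree.\<close>

lemma tmean_tr_nonneg:
  assumes n: "n \<ge> 1" and "sym_tensor a" "p + 2 * \<alpha> = q + 2 * \<beta>"
  shows "0 \<le> tmean n p ((tensor_tr n ^^ \<alpha>) a) q ((tensor_tr n ^^ \<beta>) a)"
  using assms(2,3)
proof (induction "p + q" arbitrary: p q \<alpha> \<beta> a rule: less_induct)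
  case less
  note a = less.prems(1)
  have step: "0 \<le> tmean n (Suc p') ((tensor_tr n ^^ \<gamma>) a) r ((tensor_tr n ^^ \<delta>) a)"
    if "Suc p' + r = p + q" "Suc p' + 2 * \<gamma> = r + 2 * \<delta>" for p' r \<gamma> \<delta>
  proof -
    \<comment> \<open>\<open>Suc p'\<close> and \<open>r\<close> have the same parity, so
      \<open>p' + r\<close> is odd; hence the factor is positive even for
      \<open>n = 1\<close>.\<close>
    have "p' + r \<noteq> 0" using that by presburger
    then have pos: "0 < real n + real p' + real r - 1" using n by linarith
    have "0 \<le> real p' * tmean n (p' - 1) (tensor_tr n ((tensor_tr n ^^ \<gamma>) a)) r ((tensor_tr n ^^ \<delta>) a)"
    proof (cases "p' = 0")
      case False
      then have "0 \<le> tmean n (p' - 1) ((tensor_tr n ^^ Suc \<gamma>) a) r ((tensor_tr n ^^ \<delta>) a)"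
        using that by (intro less.hyps a) auto
      then show ?thesis by simp
    qed simp
    moreover have "0 \<le> real r * (\<Sum>i<n. tmean n p' (\<lambda>J. (tensor_tr n ^^ \<gamma>) a (i # J))
        (r - 1) (\<lambda>J. (tensor_tr n ^^ \<delta>) a (i # J)))"
    proof (cases "r = 0")
      case False
      then have "0 \<le> tmean n p' ((tensor_tr n ^^ \<gamma>) (\<lambda>J. a (i # J))) (r - 1)
          ((tensor_tr n ^^ \<delta>) (\<lambda>J. a (i # J)))" for i
        using that by (intro less.hyps sym_tensor_Cons a) auto
      then show ?thesis by (intro mult_nonneg_nonneg sum_nonneg) (auto simp: tensor_tr_pow_Cons[OF a])
    qed simp
    ultimately have "0 \<le> (real n + real p' + real r - 1) *
        tmean n (Suc p') ((tensor_tr n ^^ \<gamma>) a) r ((tensor_tr n ^^ \<delta>) a)"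
      by (subst tmean_by_parts[OF n]) (auto intro: sym_tensor_tr_pow a)
    then show ?thesis using pos by (simp add: zero_le_mult_iff)
  qed
  show ?case
  proof (cases p)
    case (Suc p')
    then show ?thesis using step[of p' q \<alpha> \<beta>] less.prems by simp
  next
    case 0
    show ?thesis
    proof (cases q)
      case q: (Suc q')
      then have "0 \<le> tmean n q ((tensor_tr n ^^ \<beta>) a) p ((tensor_tr n ^^ \<alpha>) a)"
        using step[of q' p \<beta> \<alpha>] less.prems by simp
      then show ?thesis by (subst tmean_commute)
    next
      case q: 0
      with 0 less.prems have "\<alpha> = \<beta>" by simp
      with 0 q show ?thesis using tmean_square_nonneg by simp
    qed
  qed
qed

lemma tmean_tr_left_nonneg:
  assumes "n \<ge> 1" "sym_tensor a"
  shows "0 \<le> real p * tmean n (p - 1) (tensor_tr n a) (Suc p) a"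
proof (cases p)
  case (Suc r)
  then show ?thesis using tmean_tr_nonneg[OF assms, of "p - 1" 1 "Suc p" 0] by simp
qed simp

text \<open>Integrate \<open>a\<close> against itself by parts and drop the trace term, which is
  nonnegative.\<close>

lemma sum_deriv_le:
  assumes "n \<ge> 1" "sym_tensor a"
  shows "real (Suc p) * (\<Sum>i<n. tmean n p (\<lambda>J. a (i # J)) p (\<lambda>J. a (i # J)))
    \<le> (real n + 2 * real p) * tmean n (Suc p) a (Suc p) a"
  using tmean_by_parts[OF assms(1,2,2), of p "Suc p"] tmean_tr_left_nonneg[OF assms, of p]
  by (simp add: algebra_simps)

text \<open>Two integrations by parts, of \<open>a\<close> against its trace and of \<open>a\<close>
  against itself. Each time the contraction term is nonnegative and dropped, and each costs one
  factor of at most \<open>n + 2 * p\<close>.\<close>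

lemma tr_square_le:
  assumes n: "n \<ge> 1" and a: "sym_tensor a"
  shows "(real p)\<^sup>2 * tmean n (p - 1) (tensor_tr n a) (p - 1) (tensor_tr n a)
    \<le> (real n + 2 * real p)\<^sup>2 * tmean n (Suc p) a (Suc p) a"
proof (cases p)
  case 0
  then show ?thesis using tmean_square_nonneg[of n 1 a] by simp
next
  case (Suc r)
  let ?t = "tensor_tr n a" and ?S = "tmean n (Suc p) a (Suc p) a"
  have "0 \<le> real (Suc p) * (\<Sum>i<n. tmean n p (\<lambda>J. a (i # J)) p (\<lambda>J. a (i # J)))"
    by (intro mult_nonneg_nonneg sum_nonneg tmean_square_nonneg) simp
  then have 1: "real p * tmean n r ?t (Suc p) a \<le> (real n + 2 * real p) * ?S"
    using tmean_by_parts[OF n a a, of p "Suc p"] Suc by (simp add: algebra_simps)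
  have "0 \<le> real r * (\<Sum>i<n. tmean n p (\<lambda>J. a (i # J)) (r - 1) (\<lambda>J. ?t (i # J)))"
  proof (cases r)
    case r: (Suc l)
    have "0 \<le> tmean n p (\<lambda>J. a (i # J)) (r - 1) (\<lambda>J. ?t (i # J))" for i
      using tmean_tr_nonneg[OF n sym_tensor_Cons[OF a, of i], of p 0 "r - 1" 1] r Suc
      by (simp add: tensor_tr_Cons[OF a])
    then show ?thesis by (intro mult_nonneg_nonneg sum_nonneg) auto
  qed simp
  then have 2: "real p * tmean n r ?t r ?t \<le> (real n + real p + real r - 1) * tmean n (Suc p) a r ?t"
    using tmean_by_parts[OF n a sym_tensor_tr[OF a], of p r n] Suc by simp
  have 3: "0 \<le> real p * tmean n r ?t (Suc p) a"
    using tmean_tr_left_nonneg[OF n a, of p] Suc by simp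
  have "(real p)\<^sup>2 * tmean n r ?t r ?t = real p * (real p * tmean n r ?t r ?t)"
    by (simp add: power2_eq_square)
  also have "\<dots> \<le> real p * ((real n + real p + real r - 1) * tmean n (Suc p) a r ?t)"
    using 2 by (intro mult_left_mono) auto
  also have "\<dots> = (real n + real p + real r - 1) * (real p * tmean n r ?t (Suc p) a)"
    by (simp add: tmean_commute[of n r])
  also have "\<dots> \<le> (real n + 2 * real p) * ((real n + 2 * real p) * ?S)"
    using 1 3 Suc by - (rule mult_mono, auto)
  finally show ?thesis using Suc by (simp add: power2_eq_square mult.assoc)
qed

text \<open>Iterating \<open>sum_deriv_le\<close> strips off one index at a time until constants
  remain. Up to constants in \<open>m\<close> this bounds the entries of the tensor by
  \<open>n ^ m\<close> times the mean square of the form.\<close>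

lemma tmean_square_ge:
  assumes n: "n \<ge> 1" and "sym_tensor a"
  shows "fact m * (\<Sum>I\<in>idx n m. (a I)\<^sup>2) \<le> (\<Prod>j<m. real n + 2 * real j) * tmean n m a m a"
  using assms(2)
proof (induction m arbitrary: a)
  case 0
  have "tmean n 0 a 0 a = (a [])\<^sup>2"
    using n by (simp add: tmean_def tform_0 sphere_mean_const power2_eq_square)
  then show ?case by simp
next
  case (Suc m)
  have "fact (Suc m) * (\<Sum>I\<in>idx n (Suc m). (a I)\<^sup>2) =
      real (Suc m) * (\<Sum>i<n. fact m * (\<Sum>J\<in>idx n m. (a (i # J))\<^sup>2))"
    by (simp add: sum_idx_Suc sum_distrib_left mult_ac)
  also have "\<dots> \<le> real (Suc m) * (\<Sum>i<n. (\<Prod>j<m. real n + 2 * real j) *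
      tmean n m (\<lambda>J. a (i # J)) m (\<lambda>J. a (i # J)))"
    using Suc.prems by (intro mult_left_mono sum_mono Suc.IH sym_tensor_Cons) auto
  also have "\<dots> = (\<Prod>j<m. real n + 2 * real j) *
      (real (Suc m) * (\<Sum>i<n. tmean n m (\<lambda>J. a (i # J)) m (\<lambda>J. a (i # J))))"
    by (simp add: sum_distrib_left mult_ac)
  also have "\<dots> \<le> (\<Prod>j<m. real n + 2 * real j) * ((real n + 2 * real m) * tmean n (Suc m) a (Suc m) a)"
    using n Suc.prems by (intro mult_left_mono sum_deriv_le prod_nonneg) auto
  finally show ?case by (simp add: mult_ac)
qed

section \<open>Hypercontractivity\<close>

text \<open>The squared length of a vector-valued form. Its components are indexed by lists so that
  the family of all partial derivatives can be indexed by prefixing the direction.\<close>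

definition sumsq :: "nat \<Rightarrow> nat \<Rightarrow> (nat list \<Rightarrow> nat list \<Rightarrow> real) \<Rightarrow> nat list set \<Rightarrow> (nat \<Rightarrow> real) \<Rightarrow> real" where
  "sumsq n k a A x = (\<Sum>\<alpha>\<in>A. (tform n k (a \<alpha>) x)\<^sup>2)"

lemma sphere_mean_sum2:
  assumes "\<And>\<alpha> i. \<alpha> \<in> A \<Longrightarrow> i \<in> B \<Longrightarrow> integrable (sphere_measure n) (f \<alpha> i)"
  shows "sphere_mean n (\<lambda>x. \<Sum>\<alpha>\<in>A. \<Sum>i\<in>B. f \<alpha> i x) = (\<Sum>\<alpha>\<in>A. \<Sum>i\<in>B. sphere_mean n (f \<alpha> i))"
proof -
  have "sphere_mean n (\<lambda>x. \<Sum>\<alpha>\<in>A. \<Sum>i\<in>B. f \<alpha> i x) = (\<Sum>\<alpha>\<in>A. sphere_mean n (\<lambda>x. \<Sum>i\<in>B. f \<alpha> i x))"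
    using assms by (intro sphere_mean_sum Bochner_Integration.integrable_sum)
  also have "\<dots> = (\<Sum>\<alpha>\<in>A. \<Sum>i\<in>B. sphere_mean n (f \<alpha> i))"
    using assms by (intro sum.cong refl sphere_mean_sum)
  finally show ?thesis .
qed

lemma hom_fun_sum:
  assumes "\<And>\<alpha>. \<alpha> \<in> A \<Longrightarrow> hom_grad n m (f \<alpha>) (f' \<alpha>)"
  shows "hom_fun n (\<lambda>x. \<Sum>\<alpha>\<in>A. f \<alpha> x)"
  unfolding hom_fun_def by (intro exI, rule hom_grad_sum[OF assms])

lemma hom_grad_sumsq:
  assumes "\<And>\<alpha>. \<alpha> \<in> A \<Longrightarrow> sym_tensor (a \<alpha>)"
  shows "hom_grad n (k + k) (sumsq n k a A)
    (\<lambda>i x. \<Sum>\<alpha>\<in>A. 2 * real k * (tform n (k - 1) (\<lambda>J. a \<alpha> (i # J)) x * tform n k (a \<alpha>) x))"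
proof -
  have "hom_grad n (k + k) (\<lambda>x. tform n k (a \<alpha>) x * tform n k (a \<alpha>) x)
    (\<lambda>i x. (real k * tform n (k - 1) (\<lambda>J. a \<alpha> (i # J)) x) * tform n k (a \<alpha>) x +
      tform n k (a \<alpha>) x * (real k * tform n (k - 1) (\<lambda>J. a \<alpha> (i # J)) x))" if "\<alpha> \<in> A" for \<alpha>
    using assms[OF that] by (intro hom_grad.mult hom_grad_tform)
  from hom_grad_sum[OF this] have "hom_grad n (k + k) (\<lambda>x. \<Sum>\<alpha>\<in>A. tform n k (a \<alpha>) x * tform n k (a \<alpha>) x)
    (\<lambda>i x. \<Sum>\<alpha>\<in>A. (real k * tform n (k - 1) (\<lambda>J. a \<alpha> (i # J)) x) * tform n k (a \<alpha>) x +
      tform n k (a \<alpha>) x * (real k * tform n (k - 1) (\<lambda>J. a \<alpha> (i # J)) x))" .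
  then show ?thesis
    unfolding sumsq_def[abs_def] power2_eq_square
    by (rule hom_grad.cong) (intro sum.cong refl, simp)
qed

lemma hom_fun_sumsq:
  assumes "\<And>\<alpha>. \<alpha> \<in> A \<Longrightarrow> sym_tensor (a \<alpha>)"
  shows "hom_fun n (sumsq n k a A)"
  unfolding hom_fun_def by (intro exI, rule hom_grad_sumsq[OF assms])

lemma sumsq_nonneg: "0 \<le> sumsq n k a A x"
  unfolding sumsq_def by (intro sum_nonneg) simp

lemma sphere_mean_sumsq:
  assumes "n \<ge> 1" "\<And>\<alpha>. \<alpha> \<in> A \<Longrightarrow> sym_tensor (a \<alpha>)"
  shows "sphere_mean n (sumsq n k a A) = (\<Sum>\<alpha>\<in>A. tmean n k (a \<alpha>) k (a \<alpha>))"
  unfolding sumsq_def[abs_def] tmean_def power2_eq_square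
  using assms by (intro sphere_mean_sum integrable_tform_mult)

text \<open>Write the square of \<open>W = sumsq n k a A\<close> as the sum of
  \<open>x i * T * G * W\<close>, with \<open>T\<close> the tensor form of a component
  \<open>G\<close> after fixing the slot \<open>i\<close>, and integrate \<open>x i\<close> by
  parts. The derivative falls on \<open>T\<close> (trace), on \<open>G\<close> (squared gradient) or
  on \<open>W\<close> (squared pairing of gradient and form). The degree \<open>p + 3 * k\<close>
  with \<open>k = p + 1\<close> makes the factor \<open>n + 4 * p + 2\<close>.\<close>

lemma sumsq_by_parts:
  fixes p :: nat
  defines "k \<equiv> Suc p"
  assumes n: "n \<ge> 1" and a: "\<And>\<alpha>. \<alpha> \<in> A \<Longrightarrow> sym_tensor (a \<alpha>)"
  shows "(real n + 4 * real p + 2) * sphere_mean n (\<lambda>x. (sumsq n k a A x)\<^sup>2) =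
    sphere_mean n (\<lambda>x.
      real p * ((\<Sum>\<alpha>\<in>A. tform n (p - 1) (tensor_tr n (a \<alpha>)) x * tform n k (a \<alpha>) x) * sumsq n k a A x)
    + real k * ((\<Sum>\<alpha>\<in>A. \<Sum>i<n. (tform n p (\<lambda>J. a \<alpha> (i # J)) x)\<^sup>2) * sumsq n k a A x)
    + 2 * real k * (\<Sum>i<n. (\<Sum>\<alpha>\<in>A. tform n p (\<lambda>J. a \<alpha> (i # J)) x * tform n k (a \<alpha>) x)\<^sup>2))"
    (is "_ = sphere_mean n ?R")
proof -
  let ?W = "sumsq n k a A"
  let ?W' = "\<lambda>i x. \<Sum>\<alpha>\<in>A. 2 * real k * (tform n (k - 1) (\<lambda>J. a \<alpha> (i # J)) x * tform n k (a \<alpha>) x)"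
  let ?G = "\<lambda>\<alpha>. tform n k (a \<alpha>)" and ?T = "\<lambda>\<alpha> i. tform n p (\<lambda>J. a \<alpha> (i # J))"
  let ?S = "\<lambda>\<alpha> i j x. real p * tform n (p - 1) (\<lambda>J. a \<alpha> (i # j # J)) x"
  let ?h = "\<lambda>\<alpha> i x. ?T \<alpha> i x * (?G \<alpha> x * ?W x)"
  let ?h' = "\<lambda>\<alpha> i j x. ?S \<alpha> i j x * (?G \<alpha> x * ?W x) +
     ?T \<alpha> i x * ((real k * tform n (k - 1) (\<lambda>J. a \<alpha> (j # J)) x) * ?W x + ?G \<alpha> x * ?W' j x)"
  have hg: "hom_grad n (p + (k + (k + k))) (?h \<alpha> i) (?h' \<alpha> i)" if "\<alpha> \<in> A" for \<alpha> i
    using a that by (intro hom_grad.mult hom_grad_sumsq hom_grad_tform sym_tensor_Cons)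
  have xh: "integrable (sphere_measure n) (\<lambda>x. x i * ?h \<alpha> i x)" if "\<alpha> \<in> A" "i < n" for \<alpha> i
    using integrable_hom_grad(1)[OF n hom_grad.mult[OF hom_grad.var[OF that(2)] hg[OF that(1)]]] .
  have "(?W x)\<^sup>2 = (\<Sum>\<alpha>\<in>A. \<Sum>i<n. x i * ?h \<alpha> i x)" for x
  proof -
    have "(?W x)\<^sup>2 = (\<Sum>\<alpha>\<in>A. ?G \<alpha> x * (?G \<alpha> x * ?W x))"
      by (simp add: power2_eq_square sumsq_def sum_distrib_right mult_ac)
    also have "\<dots> = (\<Sum>\<alpha>\<in>A. \<Sum>i<n. x i * ?h \<alpha> i x)"
    proof (intro sum.cong refl)
      fix \<alpha>
      have "?G \<alpha> x = (\<Sum>i<n. x i * ?T \<alpha> i x)" by (simp add: k_def tform_Suc)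
      then show "?G \<alpha> x * (?G \<alpha> x * ?W x) = (\<Sum>i<n. x i * ?h \<alpha> i x)"
        by (subst \<open>?G \<alpha> x = _\<close>) (simp only: sum_distrib_right mult.assoc)
    qed
    finally show ?thesis .
  qed
  then have "sphere_mean n (\<lambda>x. (?W x)\<^sup>2) = (\<Sum>\<alpha>\<in>A. \<Sum>i<n. sphere_mean n (\<lambda>x. x i * ?h \<alpha> i x))"
    by (simp only:) (rule sphere_mean_sum2, rule xh, auto)
  then have "(real n + 4 * real p + 2) * sphere_mean n (\<lambda>x. (?W x)\<^sup>2) =
     (\<Sum>\<alpha>\<in>A. \<Sum>i<n. (real n + real (p + (k + (k + k))) - 1) * sphere_mean n (\<lambda>x. x i * ?h \<alpha> i x))"
    by (simp add: sum_distrib_left k_def algebra_simps)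
  also have "\<dots> = (\<Sum>\<alpha>\<in>A. \<Sum>i<n. sphere_mean n (?h' \<alpha> i i))"
    by (intro sum.cong refl sphere_mean_coord_mult[OF n hg]) auto
  also have "\<dots> = sphere_mean n (\<lambda>x. \<Sum>\<alpha>\<in>A. \<Sum>i<n. ?h' \<alpha> i i x)"
    by (rule sphere_mean_sum2[symmetric]) (rule integrable_hom_grad(2)[OF n hg], auto)
  also have "(\<lambda>x. \<Sum>\<alpha>\<in>A. \<Sum>i<n. ?h' \<alpha> i i x) = ?R"
  proof
    fix x
    have 1: "(\<Sum>\<alpha>\<in>A. \<Sum>i<n. ?S \<alpha> i i x * (?G \<alpha> x * ?W x)) =
      real p * ((\<Sum>\<alpha>\<in>A. tform n (p - 1) (tensor_tr n (a \<alpha>)) x * ?G \<alpha> x) * ?W x)"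
      by (simp only: tform_tensor_tr sum_distrib_left sum_distrib_right mult.assoc)
    have 2: "(\<Sum>\<alpha>\<in>A. \<Sum>i<n. ?T \<alpha> i x * (real k * tform n (k - 1) (\<lambda>J. a \<alpha> (i # J)) x * ?W x)) =
      real k * ((\<Sum>\<alpha>\<in>A. \<Sum>i<n. (?T \<alpha> i x)\<^sup>2) * ?W x)"
      by (simp add: k_def sum_distrib_left sum_distrib_right power2_eq_square mult_ac)
    have 3: "(\<Sum>\<alpha>\<in>A. \<Sum>i<n. ?T \<alpha> i x * (?G \<alpha> x * ?W' i x)) =
      2 * real k * (\<Sum>i<n. (\<Sum>\<alpha>\<in>A. ?T \<alpha> i x * ?G \<alpha> x)\<^sup>2)"
    proof -
      have "(\<Sum>\<alpha>\<in>A. \<Sum>i<n. ?T \<alpha> i x * (?G \<alpha> x * ?W' i x)) = (\<Sum>i<n. \<Sum>\<alpha>\<in>A. ?T \<alpha> i x * (?G \<alpha> x * ?W' i x))"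
        by (rule sum.swap)
      also have "\<dots> = (\<Sum>i<n. (\<Sum>\<alpha>\<in>A. ?T \<alpha> i x * ?G \<alpha> x) * ?W' i x)"
        by (simp only: sum_distrib_right mult.assoc)
      also have "\<dots> = (\<Sum>i<n. (\<Sum>\<alpha>\<in>A. ?T \<alpha> i x * ?G \<alpha> x) * (2 * real k * (\<Sum>\<alpha>\<in>A. ?T \<alpha> i x * ?G \<alpha> x)))"
        by (simp add: k_def sum_distrib_left)
      finally show ?thesis by (simp add: power2_eq_square sum_distrib_left mult_ac)
    qed
    show "(\<Sum>\<alpha>\<in>A. \<Sum>i<n. ?h' \<alpha> i i x) = ?R x"
      by (simp only: distrib_left sum.distrib 1 2 3 add.assoc)
  qed
  finally show ?thesis .
qed

text \<open>Three completed squares, each paying a quarter of \<open>\<nu> * W^2\<close>, so that a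
  quarter is left after absorption. The powers of \<open>\<nu>\<close> are those that the bounds for
  gradient and trace cancel later. The factor \<open>3 * k\<close> collects \<open>k\<close> from
  the squared gradient and \<open>2 * k\<close> from the squared pairing.\<close>

lemma am_gm_scaled:
  fixes \<nu> :: real
  assumes \<nu>: "\<nu> > 0" and U: "U\<^sup>2 \<le> W2 * W" and p: "0 \<le> p"
  shows "p * (U * W) + 3 * k * (W1 * W) \<le> 3/4 * \<nu> * W\<^sup>2 + (9 * k\<^sup>2 / \<nu>) * W1\<^sup>2 + (p ^ 4 / \<nu> ^ 3) * W2\<^sup>2"
proof -
  define s where "s = sqrt \<nu>"
  have s: "s > 0" "s\<^sup>2 = \<nu>" using \<nu> by (auto simp: s_def)
  have 1: "3 * k * (W1 * W) \<le> \<nu> * W\<^sup>2 / 4 + (9 * k\<^sup>2 / \<nu>) * W1\<^sup>2"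
  proof -
    have "0 \<le> (s * W / 2 - 3 * k * W1 / s)\<^sup>2" by simp
    also have "\<dots> = \<nu> * W\<^sup>2 / 4 + (9 * k\<^sup>2 / \<nu>) * W1\<^sup>2 - 3 * k * (W1 * W)"
      using s by (simp add: power2_diff power_divide power_mult_distrib)
    finally show ?thesis by simp
  qed
  have 2: "p * (U * W) \<le> \<nu> * W\<^sup>2 / 4 + (p\<^sup>2 / \<nu>) * U\<^sup>2"
  proof -
    have "0 \<le> (s * W / 2 - p * U / s)\<^sup>2" by simp
    also have "\<dots> = \<nu> * W\<^sup>2 / 4 + (p\<^sup>2 / \<nu>) * U\<^sup>2 - p * (U * W)"
      using s by (simp add: power2_diff power_divide power_mult_distrib)
    finally show ?thesis by simp
  qed
  have "(p\<^sup>2 / \<nu>) * U\<^sup>2 \<le> (p\<^sup>2 / \<nu>) * (W2 * W)"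
    using U \<nu> by (intro mult_left_mono) auto
  also have "\<dots> \<le> \<nu> * W\<^sup>2 / 4 + (p ^ 4 / \<nu> ^ 3) * W2\<^sup>2"
  proof -
    have "0 \<le> (s * W / 2 - p\<^sup>2 * W2 / (s * \<nu>))\<^sup>2" by simp
    also have "\<dots> = \<nu> * W\<^sup>2 / 4 + (p ^ 4 / \<nu> ^ 3) * W2\<^sup>2 - (p\<^sup>2 / \<nu>) * (W2 * W)"
      using s \<nu> by (simp add: power2_diff power_divide power_mult_distrib power3_eq_cube power2_eq_square[of \<nu>] mult_ac)
    finally show ?thesis by simp
  qed
  finally show ?thesis using 1 2 by (simp add: algebra_simps)
qed

text \<open>Integrating by parts expresses \<open>\<langle>W\<^sup>2\<rangle>\<close> through the gradients and Laplacians of the family, to which the induction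
  hypothesis applies; this is why vector-valued forms are needed.\<close>

theorem sumsq_hypercontractive:
  assumes n: "n \<ge> 1"
  assumes "finite A" "\<And>\<alpha>. \<alpha> \<in> A \<Longrightarrow> sym_tensor (a \<alpha>)"
  shows "sphere_mean n (\<lambda>x. (sumsq n k a A x)\<^sup>2) \<le> 40 ^ k * (sphere_mean n (sumsq n k a A))\<^sup>2"
  using assms(2,3)
proof (induction k arbitrary: a A rule: less_induct)
  case (less k)
  note A = less.prems(1) and a = less.prems(2)
  show ?case
  proof (cases k)
    case 0
    then show ?thesis by (simp add: sumsq_def[abs_def] tform_0 sphere_mean_const[OF n])
  next
    case (Suc p)
    define \<nu> where "\<nu> = real n + 4 * real p + 2"
    have \<nu>: "\<nu> > 0" by (simp add: \<nu>_def)
    let ?W = "sumsq n k a A"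
    define S where "S = sphere_mean n ?W"
    \<comment> \<open>The family of all partial derivatives: \<open>hd\<close> is the direction,
      \<open>tl\<close> the index of the original component.\<close>
    define A1 where "A1 = (\<lambda>(i, \<alpha>). i # \<alpha>) ` ({..<n} \<times> A)"
    define a1 where "a1 = (\<lambda>\<beta> J. a (tl \<beta>) (hd \<beta> # J))"
    define a2 where "a2 = (\<lambda>\<alpha>. tensor_tr n (a \<alpha>))"
    let ?W1 = "sumsq n p a1 A1" and ?W2 = "sumsq n (p - 1) a2 A"
    let ?U = "\<lambda>x. \<Sum>\<alpha>\<in>A. tform n (p - 1) (tensor_tr n (a \<alpha>)) x * tform n k (a \<alpha>) x"
    let ?V = "\<lambda>i x. \<Sum>\<alpha>\<in>A. tform n p (\<lambda>J. a \<alpha> (i # J)) x * tform n k (a \<alpha>) x"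
    have A1: "finite A1" using A by (simp add: A1_def)
    have a1: "sym_tensor (a1 \<beta>)" if "\<beta> \<in> A1" for \<beta>
      using that a by (auto simp: A1_def a1_def intro: sym_tensor_Cons)
    have a2: "sym_tensor (a2 \<alpha>)" if "\<alpha> \<in> A" for \<alpha>
      using that a by (auto simp: a2_def intro: sym_tensor_tr)
    have sumA1: "(\<Sum>\<beta>\<in>A1. f (hd \<beta>) (tl \<beta>)) = (\<Sum>\<alpha>\<in>A. \<Sum>i<n. f i \<alpha>)" for f :: "nat \<Rightarrow> nat list \<Rightarrow> real"
    proof -
      have "(\<Sum>\<beta>\<in>A1. f (hd \<beta>) (tl \<beta>)) = (\<Sum>(i, \<alpha>)\<in>{..<n} \<times> A. f i \<alpha>)"
        unfolding A1_def by (subst sum.reindex) (auto simp: inj_on_def case_prod_beta)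
      also have "\<dots> = (\<Sum>i<n. \<Sum>\<alpha>\<in>A. f i \<alpha>)" by (simp add: sum.cartesian_product)
      finally show ?thesis by (simp add: sum.swap[of _ A])
    qed
    have W1: "?W1 x = (\<Sum>\<alpha>\<in>A. \<Sum>i<n. (tform n p (\<lambda>J. a \<alpha> (i # J)) x)\<^sup>2)" for x
      unfolding sumsq_def a1_def by (rule sumA1)
    have W2: "?W2 x = (\<Sum>\<alpha>\<in>A. (tform n (p - 1) (tensor_tr n (a \<alpha>)) x)\<^sup>2)" for x
      by (simp add: sumsq_def a2_def)
    have int: "integrable (sphere_measure n) (\<lambda>x. (?W x)\<^sup>2)" "integrable (sphere_measure n) (\<lambda>x. (?W1 x)\<^sup>2)"
       "integrable (sphere_measure n) (\<lambda>x. (?W2 x)\<^sup>2)"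
      using a a1 a2 by (auto intro!: integrable_hom_fun[OF n] hom_fun_power2 hom_fun_sumsq)
    have intU: "integrable (sphere_measure n) (\<lambda>x. ?U x * ?W x)"
    proof (intro integrable_hom_fun[OF n] hom_fun_mult hom_fun_sumsq a)
      show "hom_fun n ?U" 
        by (rule hom_fun_sum, rule hom_grad.mult; rule hom_grad_tform; simp add: a sym_tensor_tr)
    qed
    have intV: "integrable (sphere_measure n) (\<lambda>x. \<Sum>i<n. (?V i x)\<^sup>2)"
    proof (intro Bochner_Integration.integrable_sum integrable_hom_fun[OF n] hom_fun_power2)
      fix i
      show "hom_fun n (?V i)"
        by (rule hom_fun_sum, rule hom_grad.mult; rule hom_grad_tform; simp add: a sym_tensor_Cons)
    qed
    have intW1: "integrable (sphere_measure n) (\<lambda>x. ?W1 x * ?W x)"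
      using a a1 by (auto intro!: integrable_hom_fun[OF n] hom_fun_mult hom_fun_sumsq)
    have S1: "real k * sphere_mean n ?W1 \<le> \<nu> * S"
    proof -
      have "sphere_mean n ?W1 = (\<Sum>\<beta>\<in>A1. tmean n p (\<lambda>J. a (tl \<beta>) (hd \<beta> # J)) p (\<lambda>J. a (tl \<beta>) (hd \<beta> # J)))"
        by (subst sphere_mean_sumsq[OF n a1]) (simp_all add: a1_def)
      also have "\<dots> = (\<Sum>\<alpha>\<in>A. \<Sum>i<n. tmean n p (\<lambda>J. a \<alpha> (i # J)) p (\<lambda>J. a \<alpha> (i # J)))"
        by (rule sumA1)
      finally have "real k * sphere_mean n ?W1 =
          (\<Sum>\<alpha>\<in>A. real k * (\<Sum>i<n. tmean n p (\<lambda>J. a \<alpha> (i # J)) p (\<lambda>J. a \<alpha> (i # J))))"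
        by (simp add: sum_distrib_left)
      also have "\<dots> \<le> (\<Sum>\<alpha>\<in>A. \<nu> * tmean n k (a \<alpha>) k (a \<alpha>))"
      proof (rule sum_mono)
        fix \<alpha> assume "\<alpha> \<in> A"
        then have "real k * (\<Sum>i<n. tmean n p (\<lambda>J. a \<alpha> (i # J)) p (\<lambda>J. a \<alpha> (i # J))) \<le>
          (real n + 2 * real p) * tmean n k (a \<alpha>) k (a \<alpha>)"
          unfolding Suc using n a by (intro sum_deriv_le)
        also have "\<dots> \<le> \<nu> * tmean n k (a \<alpha>) k (a \<alpha>)"
          by (intro mult_right_mono tmean_square_nonneg) (simp add: \<nu>_def)
        finally show "real k * (\<Sum>i<n. tmean n p (\<lambda>J. a \<alpha> (i # J)) p (\<lambda>J. a \<alpha> (i # J))) \<le>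
          \<nu> * tmean n k (a \<alpha>) k (a \<alpha>)" .
      qed
      also have "\<dots> = \<nu> * S"
        unfolding S_def by (subst sphere_mean_sumsq[OF n a]) (simp_all add: sum_distrib_left)
      finally show ?thesis .
    qed
    have S2: "(real p)\<^sup>2 * sphere_mean n ?W2 \<le> \<nu>\<^sup>2 * S"
    proof -
      have "(real p)\<^sup>2 * sphere_mean n ?W2 = (\<Sum>\<alpha>\<in>A. (real p)\<^sup>2 * tmean n (p - 1) (tensor_tr n (a \<alpha>)) (p - 1) (tensor_tr n (a \<alpha>)))"
        by (subst sphere_mean_sumsq[OF n a2]) (simp_all add: a2_def sum_distrib_left)
      also have "\<dots> \<le> (\<Sum>\<alpha>\<in>A. \<nu>\<^sup>2 * tmean n k (a \<alpha>) k (a \<alpha>))"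
      proof (rule sum_mono)
        fix \<alpha> assume "\<alpha> \<in> A"
        then have "(real p)\<^sup>2 * tmean n (p - 1) (tensor_tr n (a \<alpha>)) (p - 1) (tensor_tr n (a \<alpha>)) \<le>
          (real n + 2 * real p)\<^sup>2 * tmean n k (a \<alpha>) k (a \<alpha>)"
          unfolding Suc using n a by (intro tr_square_le)
        also have "\<dots> \<le> \<nu>\<^sup>2 * tmean n k (a \<alpha>) k (a \<alpha>)"
          by (intro mult_right_mono tmean_square_nonneg power_mono) (simp_all add: \<nu>_def)
        finally show "(real p)\<^sup>2 * tmean n (p - 1) (tensor_tr n (a \<alpha>)) (p - 1) (tensor_tr n (a \<alpha>)) \<le>
          \<nu>\<^sup>2 * tmean n k (a \<alpha>) k (a \<alpha>)" .
      qed
      also have "\<dots> = \<nu>\<^sup>2 * S"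
        unfolding S_def by (subst sphere_mean_sumsq[OF n a]) (simp_all add: sum_distrib_left)
      finally show ?thesis .
    qed
    have S0: "0 \<le> S" "0 \<le> sphere_mean n ?W1" "0 \<le> sphere_mean n ?W2"
      unfolding S_def by (auto intro!: sphere_mean_nonneg sumsq_nonneg)
    \<comment> \<open>The weight \<open>k^2\<close> turns the square of the mean of
      \<open>W1\<close> into \<open>(k * mean W1)^2\<close>, at most \<open>(\<nu> * S)^2\<close>,
      and a single factor \<open>\<nu>\<close> survives. In \<open>T2\<close> the weight
      \<open>p^4\<close> plays the same part for the traces.\<close>
    have T1: "9 * (real k)\<^sup>2 / \<nu> * sphere_mean n (\<lambda>x. (?W1 x)\<^sup>2) \<le> 9 * 40 ^ p * \<nu> * S\<^sup>2"
    proof -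
      have "9 * (real k)\<^sup>2 / \<nu> * sphere_mean n (\<lambda>x. (?W1 x)\<^sup>2) \<le>
          9 * (real k)\<^sup>2 / \<nu> * (40 ^ p * (sphere_mean n ?W1)\<^sup>2)"
        using \<nu> less.IH[of p A1 a1] A1 a1 Suc by (intro mult_left_mono) auto
      also have "\<dots> = 9 * 40 ^ p / \<nu> * (real k * sphere_mean n ?W1)\<^sup>2"
        by (simp add: power_mult_distrib)
      also have "\<dots> \<le> 9 * 40 ^ p / \<nu> * (\<nu> * S)\<^sup>2"
        using \<nu> S0 S1 by (intro mult_left_mono power_mono) auto
      also have "\<dots> = 9 * 40 ^ p * \<nu> * S\<^sup>2"
        using \<nu> by (simp add: power2_eq_square)
      finally show ?thesis .
    qed
    have T2: "(real p) ^ 4 / \<nu> ^ 3 * sphere_mean n (\<lambda>x. (?W2 x)\<^sup>2) \<le> 40 ^ p * \<nu> * S\<^sup>2"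
    proof -
      have "(real p) ^ 4 / \<nu> ^ 3 * sphere_mean n (\<lambda>x. (?W2 x)\<^sup>2) \<le>
          (real p) ^ 4 / \<nu> ^ 3 * (40 ^ p * (sphere_mean n ?W2)\<^sup>2)"
      proof (rule mult_left_mono)
        have "sphere_mean n (\<lambda>x. (?W2 x)\<^sup>2) \<le> 40 ^ (p - 1) * (sphere_mean n ?W2)\<^sup>2"
          using less.IH[of "p - 1" A a2] A a2 Suc by auto
        also have "\<dots> \<le> 40 ^ p * (sphere_mean n ?W2)\<^sup>2"
          by (intro mult_right_mono power_increasing) auto
        finally show "sphere_mean n (\<lambda>x. (?W2 x)\<^sup>2) \<le> 40 ^ p * (sphere_mean n ?W2)\<^sup>2" .
      qed (use \<nu> in simp)
      also have "\<dots> = 40 ^ p / \<nu> ^ 3 * ((real p)\<^sup>2 * sphere_mean n ?W2)\<^sup>2"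
        by (simp add: power_mult_distrib)
      also have "\<dots> \<le> 40 ^ p / \<nu> ^ 3 * (\<nu>\<^sup>2 * S)\<^sup>2"
        using \<nu> S0 S2 by (intro mult_left_mono power_mono) auto
      also have "\<dots> = 40 ^ p * \<nu> * S\<^sup>2"
        using \<nu> by (simp add: power2_eq_square power3_eq_cube)
      finally show ?thesis .
    qed
    define X where "X = sphere_mean n (\<lambda>x. (?W x)\<^sup>2)"
    have "\<nu> * X = sphere_mean n (\<lambda>x. real p * (?U x * ?W x) + real k * (?W1 x * ?W x)
      + 2 * real k * (\<Sum>i<n. (?V i x)\<^sup>2))"
      unfolding X_def \<nu>_def W1 using sumsq_by_parts[where p = p and A = A and a = a, OF n a] unfolding Suc by simp
    also have "\<dots> \<le> sphere_mean n (\<lambda>x. 3/4 * \<nu> * (?W x)\<^sup>2 + (9 * (real k)\<^sup>2 / \<nu>) * (?W1 x)\<^sup>2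
        + ((real p) ^ 4 / \<nu> ^ 3) * (?W2 x)\<^sup>2)"
    proof (rule sphere_mean_mono)
      fix x
      \<comment> \<open>Cauchy-Schwarz over the components, direction by direction, reduces the
        squared pairing to \<open>W1 * W\<close>.\<close>
      have "(\<Sum>i<n. (?V i x)\<^sup>2)
        \<le> (\<Sum>i<n. (\<Sum>\<alpha>\<in>A. (tform n p (\<lambda>J. a \<alpha> (i # J)) x)\<^sup>2) * ?W x)"
        unfolding sumsq_def by (intro sum_mono Cauchy_Schwarz_ineq_sum)
      also have "\<dots> = ?W1 x * ?W x"
        unfolding W1 by (subst sum.swap) (simp add: sum_distrib_right)
      finally have "2 * real k * (\<Sum>i<n. (?V i x)\<^sup>2)
        \<le> 2 * real k * (?W1 x * ?W x)" by (intro mult_left_mono) auto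
      moreover have "(?U x)\<^sup>2 \<le> ?W2 x * ?W x"
        unfolding W2 unfolding sumsq_def by (rule Cauchy_Schwarz_ineq_sum)
      note am_gm_scaled[OF \<nu> this, of "real p" "real k" "?W1 x"]
      ultimately show "real p * (?U x * ?W x) + real k * (?W1 x * ?W x)
        + 2 * real k * (\<Sum>i<n. (?V i x)\<^sup>2)
        \<le> 3/4 * \<nu> * (?W x)\<^sup>2 + (9 * (real k)\<^sup>2 / \<nu>) * (?W1 x)\<^sup>2 + ((real p) ^ 4 / \<nu> ^ 3) * (?W2 x)\<^sup>2"
        by simp
    qed (intro Bochner_Integration.integrable_add Bochner_Integration.integrable_mult_right int intU intV intW1)+
    also have "\<dots> = 3/4 * \<nu> * X + 9 * (real k)\<^sup>2 / \<nu> * sphere_mean n (\<lambda>x. (?W1 x)\<^sup>2)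
        + (real p) ^ 4 / \<nu> ^ 3 * sphere_mean n (\<lambda>x. (?W2 x)\<^sup>2)"
      unfolding X_def sphere_mean_cmult[symmetric]
      by (subst sphere_mean_add, (intro Bochner_Integration.integrable_add Bochner_Integration.integrable_mult_right int)+)+ (rule refl)
    also have "\<dots> \<le> 3/4 * \<nu> * X + 9 * 40 ^ p * \<nu> * S\<^sup>2 + 40 ^ p * \<nu> * S\<^sup>2"
      unfolding add.assoc by (intro add_left_mono add_mono T1 T2)
    \<comment> \<open>Origin of the base 40: gradient and trace contribute \<open>9 + 1\<close>
      times \<open>40 ^ p\<close>, and absorbing \<open>3/4 * X\<close> multiplies by 4.\<close>
    finally have "\<nu> * X \<le> \<nu> * (3/4 * X + 10 * 40 ^ p * S\<^sup>2)" by (simp add: algebra_simps)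
    then have "X \<le> 3/4 * X + 10 * 40 ^ p * S\<^sup>2" using \<nu> by simp
    then show ?thesis unfolding X_def S_def Suc by simp
  qed
qed

text \<open>A family with one member turns hypercontractivity into a fourth moment bound, and
  \<open>2 * a^2 * b^2 \<le> a^4 + b^4\<close> passes to products.\<close>

corollary tform_product_mean_le:
  assumes n: "n \<ge> 1" and a: "sym_tensor a" and b: "sym_tensor b"
  shows "sphere_mean n (\<lambda>x. (tform n k a x * tform n k b x)\<^sup>2)
    \<le> 40 ^ k * ((tmean n k a k a)\<^sup>2 + (tmean n k b k b)\<^sup>2) / 2"
proof -
  have 4: "sphere_mean n (\<lambda>x. (tform n k c x) ^ 4) \<le> 40 ^ k * (tmean n k c k c)\<^sup>2"
    "integrable (sphere_measure n) (\<lambda>x. (tform n k c x) ^ 4)"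
    if "sym_tensor c" for c
  proof -
    have e: "sumsq n k (\<lambda>_. c) {[]} = (\<lambda>x. tform n k c x * tform n k c x)"
      by (simp add: sumsq_def[abs_def] power2_eq_square)
    have p: "(tform n k c x) ^ 4 = (tform n k c x * tform n k c x)\<^sup>2" for x
      by (simp add: power2_eq_square power4_eq_xxxx)
    show "sphere_mean n (\<lambda>x. (tform n k c x) ^ 4) \<le> 40 ^ k * (tmean n k c k c)\<^sup>2"
      using sumsq_hypercontractive[OF n, of "{[]}" "\<lambda>_. c" k] that
      unfolding e p tmean_def by simp
    show "integrable (sphere_measure n) (\<lambda>x. (tform n k c x) ^ 4)"
      unfolding p by (intro integrable_hom_fun[OF n] hom_fun_power2 hom_fun_mult hom_fun_tform that)
  qed
  have "sphere_mean n (\<lambda>x. (tform n k a x * tform n k b x)\<^sup>2)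
     \<le> sphere_mean n (\<lambda>x. 1/2 * (tform n k a x) ^ 4 + 1/2 * (tform n k b x) ^ 4)"
  proof (rule sphere_mean_mono)
    fix x
    have "0 \<le> ((tform n k a x)\<^sup>2 - (tform n k b x)\<^sup>2)\<^sup>2" by simp
    also have "\<dots> = (tform n k a x) ^ 4 + (tform n k b x) ^ 4 - 2 * (tform n k a x * tform n k b x)\<^sup>2"
      by (simp add: power2_diff power_mult_distrib)
    finally show "(tform n k a x * tform n k b x)\<^sup>2 \<le> 1/2 * (tform n k a x) ^ 4 + 1/2 * (tform n k b x) ^ 4"
      by simp
  qed (intro integrable_hom_fun[OF n] hom_fun_power2 hom_fun_mult hom_fun_tform a b
      Bochner_Integration.integrable_add Bochner_Integration.integrable_mult_right 4)+
  also have "\<dots> = 1/2 * sphere_mean n (\<lambda>x. (tform n k a x) ^ 4) + 1/2 * sphere_mean n (\<lambda>x. (tform n k b x) ^ 4)"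
    unfolding sphere_mean_cmult[symmetric]
    by (intro sphere_mean_add Bochner_Integration.integrable_mult_right 4 a b)
  also have "\<dots> \<le> 40 ^ k * ((tmean n k a k a)\<^sup>2 + (tmean n k b k b)\<^sup>2) / 2"
    using 4(1)[OF a] 4(1)[OF b] by (simp add: algebra_simps)
  finally show ?thesis .
qed

section \<open>Orthonormal bases of spaces of forms\<close>

lemma sum_monomials: "p = (\<Sum>\<nu>\<in>Poly_Mapping.keys p. Poly_Mapping.single \<nu> (Poly_Mapping.lookup p \<nu>))"
proof (rule poly_mapping_eqI)
  fix \<mu>
  have "Poly_Mapping.lookup (\<Sum>\<nu>\<in>Poly_Mapping.keys p. Poly_Mapping.single \<nu> (Poly_Mapping.lookup p \<nu>)) \<mu>
    = (\<Sum>\<nu>\<in>Poly_Mapping.keys p. if \<nu> = \<mu> then Poly_Mapping.lookup p \<nu> else 0)"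
    by (simp add: lookup_sum lookup_single when_def)
  also have "\<dots> = Poly_Mapping.lookup p \<mu>" by (simp add: in_keys_iff)
  finally show "Poly_Mapping.lookup p \<mu> =
    Poly_Mapping.lookup (\<Sum>\<nu>\<in>Poly_Mapping.keys p. Poly_Mapping.single \<nu> (Poly_Mapping.lookup p \<nu>)) \<mu>" ..
qed

lemma lookup_scaleR [simp]: "Poly_Mapping.lookup (c *\<^sub>R p) \<nu> = c *\<^sub>R Poly_Mapping.lookup p \<nu>"
  by transfer simp

definition monom_eval :: "(nat \<Rightarrow>\<^sub>0 nat) \<Rightarrow> (nat \<Rightarrow> real) \<Rightarrow> real" where
  "monom_eval \<nu> x = (\<Prod>i\<in>Poly_Mapping.keys \<nu>. x i ^ Poly_Mapping.lookup \<nu> i)"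

lemma monom_eval_superset:
  assumes "finite S" "Poly_Mapping.keys \<nu> \<subseteq> S"
  shows "monom_eval \<nu> x = (\<Prod>i\<in>S. x i ^ Poly_Mapping.lookup \<nu> i)"
  unfolding monom_eval_def using assms
  by (intro prod.mono_neutral_left) (auto simp: in_keys_iff)

lemma monom_eval_add: "monom_eval (\<mu> + \<nu>) x = monom_eval \<mu> x * monom_eval \<nu> x"
proof -
  let ?S = "Poly_Mapping.keys \<mu> \<union> Poly_Mapping.keys \<nu>"
  have "monom_eval (\<mu> + \<nu>) x = (\<Prod>i\<in>?S. x i ^ Poly_Mapping.lookup (\<mu> + \<nu>) i)"
    using keys_add[of \<mu> \<nu>] by (intro monom_eval_superset) auto
  also have "\<dots> = monom_eval \<mu> x * monom_eval \<nu> x"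
    by (simp add: monom_eval_superset[of ?S] lookup_add power_add prod.distrib)
  finally show ?thesis .
qed

lemma eval_poly_superset:
  assumes "finite S" "Poly_Mapping.keys p \<subseteq> S"
  shows "eval_poly p x = (\<Sum>\<nu>\<in>S. Poly_Mapping.lookup p \<nu> * monom_eval \<nu> x)"
  unfolding eval_poly_def monom_eval_def[symmetric] using assms
  by (intro sum.mono_neutral_left) (auto simp: in_keys_iff)

lemma eval_poly_add: "eval_poly (p + q) x = eval_poly p x + eval_poly q x"
proof -
  let ?S = "Poly_Mapping.keys p \<union> Poly_Mapping.keys q"
  have "eval_poly (p + q) x = (\<Sum>\<nu>\<in>?S. Poly_Mapping.lookup (p + q) \<nu> * monom_eval \<nu> x)"
    using keys_add[of p q] by (intro eval_poly_superset) auto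
  also have "\<dots> = eval_poly p x + eval_poly q x"
    by (simp add: eval_poly_superset[of ?S] lookup_add distrib_right sum.distrib)
  finally show ?thesis .
qed

lemma eval_poly_0 [simp]: "eval_poly 0 x = 0"
  by (simp add: eval_poly_def)

lemma eval_poly_scaleR: "eval_poly (c *\<^sub>R p) x = c * eval_poly p x"
proof -
  have "eval_poly (c *\<^sub>R p) x = (\<Sum>\<nu>\<in>Poly_Mapping.keys p. Poly_Mapping.lookup (c *\<^sub>R p) \<nu> * monom_eval \<nu> x)"
    by (intro eval_poly_superset) (auto simp: in_keys_iff)
  then show ?thesis by (simp add: eval_poly_superset[OF finite_keys order_refl] sum_distrib_left mult.assoc)
qed

lemma eval_poly_sum: "eval_poly (\<Sum>i\<in>A. f i) x = (\<Sum>i\<in>A. eval_poly (f i) x)"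
  by (induction A rule: infinite_finite_induct) (auto simp: eval_poly_add)

lemma eval_poly_single: "eval_poly (Poly_Mapping.single \<nu> c) x = c * monom_eval \<nu> x"
proof -
  have "eval_poly (Poly_Mapping.single \<nu> c) x =
    (\<Sum>\<mu>\<in>{\<nu>}. Poly_Mapping.lookup (Poly_Mapping.single \<nu> c) \<mu> * monom_eval \<mu> x)"
    by (intro eval_poly_superset) auto
  then show ?thesis by simp
qed

lemma eval_poly_mult: "eval_poly (p * q) x = eval_poly p x * eval_poly q x"
proof -
  have "p * q = (\<Sum>\<mu>\<in>Poly_Mapping.keys p. \<Sum>\<nu>\<in>Poly_Mapping.keys q.
      Poly_Mapping.single (\<mu> + \<nu>) (Poly_Mapping.lookup p \<mu> * Poly_Mapping.lookup q \<nu>))"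
    by (subst sum_monomials[of p], subst sum_monomials[of q]) (simp add: sum_product mult_single)
  then have "eval_poly (p * q) x = (\<Sum>\<mu>\<in>Poly_Mapping.keys p. \<Sum>\<nu>\<in>Poly_Mapping.keys q.
      (Poly_Mapping.lookup p \<mu> * monom_eval \<mu> x) * (Poly_Mapping.lookup q \<nu> * monom_eval \<nu> x))"
    by (simp add: eval_poly_sum eval_poly_single monom_eval_add mult_ac)
  then show ?thesis
    by (simp add: sum_product eval_poly_superset[OF finite_keys order_refl])
qed

lemma eval_poly_1: "eval_poly 1 x = 1"
  using eval_poly_single[of 0 1 x] by (simp add: monom_eval_def)

lemma eval_poly_power: "eval_poly (p ^ k) x = eval_poly p x ^ k"
  by (induction k) (simp_all add: eval_poly_1 eval_poly_mult)

lemma eval_poly_var: "eval_poly (var i) x = x i"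
  by (simp add: var_def eval_poly_single monom_eval_def)

definition total_deg :: "(nat \<Rightarrow>\<^sub>0 nat) \<Rightarrow> nat" where
  "total_deg \<nu> = (\<Sum>i\<in>Poly_Mapping.keys \<nu>. Poly_Mapping.lookup \<nu> i)"

lemma total_deg_superset:
  assumes "finite S" "Poly_Mapping.keys \<nu> \<subseteq> S"
  shows "total_deg \<nu> = (\<Sum>i\<in>S. Poly_Mapping.lookup \<nu> i)"
  unfolding total_deg_def using assms
  by (intro sum.mono_neutral_left) (auto simp: in_keys_iff)

lemma total_deg_add: "total_deg (\<mu> + \<nu>) = total_deg \<mu> + total_deg \<nu>"
proof -
  let ?S = "Poly_Mapping.keys \<mu> \<union> Poly_Mapping.keys \<nu>"
  have "total_deg (\<mu> + \<nu>) = (\<Sum>i\<in>?S. Poly_Mapping.lookup (\<mu> + \<nu>) i)"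
    using keys_add[of \<mu> \<nu>] by (intro total_deg_superset) auto
  then show ?thesis
    by (simp add: total_deg_superset[of ?S] lookup_add sum.distrib)
qed

lemma forms_iff: "p \<in> forms n m \<longleftrightarrow>
    (\<forall>\<nu>\<in>Poly_Mapping.keys p. Poly_Mapping.keys \<nu> \<subseteq> {..<n} \<and> total_deg \<nu> = m)"
  by (simp add: forms_def total_deg_def)

lemma subspace_forms: "subspace (forms n m)"
proof (rule subspaceI)
  fix p q assume "p \<in> forms n m" "q \<in> forms n m"
  then show "p + q \<in> forms n m" using keys_add[of p q] by (auto simp: forms_iff)
next
  fix p and c :: real assume "p \<in> forms n m"
  then show "c *\<^sub>R p \<in> forms n m" by (auto simp: forms_iff in_keys_iff)
qed (simp add: forms_iff)

lemma mult_in_forms: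
  assumes "p \<in> forms n m" "q \<in> forms n l"
  shows "p * q \<in> forms n (m + l)"
  unfolding forms_iff
proof
  fix \<nu> assume "\<nu> \<in> Poly_Mapping.keys (p * q)"
  then obtain a b where ab: "\<nu> = a + b" "a \<in> Poly_Mapping.keys p" "b \<in> Poly_Mapping.keys q"
    using keys_mult[of p q] by auto
  then show "Poly_Mapping.keys \<nu> \<subseteq> {..<n} \<and> total_deg \<nu> = m + l"
    using assms keys_add[of a b] by (fastforce simp: forms_iff total_deg_add)
qed

lemma one_in_forms: "1 \<in> forms n 0"
  by (simp add: forms_iff total_deg_def)

lemma power_in_forms: "p \<in> forms n m \<Longrightarrow> p ^ k \<in> forms n (m * k)"
proof (induction k)
  case (Suc k)
  then show ?case using mult_in_forms[of p n m "p ^ k" "m * k"] by simp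
qed (simp add: one_in_forms)

lemma var_in_forms: "i < n \<Longrightarrow> var i \<in> forms n 1"
  by (simp add: forms_iff total_deg_def var_def)

section \<open>Coefficient tensors and the inner product of forms\<close>

definition expo :: "nat list \<Rightarrow> (nat \<Rightarrow>\<^sub>0 nat)" where
  "expo I = (\<Sum>i\<leftarrow>I. Poly_Mapping.single i 1)"

lemma lookup_expo: "Poly_Mapping.lookup (expo I) i = count (mset I) i"
  by (induction I) (auto simp: expo_def lookup_add lookup_single when_def)

lemma keys_expo: "Poly_Mapping.keys (expo I) = set I"
  by (auto simp: in_keys_iff lookup_expo)

lemma expo_eq_iff: "expo I = expo J \<longleftrightarrow> mset I = mset J"
  by (metis lookup_expo multiset_eqI poly_mapping_eqI)

lemma total_deg_expo: "total_deg (expo I) = length I"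
  by (induction I) (simp_all add: expo_def total_deg_add, simp_all add: total_deg_def)

lemma monom_eval_expo: "monom_eval (expo I) x = (\<Prod>i\<leftarrow>I. x i)"
  by (induction I) (simp_all add: expo_def monom_eval_add, simp_all add: monom_eval_def)

lemma expo_surj:
  assumes "Poly_Mapping.keys \<nu> \<subseteq> {..<n}" "total_deg \<nu> = m"
  shows "\<exists>I\<in>idx n m. expo I = \<nu>"
proof -
  define M where "M = (\<Sum>i\<in>Poly_Mapping.keys \<nu>. replicate_mset (Poly_Mapping.lookup \<nu> i) i)"
  have c: "count M i = Poly_Mapping.lookup \<nu> i" for i
  proof -
    have "count M i = (\<Sum>j\<in>Poly_Mapping.keys \<nu>. if j = i then Poly_Mapping.lookup \<nu> j else 0)"
      unfolding M_def count_sum by (intro sum.cong) auto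
    then show ?thesis by (simp add: in_keys_iff)
  qed
  obtain I where I: "mset I = M" using ex_mset by blast
  have e: "expo I = \<nu>" by (rule poly_mapping_eqI) (simp add: lookup_expo I c)
  then have "set I \<subseteq> {..<n}" "length I = m"
    using assms by (simp_all flip: e add: keys_expo total_deg_expo)
  then show ?thesis using e by (intro bexI[of _ I]) (auto simp: idx_def)
qed

definition mono_poly :: "nat list \<Rightarrow> rpoly" where
  "mono_poly I = Poly_Mapping.single (expo I) 1"

lemma eval_mono_poly: "eval_poly (mono_poly I) x = (\<Prod>i\<leftarrow>I. x i)"
  by (simp add: mono_poly_def eval_poly_single monom_eval_expo)

lemma mono_poly_in_forms: "I \<in> idx n m \<Longrightarrow> mono_poly I \<in> forms n m"
  by (auto simp: mono_poly_def forms_iff keys_expo total_deg_expo idx_def)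

text \<open>Each coefficient is distributed evenly over the index lists of its monomial, which makes the
  tensor symmetric.\<close>

definition coeff_tensor :: "nat \<Rightarrow> nat \<Rightarrow> rpoly \<Rightarrow> nat list \<Rightarrow> real" where
  "coeff_tensor n m p I = Poly_Mapping.lookup p (expo I) / real (card {J \<in> idx n m. expo J = expo I})"

lemma sym_coeff_tensor: "sym_tensor (coeff_tensor n m p)"
proof -
  have "coeff_tensor n m p I = coeff_tensor n m p J" if "mset I = mset J" for I J
    using that unfolding expo_eq_iff[symmetric] by (simp add: coeff_tensor_def)
  then show ?thesis unfolding sym_tensor_def by blast
qed

lemma coeff_tensor_scaleR: "coeff_tensor n m (c *\<^sub>R p) I = c * coeff_tensor n m p I"
  by (simp add: coeff_tensor_def)

lemma coeff_tensor_sum: "coeff_tensor n m (\<Sum>i\<in>A. f i) I = (\<Sum>i\<in>A. coeff_tensor n m (f i) I)"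
  by (simp add: coeff_tensor_def lookup_sum sum_divide_distrib)

lemma form_eq_sum_mono:
  assumes "p \<in> forms n m"
  shows "p = (\<Sum>I\<in>idx n m. coeff_tensor n m p I *\<^sub>R mono_poly I)"
proof (rule poly_mapping_eqI)
  fix \<nu>
  let ?F = "{I \<in> idx n m. expo I = \<nu>}"
  have "Poly_Mapping.lookup (\<Sum>I\<in>idx n m. coeff_tensor n m p I *\<^sub>R mono_poly I) \<nu> =
     (\<Sum>I\<in>idx n m. if expo I = \<nu> then Poly_Mapping.lookup p \<nu> / real (card ?F) else 0)"
    by (simp add: lookup_sum mono_poly_def lookup_single when_def coeff_tensor_def if_distrib cong: if_cong)
  also have "\<dots> = (\<Sum>I\<in>?F. Poly_Mapping.lookup p \<nu> / real (card ?F))"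
    by (intro sum.mono_neutral_cong_right) auto
  also have "\<dots> = real (card ?F) * (Poly_Mapping.lookup p \<nu> / real (card ?F))"
    by simp
  also have "\<dots> = Poly_Mapping.lookup p \<nu>"
  proof (cases "\<nu> \<in> Poly_Mapping.keys p")
    case True
    then obtain I where "I \<in> ?F" using expo_surj[of \<nu> n m] assms by (auto simp: forms_iff)
    then have "card ?F \<noteq> 0" by (subst card_0_eq) auto
    then show ?thesis by simp
  qed (simp add: in_keys_iff)
  finally show "Poly_Mapping.lookup p \<nu> =
    Poly_Mapping.lookup (\<Sum>I\<in>idx n m. coeff_tensor n m p I *\<^sub>R mono_poly I) \<nu>" ..
qed

lemma eval_poly_form:
  assumes "p \<in> forms n m"
  shows "eval_poly p = tform n m (coeff_tensor n m p)"
  by (rule ext, subst form_eq_sum_mono[OF assms])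
    (simp add: eval_poly_sum eval_poly_scaleR eval_mono_poly tform_def)

lemma hom_fun_eval: "p \<in> forms n m \<Longrightarrow> hom_fun n (eval_poly p)"
  by (simp add: eval_poly_form hom_fun_tform sym_coeff_tensor)

lemma integrable_eval: "n \<ge> 1 \<Longrightarrow> p \<in> forms n m \<Longrightarrow> integrable (sphere_measure n) (eval_poly p)"
  by (intro integrable_hom_fun hom_fun_eval)

lemma integrable_eval_mult:
  assumes "n \<ge> 1" "p \<in> forms n m" "q \<in> forms n l"
  shows "integrable (sphere_measure n) (\<lambda>x. eval_poly p x * eval_poly q x)"
  using assms by (intro integrable_hom_fun hom_fun_mult hom_fun_eval)

lemma form_inner_sphere_mean: "form_inner n f g = sphere_mean n (\<lambda>x. eval_poly f x * eval_poly g x)"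
  by (simp add: form_inner_def sphere_mean_def)

lemma form_inner_tmean:
  assumes "f \<in> forms n m" "g \<in> forms n l"
  shows "form_inner n f g = tmean n m (coeff_tensor n m f) l (coeff_tensor n l g)"
  using assms by (simp add: form_inner_sphere_mean tmean_def eval_poly_form)

lemma form_inner_commute: "form_inner n f g = form_inner n g f"
  by (simp add: form_inner_def mult.commute)

lemma form_inner_add_left:
  assumes "n \<ge> 1" "f \<in> forms n m" "g \<in> forms n m" "h \<in> forms n l"
  shows "form_inner n (f + g) h = form_inner n f h + form_inner n g h"
  unfolding form_inner_sphere_mean eval_poly_add distrib_right
  using assms by (intro sphere_mean_add integrable_eval_mult)

lemma form_inner_scaleR_left: "form_inner n (c *\<^sub>R f) h = c * form_inner n f h"
  by (simp add: form_inner_sphere_mean eval_poly_scaleR mult.assoc sphere_mean_cmult)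

lemma form_inner_sum_left:
  assumes "n \<ge> 1" "\<And>i. i \<in> A \<Longrightarrow> f i \<in> forms n m" "h \<in> forms n l"
  shows "form_inner n (\<Sum>i\<in>A. f i) h = (\<Sum>i\<in>A. form_inner n (f i) h)"
  unfolding form_inner_sphere_mean eval_poly_sum sum_distrib_right
  using assms by (intro sphere_mean_sum integrable_eval_mult)

lemma form_inner_self_nonneg: "0 \<le> form_inner n f f"
  unfolding form_inner_sphere_mean by (rule sphere_mean_nonneg) simp

lemma coeff_tensor_norm_le:
  assumes "n \<ge> 1" "f \<in> forms n m"
  shows "fact m * (\<Sum>I\<in>idx n m. (coeff_tensor n m f I)\<^sup>2) \<le> (\<Prod>j<m. real n + 2 * real j) * form_inner n f f"
  using tmean_square_ge[OF assms(1) sym_coeff_tensor] form_inner_tmean[OF assms(2,2)] by simp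

text \<open>Definiteness comes from the coefficient bound: norm 0 forces the coefficient tensor to
  vanish.\<close>

lemma form_inner_eq_0:
  assumes "n \<ge> 1" "f \<in> forms n m" "form_inner n f f = 0"
  shows "f = 0"
proof -
  have "fact m * (\<Sum>I\<in>idx n m. (coeff_tensor n m f I)\<^sup>2) \<le> 0"
    using coeff_tensor_norm_le[OF assms(1,2)] assms(3) by simp
  then have "(\<Sum>I\<in>idx n m. (coeff_tensor n m f I)\<^sup>2) \<le> 0"
    using fact_gt_zero[of m, where 'a = real] by (simp add: mult_le_0_iff not_le[symmetric])
  then have "(\<Sum>I\<in>idx n m. (coeff_tensor n m f I)\<^sup>2) = 0"
    by (simp add: antisym sum_nonneg)
  then have "\<forall>I\<in>idx n m. coeff_tensor n m f I = 0"
    by (subst (asm) sum_nonneg_eq_0_iff) auto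
  then show ?thesis by (subst form_eq_sum_mono[OF assms(2)]) simp
qed

text \<open>Reduces identities between forms to pointwise ones, since a difference that vanishes
  everywhere has norm 0.\<close>

lemma form_eqI:
  assumes n: "n \<ge> 1" and f: "f \<in> forms n m" and g: "g \<in> forms n m"
    and e: "\<And>x. eval_poly f x = eval_poly g x"
  shows "f = g"
proof -
  have "eval_poly (f - g) x = 0" for x
    using e eval_poly_add[of "f - g" g x] by simp
  then have "form_inner n (f - g) (f - g) = 0"
    by (simp add: form_inner_sphere_mean sphere_mean_def)
  with form_inner_eq_0[OF n subspace_diff[OF subspace_forms f g]] show ?thesis by simp
qed

section \<open>Gram-Schmidt and orthonormal bases\<close>

definition orthonormal_forms :: "nat \<Rightarrow> nat \<Rightarrow> (nat \<Rightarrow> rpoly) \<Rightarrow> bool" where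
  "orthonormal_forms n r b \<longleftrightarrow> (\<forall>i<r. \<forall>j<r. form_inner n (b i) (b j) = (if i = j then 1 else 0))"

text \<open>The inner product depends on \<open>n\<close> and is definite only on forms of a fixed
  degree in \<open>n\<close> variables, not on the type \<open>rpoly\<close>; so the process is
  carried out inside \<open>forms n m\<close>.\<close>

lemma gram_schmidt_forms:
  assumes n: "n \<ge> 1" and "finite B" "B \<subseteq> forms n m"
  shows "\<exists>r b. span (b ` {..<r}) = span B \<and> orthonormal_forms n r b"
  using assms(2,3)
proof (induction B)
  case empty
  show ?case by (intro exI[of _ 0]) (simp add: orthonormal_forms_def)
next
  case (insert v B)
  then obtain r b where b: "span (b ` {..<r}) = span B" "orthonormal_forms n r b" by auto
  have spB: "span B \<subseteq> forms n m" using insert.prems by (intro span_minimal subspace_forms) auto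
  have bf: "b i \<in> forms n m" if "i < r" for i
    using b(1) spB span_superset[of "b ` {..<r}"] that by blast
  have vf: "v \<in> forms n m" using insert.prems by simp
  define w where "w = v - (\<Sum>i<r. form_inner n v (b i) *\<^sub>R b i)"
  have sf: "(\<Sum>i<r. form_inner n v (b i) *\<^sub>R b i) \<in> forms n m"
    by (intro subspace_sum subspace_scale subspace_forms bf) simp
  have ss: "(\<Sum>i<r. form_inner n v (b i) *\<^sub>R b i) \<in> span B"
    unfolding b(1)[symmetric] by (intro span_sum span_scale span_base) auto
  have wf: "w \<in> forms n m" unfolding w_def by (intro subspace_diff subspace_forms vf sf)
  have orth: "form_inner n w (b j) = 0" if j: "j < r" for j
  proof -
    have "form_inner n v (b j) = form_inner n (w + (\<Sum>i<r. form_inner n v (b i) *\<^sub>R b i)) (b j)"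
      by (simp add: w_def)
    also have "\<dots> = form_inner n w (b j) + (\<Sum>i<r. form_inner n v (b i) * form_inner n (b i) (b j))"
      using j by (subst form_inner_add_left[OF n wf sf bf], simp,
          subst form_inner_sum_left[OF n _ bf[OF j]]) (auto intro: subspace_scale subspace_forms bf simp: form_inner_scaleR_left)
    also have "(\<Sum>i<r. form_inner n v (b i) * form_inner n (b i) (b j)) = (\<Sum>i<r. if i = j then form_inner n v (b i) else 0)"
      using b(2) j by (intro sum.cong refl) (simp add: orthonormal_forms_def)
    also have "\<dots> = form_inner n v (b j)" using j by simp
    finally show ?thesis by simp
  qed
  have sv: "span (insert v B) = span (insert w B)"
  proof (intro antisym span_minimal subspace_span insert_subsetI)
    have ssv: "(\<Sum>i<r. form_inner n v (b i) *\<^sub>R b i) \<in> span (insert v B)"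
      "(\<Sum>i<r. form_inner n v (b i) *\<^sub>R b i) \<in> span (insert w B)"
      using ss span_mono[of B "insert v B"] span_mono[of B "insert w B"] by auto
    show "w \<in> span (insert v B)"
      unfolding w_def by (rule span_diff[OF span_base ssv(1)]) simp
    have "v = w + (\<Sum>i<r. form_inner n v (b i) *\<^sub>R b i)" by (simp add: w_def)
    then show "v \<in> span (insert w B)"
      using ssv by (metis insertI1 span_add span_base)
  qed (auto intro: span_base)
  show ?case
  \<comment> \<open>If the residue is 0, the new vector already lies in the span and is skipped;
    this is why \<open>r\<close> need not be \<open>card B\<close>.\<close>
  proof (cases "w = 0")
    case True
    then have "span (insert v B) = span B" using sv by simp
    then show ?thesis using b by auto
  next
    case False
    define s where "s = sqrt (form_inner n w w)"
    have s: "s > 0" "s * s = form_inner n w w"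
      using form_inner_self_nonneg[of n w] form_inner_eq_0[OF n wf] False by (auto simp: s_def less_le)
    define b' where "b' = b(r := (1 / s) *\<^sub>R w)"
    have "b' ` {..<r} = b ` {..<r}" "b' r = (1 / s) *\<^sub>R w"
      by (auto simp: b'_def intro!: image_cong)
    then have "span (b' ` {..<Suc r}) = span (insert ((1 / s) *\<^sub>R w) (b ` {..<r}))"
      by (simp only: lessThan_Suc image_insert)
    also have "\<dots> = span (insert w (b ` {..<r}))"
    proof (intro antisym span_minimal subspace_span insert_subsetI)
      show "(1 / s) *\<^sub>R w \<in> span (insert w (b ` {..<r}))" by (intro span_scale span_base) simp
      have "s *\<^sub>R ((1 / s) *\<^sub>R w) \<in> span (insert ((1 / s) *\<^sub>R w) (b ` {..<r}))"
        by (intro span_scale span_base) simp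
      then show "w \<in> span (insert ((1 / s) *\<^sub>R w) (b ` {..<r}))" using s by simp
    qed (auto intro: span_base)
    also have "\<dots> = span (insert w B)"
    proof (intro antisym span_minimal subspace_span insert_subsetI)
      show "b ` {..<r} \<subseteq> span (insert w B)"
        using b(1) span_superset[of "b ` {..<r}"] span_mono[of B "insert w B"] by blast
      show "B \<subseteq> span (insert w (b ` {..<r}))"
        using b(1) span_superset[of B] span_mono[of "b ` {..<r}" "insert w (b ` {..<r})"] by blast
    qed (auto intro: span_base)
    finally have "span (b' ` {..<Suc r}) = span (insert v B)" using sv by simp
    moreover have "orthonormal_forms n (Suc r) b'"
      unfolding orthonormal_forms_def
    proof (intro allI impI)
      fix i j assume ij: "i < Suc r" "j < Suc r"
      have rr: "form_inner n ((1 / s) *\<^sub>R w) ((1 / s) *\<^sub>R w) = 1"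
        using s by (simp add: form_inner_scaleR_left form_inner_commute[of n w "_ *\<^sub>R _"] flip: s(2))
      have ro: "form_inner n ((1 / s) *\<^sub>R w) (b l) = 0" "form_inner n (b l) ((1 / s) *\<^sub>R w) = 0" if "l < r" for l
        using orth[OF that] form_inner_scaleR_left[of n "1 / s" w "b l"] by (simp_all add: form_inner_commute[of n "b l"])
      show "form_inner n (b' i) (b' j) = (if i = j then 1 else 0)"
        using ij b(2) rr ro by (auto simp: b'_def less_Suc_eq orthonormal_forms_def)
    qed
    ultimately show ?thesis by blast
  qed
qed

lemma form_inner_orthonormal_sum:
  assumes n: "n \<ge> 1" and b: "orthonormal_forms n r b" "\<And>i. i < r \<Longrightarrow> b i \<in> forms n m"
    and j: "j < r"
  shows "form_inner n (\<Sum>i<r. c i *\<^sub>R b i) (b j) = c j"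
proof -
  have "form_inner n (\<Sum>i<r. c i *\<^sub>R b i) (b j) = (\<Sum>i<r. c i * form_inner n (b i) (b j))"
    by (subst form_inner_sum_left[OF n _ b(2)[OF j]])
      (auto intro: subspace_scale subspace_forms b simp: form_inner_scaleR_left)
  also have "\<dots> = (\<Sum>i<r. if i = j then c i else 0)"
    using b(1) j by (intro sum.cong refl) (simp add: orthonormal_forms_def)
  finally show ?thesis using j by simp
qed

lemma form_inner_orthonormal_self:
  assumes n: "n \<ge> 1" and b: "orthonormal_forms n r b" "\<And>i. i < r \<Longrightarrow> b i \<in> forms n m"
  shows "form_inner n (\<Sum>i<r. c i *\<^sub>R b i) (\<Sum>i<r. c i *\<^sub>R b i) = (\<Sum>i<r. (c i)\<^sup>2)"
proof -
  have f: "(\<Sum>i<r. c i *\<^sub>R b i) \<in> forms n m"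
    by (intro subspace_sum subspace_scale subspace_forms b) simp
  have "form_inner n (\<Sum>i<r. c i *\<^sub>R b i) (\<Sum>i<r. c i *\<^sub>R b i) = (\<Sum>i<r. c i * form_inner n (b i) (\<Sum>i<r. c i *\<^sub>R b i))"
    by (subst form_inner_sum_left[OF n _ f])
      (auto intro: subspace_scale subspace_forms b simp: form_inner_scaleR_left)
  also have "\<dots> = (\<Sum>i<r. c i * c i)"
    using form_inner_orthonormal_sum[OF n b] by (intro sum.cong refl) (simp add: form_inner_commute[of n "b _"])
  finally show ?thesis by (simp add: power2_eq_square)
qed

lemma orthonormal_forms_expand:
  assumes n: "n \<ge> 1" and b: "orthonormal_forms n r b" "\<And>i. i < r \<Longrightarrow> b i \<in> forms n m"
    and f: "f \<in> span (b ` {..<r})"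
  shows "f = (\<Sum>i<r. form_inner n f (b i) *\<^sub>R b i)"
proof -
  have "\<exists>c. f = (\<Sum>i<r. c i *\<^sub>R b i)"
    using f
  proof (induction rule: span_induct_alt)
    case base
    show ?case by (intro exI[of _ "\<lambda>_. 0"]) simp
  next
    case (step a v f)
    then obtain c j where c: "f = (\<Sum>i<r. c i *\<^sub>R b i)" "j < r" "v = b j" by auto
    have "a *\<^sub>R v + f = (\<Sum>i<r. (if i = j then a *\<^sub>R b i else 0) + c i *\<^sub>R b i)"
      using c by (simp add: sum.distrib)
    also have "\<dots> = (\<Sum>i<r. ((if i = j then a else 0) + c i) *\<^sub>R b i)"
      by (intro sum.cong refl) (simp add: scaleR_add_left)
    finally show ?case by (intro exI[of _ "\<lambda>i. (if i = j then a else 0) + c i"])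
  qed
  then obtain c where c: "f = (\<Sum>i<r. c i *\<^sub>R b i)" by blast
  then show ?thesis using form_inner_orthonormal_sum[OF n b] by simp
qed

lemma independent_orthonormal:
  assumes n: "n \<ge> 1" and b: "orthonormal_forms n r b" "\<And>i. i < r \<Longrightarrow> b i \<in> forms n m"
  shows "inj_on b {..<r}" "independent (b ` {..<r})"
proof -
  show inj: "inj_on b {..<r}"
  proof (rule inj_onI)
    fix i j assume "i \<in> {..<r}" "j \<in> {..<r}" "b i = b j"
    then show "i = j" using b(1) unfolding orthonormal_forms_def by (metis lessThan_iff zero_neq_one)
  qed
  show "independent (b ` {..<r})"
  proof (rule independent_if_scalars_zero)
    fix c v assume 0: "(\<Sum>v\<in>b ` {..<r}. c v *\<^sub>R v) = 0" and "v \<in> b ` {..<r}"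
    then obtain j where j: "j < r" "v = b j" by auto
    have "(\<Sum>i<r. c (b i) *\<^sub>R b i) = 0" using 0 inj by (simp add: sum.reindex)
    with form_inner_orthonormal_sum[OF n b j(1), of "\<lambda>i. c (b i)"] show "c v = 0"
      by (simp add: form_inner_sphere_mean sphere_mean_def j)
  qed simp
qed

lemma forms_finite_span: "forms n m \<subseteq> span (mono_poly ` idx n m)"
proof
  fix p assume "p \<in> forms n m"
  then have p: "p = (\<Sum>I\<in>idx n m. coeff_tensor n m p I *\<^sub>R mono_poly I)"
    by (rule form_eq_sum_mono)
  show "p \<in> span (mono_poly ` idx n m)"
    by (subst p, intro span_sum span_scale span_base imageI)
qed

lemma independent_forms_bound:
  assumes "independent B" "B \<subseteq> forms n m"
  shows "finite B" "card B \<le> n ^ m"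
proof -
  have "finite B \<and> card B \<le> card (mono_poly ` idx n m)"
    using assms forms_finite_span by (intro independent_span_bound) auto
  moreover have "card (mono_poly ` idx n m) \<le> n ^ m"
    using card_image_le[of "idx n m" mono_poly] by (simp add: card_idx)
  ultimately show "finite B" "card B \<le> n ^ m" by auto
qed

text \<open>Serves two spaces: the zero mean forms, where it provides the coordinates for volume,
  and all forms of degree \<open>k\<close>, whose dimension controls the size of the net in the
  cover.\<close>

lemma orthonormal_basis_exists:
  assumes n: "n \<ge> 1" and W: "subspace W" "W \<subseteq> forms n m"
  shows "\<exists>b. span (b ` {..<dim W}) = W \<and> orthonormal_forms n (dim W) b" "dim W \<le> n ^ m"
proof -
  obtain B where B: "B \<subseteq> W" "independent B" "W \<subseteq> span B" "card B = dim W"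
    using basis_exists by blast
  have Bf: "B \<subseteq> forms n m" using B W by auto
  show "dim W \<le> n ^ m" using independent_forms_bound[OF B(2) Bf] B by simp
  obtain r b where b: "span (b ` {..<r}) = span B" "orthonormal_forms n r b"
    using gram_schmidt_forms[OF n independent_forms_bound(1)[OF B(2) Bf] Bf] by blast
  have sB: "span B = W" using B W by (intro antisym span_minimal) auto
  have bf: "b i \<in> forms n m" if "i < r" for i
    using b(1) sB W(2) span_superset[of "b ` {..<r}"] that by blast
  have "dim W = card (b ` {..<r})"
    using b(1) sB dim_span[of "b ` {..<r}"] dim_eq_card_independent[OF independent_orthonormal(2)[OF n b(2) bf]]
    by simp
  also have "\<dots> = r" using independent_orthonormal(1)[OF n b(2) bf] by (simp add: card_image)
  finally show "\<exists>b. span (b ` {..<dim W}) = W \<and> orthonormal_forms n (dim W) b" using b sB by auto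
qed

lemma subspace_zero_mean_forms:
  assumes "n \<ge> 1"
  shows "subspace (zero_mean_forms n k)"
proof (rule subspaceI)
  show "0 \<in> zero_mean_forms n k" using subspace_0[OF subspace_forms] by (simp add: zero_mean_forms_def eval_poly_0[abs_def])
next
  fix p q assume "p \<in> zero_mean_forms n k" "q \<in> zero_mean_forms n k"
  then show "p + q \<in> zero_mean_forms n k"
    using sphere_mean_add[OF integrable_eval[OF assms, of p "2 * k"] integrable_eval[OF assms, of q "2 * k"]]
      subspace_add[OF subspace_forms, of p n "2 * k" q]
    by (simp add: zero_mean_forms_def sphere_mean_def eval_poly_add[abs_def])
next
  fix p and c :: real assume "p \<in> zero_mean_forms n k"
  then show "c *\<^sub>R p \<in> zero_mean_forms n k"
    using subspace_scale[OF subspace_forms, of p n "2 * k" c]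
    by (simp add: zero_mean_forms_def eval_poly_scaleR[abs_def])
qed

lemma zero_mean_forms_subset: "zero_mean_forms n k \<subseteq> forms n (2 * k)"
  by (auto simp: zero_mean_forms_def)

section \<open>Lower bound for the dimension of the space of zero mean forms\<close>

lemma independent_monomials: "independent (range (\<lambda>\<nu>. Poly_Mapping.single \<nu> 1) :: rpoly set)"
proof
  assume "dependent (range (\<lambda>\<nu>. Poly_Mapping.single \<nu> 1) :: rpoly set)"
  then have "\<exists>S u. finite S \<and> S \<subseteq> (range (\<lambda>\<nu>. Poly_Mapping.single \<nu> 1) :: rpoly set) \<and>
      (\<Sum>v\<in>S. u v *\<^sub>R v) = 0 \<and> (\<exists>v\<in>S. u v \<noteq> 0)"
    by (simp only: dependent_explicit)
  then obtain S :: "rpoly set" and u v where S: "finite S" "S \<subseteq> range (\<lambda>\<nu>. Poly_Mapping.single \<nu> 1)"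
    "v \<in> S" "u v \<noteq> 0" "(\<Sum>v\<in>S. u v *\<^sub>R v) = 0"
    by (elim exE conjE bexE)
  then obtain \<nu> where \<nu>: "v = Poly_Mapping.single \<nu> 1" by auto
  have "0 = Poly_Mapping.lookup (\<Sum>v\<in>S. u v *\<^sub>R v) \<nu>" using S by simp
  also have "\<dots> = (\<Sum>w\<in>S. if w = v then u w else 0)"
    unfolding lookup_sum
  proof (intro sum.cong refl)
    fix w assume "w \<in> S"
    then obtain \<mu> where "w = Poly_Mapping.single \<mu> 1" using S by auto
    moreover have "\<mu> = \<nu>" if "Poly_Mapping.single \<mu> (1::real) = Poly_Mapping.single \<nu> 1"
      using arg_cong[OF that, of Poly_Mapping.keys] by simp
    ultimately show "Poly_Mapping.lookup (u w *\<^sub>R w) \<nu> = (if w = v then u w else 0)"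
      unfolding \<nu> by (auto simp: lookup_single when_def)
  qed
  also have "\<dots> = u v" using S by simp
  finally show False using S by simp
qed

lemma mono_hom_grad:
  assumes "set J \<subseteq> {..<n}" "i \<notin> set J"
  shows "\<exists>h'. hom_grad n (length J) (\<lambda>x. \<Prod>j\<leftarrow>J. x j) h' \<and> h' i = (\<lambda>x. 0)"
  using assms
proof (induction J)
  case Nil
  show ?case using hom_grad.const[of n 1] by auto
next
  case (Cons j J)
  then obtain h' where h': "hom_grad n (length J) (\<lambda>x. \<Prod>j\<leftarrow>J. x j) h'" "h' i = (\<lambda>x. 0)" by auto
  have "hom_grad n (1 + length J) (\<lambda>x. x j * (\<Prod>j\<leftarrow>J. x j))
    (\<lambda>i x. (if j = i then 1 else 0) * (\<Prod>j\<leftarrow>J. x j) + x j * h' i x)"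
    using Cons by (intro hom_grad.mult hom_grad.var h') auto
  then show ?case using Cons h'
    by (intro exI[of _ "\<lambda>i x. (if j = i then 1 else 0) * (\<Prod>j\<leftarrow>J. x j) + x j * h' i x"]) auto
qed

text \<open>A variable occurring exactly once can be integrated by parts, and the cofactor does not
  depend on it.\<close>

lemma mono_zero_mean:
  assumes n: "n \<ge> 2" and I: "i # J \<in> idx n (2 * k)" "i \<notin> set J"
  shows "mono_poly (i # J) \<in> zero_mean_forms n k"
proof -
  have iJ: "i < n" "set J \<subseteq> {..<n}" using I by (auto simp: idx_def)
  obtain h' where h': "hom_grad n (length J) (\<lambda>x. \<Prod>j\<leftarrow>J. x j) h'" "h' i = (\<lambda>x. 0)"
    using mono_hom_grad[OF iJ(2) I(2)] by blast
  have "(real n + real (length J) - 1) * sphere_mean n (\<lambda>x. x i * (\<Prod>j\<leftarrow>J. x j)) = 0"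
    using sphere_mean_coord_mult[OF _ h'(1) iJ(1)] n h'(2) by (simp add: sphere_mean_def)
  moreover have "real n + real (length J) - 1 > 0" using n by linarith
  ultimately have "sphere_mean n (eval_poly (mono_poly (i # J))) = 0"
    by (simp add: eval_mono_poly[abs_def])
  then show ?thesis using mono_poly_in_forms[OF I(1)]
    by (simp add: zero_mean_forms_def sphere_mean_def)
qed

lemma card_le_dim_zero_mean:
  assumes n: "n \<ge> 2" and L: "L \<subseteq> idx n (2 * k)" "inj_on expo L"
    "\<And>I. I \<in> L \<Longrightarrow> \<exists>i J. I = i # J \<and> i \<notin> set J"
  shows "card L \<le> dim (zero_mean_forms n k)"
proof -
  have "inj_on mono_poly L"
  proof (rule inj_onI)
    fix I J assume IJ: "I \<in> L" "J \<in> L" "mono_poly I = mono_poly J"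
    then have "Poly_Mapping.keys (mono_poly I) = Poly_Mapping.keys (mono_poly J)" by simp
    then have "expo I = expo J" by (simp add: mono_poly_def)
    then show "I = J" using L(2) IJ by (simp add: inj_on_def)
  qed
  then have "card L = card (mono_poly ` L)" by (simp add: card_image)
  also have "\<dots> \<le> dim (zero_mean_forms n k)"
  proof -
    have n1: "n \<ge> 1" using n by simp
    obtain B where B: "B \<subseteq> zero_mean_forms n k" "independent B" "zero_mean_forms n k \<subseteq> span B"
      "card B = dim (zero_mean_forms n k)"
      using basis_exists by blast
    have "finite B"
      using independent_forms_bound(1)[OF B(2)] B(1) zero_mean_forms_subset by blast
    moreover have "independent (mono_poly ` L)"
      by (rule independent_mono[OF independent_monomials]) (auto simp: mono_poly_def)
    moreover have "mono_poly ` L \<subseteq> span B"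
    proof (rule image_subsetI)
      fix I assume I: "I \<in> L"
      with L(3) obtain i J where "I = i # J" "i \<notin> set J" by blast
      with I L(1) mono_zero_mean[OF n, of i J k] B(3) show "mono_poly I \<in> span B" by auto
    qed
    ultimately show ?thesis using independent_span_bound[of B "mono_poly ` L"] B(4) by simp
  qed
  finally show ?thesis .
qed

text \<open>For \<open>2 * k \<le> n\<close> the squarefree monomials suffice, counted by a binomial
  coefficient. For smaller \<open>n\<close> the claimed bound is at most 1 and one monomial is
  enough.\<close>

lemma dim_zero_mean_forms_ge:
  assumes n: "n \<ge> 2" and k: "k \<ge> 1"
  shows "(real n / real (2 * k)) ^ (2 * k) \<le> real (dim (zero_mean_forms n k))"
proof (cases "2 * k \<le> n")
  case True
  define F where "F = {A. A \<subseteq> {..<n} \<and> card A = 2 * k}"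
  define L where "L = sorted_list_of_set ` F"
  have fin: "finite A" if "A \<in> F" for A using that by (auto simp: F_def intro: finite_subset)
  have inj: "inj_on sorted_list_of_set F"
    by (rule inj_on_inverseI[of _ set]) (simp add: fin)
  have "card L = n choose (2 * k)"
    unfolding L_def card_image[OF inj] unfolding F_def by (simp add: n_subsets)
  moreover have "card L \<le> dim (zero_mean_forms n k)"
  proof (rule card_le_dim_zero_mean[OF n])
    show "L \<subseteq> idx n (2 * k)" using fin by (auto simp: L_def idx_def F_def)
    show "inj_on expo L"
    proof (rule inj_onI)
      fix I J assume IJ: "I \<in> L" "J \<in> L" "expo I = expo J"
      then have "set I = set J" by (metis keys_expo)
      then show "I = J" using IJ fin by (auto simp: L_def)
    qed
    fix I assume "I \<in> L"
    then obtain A where A: "A \<in> F" "I = sorted_list_of_set A" by (auto simp: L_def)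
    then have "length I = 2 * k" "distinct I" using fin[OF A(1)] by (simp_all add: F_def)
    moreover from this k obtain i J where "I = i # J" by (cases I) auto
    ultimately show "\<exists>i J. I = i # J \<and> i \<notin> set J" by auto
  qed
  ultimately show ?thesis
    using binomial_ge_n_over_k_pow_k[OF True, where 'a = real] by linarith
next
  case False
  \<comment> \<open>The monomial with variable 1 once and variable 0 otherwise; it exists because
    \<open>n \<ge> 2\<close>.\<close>
  have "card {1 # replicate (2 * k - 1) (0::nat)} \<le> dim (zero_mean_forms n k)"
    using n k by (intro card_le_dim_zero_mean) (auto simp: idx_def)
  then have "1 \<le> real (dim (zero_mean_forms n k))" by simp
  moreover have "(real n / real (2 * k)) ^ (2 * k) \<le> 1"
    using False k by (intro power_le_one) (auto simp: divide_le_eq)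
  ultimately show ?thesis by linarith
qed

section \<open>Lattice nets, empirical approximation and positive semidefinite forms\<close>

text \<open>Scaled by \<open>1 / \<surd>d\<close> with \<open>d = card S\<close>, these are the lattice points of the ball of radius 2;
  rounding its coordinates up or down at random writes a point of the unit ball as a convex
  combination of them.\<close>

definition lattice_net :: "'i set \<Rightarrow> ('i \<Rightarrow> int) set" where
  "lattice_net S = {z \<in> S \<rightarrow>\<^sub>E UNIV. (\<Sum>i\<in>S. (z i)\<^sup>2) \<le> 4 * int (card S)}"

lemma sum_half_power_abs_le: "(\<Sum>j\<in>{- int m..int m}. (1/2::real) ^ nat \<bar>j\<bar>) \<le> 3"
proof -
  have "(\<Sum>j\<in>{- int m..int m}. (1/2::real) ^ nat \<bar>j\<bar>) = 3 - 2 * (1/2) ^ m"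
  proof (induction m)
    case (Suc m)
    have "{- int (Suc m)..int (Suc m)} = insert (int (Suc m)) (insert (- int (Suc m)) {- int m..int m})"
      by auto
    then have "(\<Sum>j\<in>{- int (Suc m)..int (Suc m)}. (1/2::real) ^ nat \<bar>j\<bar>) =
        2 * (1/2) ^ Suc m + (\<Sum>j\<in>{- int m..int m}. (1/2::real) ^ nat \<bar>j\<bar>)"
      by (simp add: nat_add_distrib)
    then show ?case using Suc by simp
  qed simp
  then show ?thesis by simp
qed

text \<open>Counting with weights \<open>2^(- \<bar>z\<bar>)\<close> for the l1-norm:
  \<open>\<bar>z i\<bar> \<le> (z i)^2\<close> on integers, so each net point weighs at least
  \<open>2^(- 4 d)\<close>, while the whole box weighs at most \<open>3^d\<close>. Hence the base
  \<open>48 = 3 * 16\<close>.\<close>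

lemma card_lattice_net:
  assumes "finite S"
  shows "finite (lattice_net S)" "real (card (lattice_net S)) \<le> 48 ^ card S"
proof -
  define d where "d = card S"
  define P where "P = Pi\<^sub>E S (\<lambda>_. {- int (4 * d)..int (4 * d)})"
  have finP: "finite P" unfolding P_def using assms by (intro finite_PiE) auto
  have abs1: "(\<Sum>i\<in>S. \<bar>z i\<bar>) \<le> 4 * int d" if "z \<in> lattice_net S" for z
  proof -
    have "\<bar>z i\<bar> \<le> (z i)\<^sup>2" for i
    proof (cases "z i = 0")
      case False
      then have "\<bar>z i\<bar> * 1 \<le> \<bar>z i\<bar> * \<bar>z i\<bar>" by (intro mult_left_mono) auto
      then show ?thesis by (simp add: power2_eq_square)
    qed simp
    then have "(\<Sum>i\<in>S. \<bar>z i\<bar>) \<le> (\<Sum>i\<in>S. (z i)\<^sup>2)" by (intro sum_mono) auto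
    also have "\<dots> \<le> 4 * int d" using that by (simp add: lattice_net_def d_def)
    finally show ?thesis .
  qed
  have sub: "lattice_net S \<subseteq> P"
  proof
    fix z assume z: "z \<in> lattice_net S"
    have "\<bar>z i\<bar> \<le> 4 * int d" if "i \<in> S" for i
      using member_le_sum[of i S "\<lambda>i. \<bar>z i\<bar>"] abs1[OF z] that assms by simp
    then show "z \<in> P" using z by (auto simp: P_def lattice_net_def PiE_iff abs_le_iff)
      (smt (verit))+
  qed
  then show fin: "finite (lattice_net S)" using finP finite_subset by blast
  have "real (card (lattice_net S)) * (1/2) ^ (4 * d) \<le> (\<Sum>z\<in>lattice_net S. \<Prod>i\<in>S. (1/2) ^ nat \<bar>z i\<bar>)"
  proof -
    have "(1/2::real) ^ (4 * d) \<le> (\<Prod>i\<in>S. (1/2) ^ nat \<bar>z i\<bar>)" if "z \<in> lattice_net S" for z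
    proof -
      have "int (\<Sum>i\<in>S. nat \<bar>z i\<bar>) \<le> int (4 * d)" using abs1[OF that] by simp
      then have "(\<Sum>i\<in>S. nat \<bar>z i\<bar>) \<le> 4 * d" by linarith
      then have "(1/2::real) ^ (4 * d) \<le> (1/2) ^ (\<Sum>i\<in>S. nat \<bar>z i\<bar>)"
        by (intro power_decreasing) auto
      then show ?thesis by (simp add: power_sum)
    qed
    then have "(\<Sum>z\<in>lattice_net S. (1/2::real) ^ (4 * d)) \<le> (\<Sum>z\<in>lattice_net S. \<Prod>i\<in>S. (1/2) ^ nat \<bar>z i\<bar>)"
      by (rule sum_mono)
    then show ?thesis by simp
  qed
  also have "\<dots> \<le> (\<Sum>z\<in>P. \<Prod>i\<in>S. (1/2) ^ nat \<bar>z i\<bar>)"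
    using sub finP by (intro sum_mono2 prod_nonneg) auto
  also have "\<dots> = (\<Prod>i\<in>S. \<Sum>j\<in>{- int (4 * d)..int (4 * d)}. (1/2) ^ nat \<bar>j\<bar>)"
    unfolding P_def by (rule prod_sum_PiE[symmetric]) (use assms in auto)
  also have "\<dots> \<le> (\<Prod>i\<in>S. 3)"
    by (intro prod_mono conjI sum_nonneg sum_half_power_abs_le) auto
  finally have "real (card (lattice_net S)) * (1/2) ^ (4 * d) \<le> 3 ^ d" by (simp add: d_def)
  then have "real (card (lattice_net S)) \<le> 3 ^ d * 2 ^ (4 * d)"
    by (simp add: power_divide field_simps)
  also have "\<dots> = 48 ^ d" by (simp add: power_mult flip: power_mult_distrib)
  finally show "real (card (lattice_net S)) \<le> 48 ^ card S" by (simp add: d_def)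
qed

text \<open>Independent rounding: \<open>T\<close> is the set of coordinates rounded up, coordinate
  \<open>i\<close> with probability \<open>\<theta> i\<close>. The sums are the total mass and the
  marginal at \<open>i\<close>.\<close>

lemma sum_subset_weights:
  fixes \<theta> :: "'i \<Rightarrow> real"
  assumes "finite S"
  shows "(\<Sum>T\<in>Pow S. (\<Prod>i\<in>T. \<theta> i) * (\<Prod>i\<in>S - T. 1 - \<theta> i)) = 1"
    and "i \<in> S \<Longrightarrow> (\<Sum>T\<in>Pow S. (\<Prod>i\<in>T. \<theta> i) * (\<Prod>i\<in>S - T. 1 - \<theta> i) * (if i \<in> T then 1 else 0)) = \<theta> i"
proof -
  show "(\<Sum>T\<in>Pow S. (\<Prod>i\<in>T. \<theta> i) * (\<Prod>i\<in>S - T. 1 - \<theta> i)) = 1"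
    using prod_add[OF assms, of \<theta> "\<lambda>i. 1 - \<theta> i"] by simp
  assume i: "i \<in> S"
  \<comment> \<open>Replacing the factor \<open>1 - \<theta> i\<close> by 0 removes exactly the
    subsets that omit \<open>i\<close>, and the remaining sum factorises again.\<close>
  let ?g = "\<lambda>j. if j = i then 0 else 1 - \<theta> j"
  have "(\<Sum>T\<in>Pow S. (\<Prod>i\<in>T. \<theta> i) * (\<Prod>i\<in>S - T. 1 - \<theta> i) * (if i \<in> T then 1 else 0)) =
     (\<Sum>T\<in>Pow S. (\<Prod>i\<in>T. \<theta> i) * (\<Prod>j\<in>S - T. ?g j))"
  proof (intro sum.cong refl)
    fix T assume "T \<in> Pow S"
    show "(\<Prod>i\<in>T. \<theta> i) * (\<Prod>i\<in>S - T. 1 - \<theta> i) * (if i \<in> T then 1 else 0) = (\<Prod>i\<in>T. \<theta> i) * (\<Prod>j\<in>S - T. ?g j)"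
    proof (cases "i \<in> T")
      case True
      then have "(\<Prod>j\<in>S - T. ?g j) = (\<Prod>i\<in>S - T. 1 - \<theta> i)" by (intro prod.cong) auto
      with True show ?thesis by simp
    next
      case False
      then have "(\<Prod>j\<in>S - T. ?g j) = 0" using i assms by (intro prod_zero) auto
      with False show ?thesis by simp
    qed
  qed
  also have "\<dots> = (\<Prod>j\<in>S. \<theta> j + ?g j)" by (rule prod_add[OF assms, symmetric])
  also have "\<dots> = (\<Prod>j\<in>S. if j = i then \<theta> i else 1)" by (intro prod.cong) auto
  also have "\<dots> = \<theta> i" using i assms by simp
  finally show "(\<Sum>T\<in>Pow S. (\<Prod>i\<in>T. \<theta> i) * (\<Prod>i\<in>S - T. 1 - \<theta> i) * (if i \<in> T then 1 else 0)) = \<theta> i" .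
qed

lemma unit_ball_in_hull_lattice_net:
  fixes x :: "'i \<Rightarrow> real"
  assumes S: "finite S" and x: "(\<Sum>i\<in>S. (x i)\<^sup>2) \<le> 1"
  obtains w :: "('i \<Rightarrow> int) \<Rightarrow> real" where "\<And>z. 0 \<le> w z" "(\<Sum>z\<in>lattice_net S. w z) = 1"
    "\<And>i. i \<in> S \<Longrightarrow> (\<Sum>z\<in>lattice_net S. w z * real_of_int (z i)) = sqrt (real (card S)) * x i"
proof -
  define d where "d = card S"
  define y where "y i = sqrt (real d) * x i" for i
  define \<theta> where "\<theta> i = frac (y i)" for i
  define p where "p T = (\<Prod>i\<in>T. \<theta> i) * (\<Prod>i\<in>S - T. 1 - \<theta> i)" for T
  define r where "r T = (\<lambda>i\<in>S. \<lfloor>y i\<rfloor> + (if i \<in> T then 1 else 0))" for T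
  define w where "w z = sum p {T \<in> Pow S. r T = z}" for z
  have p0: "0 \<le> p T" for T
    unfolding p_def \<theta>_def by (intro mult_nonneg_nonneg prod_nonneg) (auto simp: less_imp_le[OF frac_lt_1])
  have rnet: "r T \<in> lattice_net S" for T
  proof -
    \<comment> \<open>Rounding moves \<open>y i\<close> by some \<open>e\<close> with
      \<open>e^2 \<le> 1\<close>, and \<open>(y + e)^2 \<le> 2 * y^2 + 2 * e^2\<close>. Summation
      gives \<open>2 * d + 2 * d\<close>, which is the bound in \<open>lattice_net\<close>.\<close>
    have sq: "(real_of_int (r T i))\<^sup>2 \<le> 2 * (y i)\<^sup>2 + 2" if "i \<in> S" for i
    proof -
      define e where "e = real_of_int (r T i) - y i"
      have "real_of_int \<lfloor>y i\<rfloor> \<le> y i" "y i < real_of_int \<lfloor>y i\<rfloor> + 1" by linarith+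
      then have "\<bar>e\<bar> \<le> 1" using that unfolding e_def r_def by (cases "i \<in> T") (simp_all add: abs_le_iff, linarith+)
      then have e: "e\<^sup>2 \<le> 1" by (simp add: abs_square_le_1)
      have "0 \<le> (y i - e)\<^sup>2" by simp
      moreover have "(real_of_int (r T i))\<^sup>2 = (y i + e)\<^sup>2" by (simp add: e_def)
      ultimately show ?thesis using e by (simp add: power2_sum power2_diff)
    qed
    have "real_of_int (\<Sum>i\<in>S. (r T i)\<^sup>2) \<le> (\<Sum>i\<in>S. 2 * (y i)\<^sup>2 + 2)"
      using sq by (simp add: sum_mono)
    also have "\<dots> = 2 * real d * (\<Sum>i\<in>S. (x i)\<^sup>2) + 2 * real d"
      by (simp add: y_def power_mult_distrib sum.distrib d_def sum_distrib_left mult.assoc)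
    also have "\<dots> \<le> 2 * real d * 1 + 2 * real d"
      using x by (intro add_right_mono mult_left_mono) auto
    finally have "real_of_int (\<Sum>i\<in>S. (r T i)\<^sup>2) \<le> real_of_int (4 * int d)" by simp
    then have "(\<Sum>i\<in>S. (r T i)\<^sup>2) \<le> 4 * int d" by (simp only: of_int_le_iff)
    then show ?thesis by (auto simp: lattice_net_def r_def d_def)
  qed
  have push: "(\<Sum>z\<in>lattice_net S. w z * g z) = (\<Sum>T\<in>Pow S. p T * g (r T))" for g :: "('i \<Rightarrow> int) \<Rightarrow> real"
  proof -
    have "(\<Sum>z\<in>lattice_net S. w z * g z) = (\<Sum>z\<in>lattice_net S. \<Sum>T\<in>{T \<in> Pow S. r T = z}. p T * g (r T))"
      unfolding w_def by (intro sum.cong refl) (simp add: sum_distrib_right)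
    also have "\<dots> = (\<Sum>T\<in>Pow S. p T * g (r T))"
      using S card_lattice_net(1)[OF S] rnet by (intro sum.group) auto
    finally show ?thesis .
  qed
  show ?thesis
  proof (rule that)
    show "0 \<le> w z" for z unfolding w_def by (intro sum_nonneg p0)
    show "(\<Sum>z\<in>lattice_net S. w z) = 1"
      using push[of "\<lambda>_. 1"] sum_subset_weights(1)[OF S, where \<theta> = \<theta>] by (simp add: p_def)
    fix i assume i: "i \<in> S"
    have "(\<Sum>z\<in>lattice_net S. w z * real_of_int (z i)) = (\<Sum>T\<in>Pow S. p T * real_of_int (r T i))"
      by (rule push)
    also have "\<dots> = (\<Sum>T\<in>Pow S. p T * of_int \<lfloor>y i\<rfloor> + p T * (if i \<in> T then 1 else 0))"
      using i by (intro sum.cong refl) (simp add: r_def distrib_left)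
    also have "\<dots> = of_int \<lfloor>y i\<rfloor> + \<theta> i"
      using sum_subset_weights[OF S, where \<theta> = \<theta>] i unfolding p_def
      by (simp add: sum.distrib flip: sum_distrib_right)
    also have "\<dots> = sqrt (real (card S)) * x i"
      by (simp add: \<theta>_def frac_def y_def d_def)
    finally show "(\<Sum>z\<in>lattice_net S. w z * real_of_int (z i)) = sqrt (real (card S)) * x i" .
  qed
qed

text \<open>Expanding both arguments with the same weights writes the rank-one matrix of
  \<open>x\<close>, after scaling, as a mixture of products of net points. The weights do not depend
  on the matrix \<open>A\<close>, so one choice serves many bilinear forms at once. The squared norm
  of \<open>x\<close> stands on the left so that \<open>x = 0\<close> is included.\<close>

lemma bilinear_lattice_net:
  fixes x :: "'i \<Rightarrow> real"
  assumes S: "finite S"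
  obtains w :: "('i \<Rightarrow> int) \<Rightarrow> real" where "\<And>z. 0 \<le> w z" "(\<Sum>z\<in>lattice_net S. w z) = 1"
    "\<And>A. (\<Sum>i\<in>S. (x i)\<^sup>2) * (\<Sum>z\<in>lattice_net S. \<Sum>z'\<in>lattice_net S. w z * w z' *
        (\<Sum>i\<in>S. \<Sum>j\<in>S. A i j * real_of_int (z i) * real_of_int (z' j)))
      = real (card S) * (\<Sum>i\<in>S. \<Sum>j\<in>S. A i j * x i * x j)"
proof -
  let ?N = "lattice_net S" and ?q = "sqrt (real (card S))"
  define s where "s = sqrt (\<Sum>i\<in>S. (x i)\<^sup>2)"
  have s2: "s\<^sup>2 = (\<Sum>i\<in>S. (x i)\<^sup>2)" unfolding s_def by (simp add: sum_nonneg)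
  \<comment> \<open>For \<open>x = 0\<close> the division yields \<open>u = 0\<close>, which still
    lies in the unit ball.\<close>
  define u where "u i = x i / s" for i
  have "(\<Sum>i\<in>S. (u i)\<^sup>2) = s\<^sup>2 / s\<^sup>2"
    unfolding u_def s2 by (simp add: power_divide flip: sum_divide_distrib s2)
  then have "(\<Sum>i\<in>S. (u i)\<^sup>2) \<le> 1" by simp
  from unit_ball_in_hull_lattice_net[OF S this] obtain w where w: "\<And>z. 0 \<le> w z" "(\<Sum>z\<in>?N. w z) = 1"
    "\<And>i. i \<in> S \<Longrightarrow> (\<Sum>z\<in>?N. w z * real_of_int (z i)) = ?q * u i" by blast
  have xu: "x i = s * u i" if "i \<in> S" for i
  proof (cases "s = 0")
    case True
    then have "(\<Sum>i\<in>S. (x i)\<^sup>2) = 0" using s2 by simp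
    then have "\<forall>i\<in>S. x i = 0" using S by (subst (asm) sum_nonneg_eq_0_iff) auto
    with that True show ?thesis by simp
  qed (simp add: u_def)
  show ?thesis
  proof (rule that[OF w(1,2)])
    fix A
    have "(\<Sum>z\<in>?N. \<Sum>z'\<in>?N. w z * w z' * (\<Sum>i\<in>S. \<Sum>j\<in>S. A i j * real_of_int (z i) * real_of_int (z' j)))
      = (\<Sum>z\<in>?N. \<Sum>i\<in>S. \<Sum>j\<in>S. \<Sum>z'\<in>?N. A i j * (w z * real_of_int (z i)) * (w z' * real_of_int (z' j)))"
      unfolding sum_distrib_left
      by (intro sum.cong refl, subst sum.swap, intro sum.cong refl, subst sum.swap, intro sum.cong refl) (simp add: mult_ac)
    also have "\<dots> = (\<Sum>z\<in>?N. \<Sum>i\<in>S. \<Sum>j\<in>S. A i j * (w z * real_of_int (z i)) * (?q * u j))"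
      by (intro sum.cong refl) (simp add: w(3) flip: sum_distrib_left)
    also have "\<dots> = (\<Sum>i\<in>S. \<Sum>j\<in>S. \<Sum>z\<in>?N. A i j * (w z * real_of_int (z i)) * (?q * u j))"
      by (subst sum.swap, intro sum.cong refl, rule sum.swap)
    also have "\<dots> = (\<Sum>i\<in>S. \<Sum>j\<in>S. A i j * (?q * u i) * (?q * u j))"
      by (intro sum.cong refl) (simp add: w(3) flip: sum_distrib_left sum_distrib_right)
    finally have "(\<Sum>i\<in>S. (x i)\<^sup>2) * (\<Sum>z\<in>?N. \<Sum>z'\<in>?N. w z * w z' *
        (\<Sum>i\<in>S. \<Sum>j\<in>S. A i j * real_of_int (z i) * real_of_int (z' j)))
      = (\<Sum>i\<in>S. \<Sum>j\<in>S. s\<^sup>2 * (A i j * (?q * u i) * (?q * u j)))"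
      by (simp add: sum_distrib_left flip: s2)
    also have "\<dots> = (\<Sum>i\<in>S. \<Sum>j\<in>S. real (card S) * (A i j * x i * x j))"
    proof (intro sum.cong refl)
      fix i j assume ij: "i \<in> S" "j \<in> S"
      have "s\<^sup>2 * (A i j * (?q * u i) * (?q * u j)) = (?q * ?q) * (A i j * (s * u i) * (s * u j))"
        by (simp only: mult_ac power2_eq_square)
      then show "s\<^sup>2 * (A i j * (?q * u i) * (?q * u j)) = real (card S) * (A i j * x i * x j)"
        using xu ij by simp
    qed
    finally show "(\<Sum>i\<in>S. (x i)\<^sup>2) * (\<Sum>z\<in>?N. \<Sum>z'\<in>?N. w z * w z' *
        (\<Sum>i\<in>S. \<Sum>j\<in>S. A i j * real_of_int (z i) * real_of_int (z' j)))
      = real (card S) * (\<Sum>i\<in>S. \<Sum>j\<in>S. A i j * x i * x j)"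
      by (simp only: sum_distrib_left)
  qed
qed

text \<open>A lower bound at pairs of net points survives convex combination in each argument.
  Pairs, not single points, have to be tested because the two copies of \<open>x\<close> are
  expanded separately.\<close>

lemma quadratic_form_ge_lattice_net:
  fixes A :: "'i \<Rightarrow> 'i \<Rightarrow> real"
  assumes S: "finite S"
    and net: "\<And>z z'. z \<in> lattice_net S \<Longrightarrow> z' \<in> lattice_net S \<Longrightarrow>
      - real (card S) \<le> (\<Sum>i\<in>S. \<Sum>j\<in>S. A i j * real_of_int (z i) * real_of_int (z' j))"
  shows "- (\<Sum>i\<in>S. (x i)\<^sup>2) \<le> (\<Sum>i\<in>S. \<Sum>j\<in>S. A i j * x i * x j)"
proof (cases "S = {}")
  case False
  let ?N = "lattice_net S"
  have d: "real (card S) > 0" using S False by (simp add: card_gt_0_iff)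
  obtain w where w: "\<And>z. 0 \<le> w z" "(\<Sum>z\<in>?N. w z) = 1"
    "\<And>A. (\<Sum>i\<in>S. (x i)\<^sup>2) * (\<Sum>z\<in>?N. \<Sum>z'\<in>?N. w z * w z' *
        (\<Sum>i\<in>S. \<Sum>j\<in>S. A i j * real_of_int (z i) * real_of_int (z' j)))
      = real (card S) * (\<Sum>i\<in>S. \<Sum>j\<in>S. A i j * x i * x j)"
    using bilinear_lattice_net[OF S, of x] by blast
  have "- real (card S) = (\<Sum>z\<in>?N. w z) * (\<Sum>z\<in>?N. w z) * - real (card S)"
    by (simp add: w(2))
  also have "\<dots> = (\<Sum>z\<in>?N. \<Sum>z'\<in>?N. w z * w z' * - real (card S))"
    unfolding sum_product by (simp only: sum_distrib_right)
  also have "\<dots> \<le> (\<Sum>z\<in>?N. \<Sum>z'\<in>?N. w z * w z' * (\<Sum>i\<in>S. \<Sum>j\<in>S. A i j * real_of_int (z i) * real_of_int (z' j)))"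
    by (intro sum_mono mult_left_mono net mult_nonneg_nonneg w(1))
  finally have "(\<Sum>i\<in>S. (x i)\<^sup>2) * - real (card S) \<le> real (card S) * (\<Sum>i\<in>S. \<Sum>j\<in>S. A i j * x i * x j)"
    unfolding w(3)[symmetric] by (intro mult_left_mono sum_nonneg) auto
  then have "real (card S) * - (\<Sum>i\<in>S. (x i)\<^sup>2) \<le> real (card S) * (\<Sum>i\<in>S. \<Sum>j\<in>S. A i j * x i * x j)"
    by (simp add: mult.commute)
  then show ?thesis using d by (simp only: mult_le_cancel_left_pos)
qed simp

text \<open>Maurey's empirical method, derandomised: each new sample can be chosen so that the squared
  deviation grows by at most \<open>R\<^sup>2\<close>.\<close>

lemma empirical_approximation:
  fixes V :: "'a \<Rightarrow> nat \<Rightarrow> real"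
  assumes P: "finite P" and w: "\<And>a. a \<in> P \<Longrightarrow> 0 \<le> w a" "(\<Sum>a\<in>P. w a) = 1"
    and y: "\<And>i. i < D \<Longrightarrow> y i = (\<Sum>a\<in>P. w a * V a i)"
    and V: "\<And>a. a \<in> P \<Longrightarrow> (\<Sum>i<D. (V a i)\<^sup>2) \<le> R2"
  shows "\<exists>s. (\<forall>j<m. s j \<in> P) \<and> (\<Sum>i<D. ((\<Sum>j<m. V (s j) i) - real m * y i)\<^sup>2) \<le> real m * R2"
proof (induction m)
  case (Suc m)
  then obtain s where s: "\<forall>j<m. s j \<in> P" "(\<Sum>i<D. ((\<Sum>j<m. V (s j) i) - real m * y i)\<^sup>2) \<le> real m * R2"
    by blast
  define e where "e i = (\<Sum>j<m. V (s j) i) - real m * y i" for i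
  \<comment> \<open>Averaged over the next sample the cross term vanishes, because
    \<open>V a - y\<close> has mean 0; only its variance, at most \<open>R2\<close>, is
    added.\<close>
  have mean: "(\<Sum>a\<in>P. w a * (\<Sum>i<D. (e i + V a i - y i)\<^sup>2)) \<le> (\<Sum>i<D. (e i)\<^sup>2) + R2"
  proof -
    have "(\<Sum>a\<in>P. w a * (\<Sum>i<D. (e i + V a i - y i)\<^sup>2)) = (\<Sum>i<D. \<Sum>a\<in>P. w a * (e i + V a i - y i)\<^sup>2)"
      unfolding sum_distrib_left by (rule sum.swap)
    also have "\<dots> = (\<Sum>i<D. (e i)\<^sup>2 + (\<Sum>a\<in>P. w a * (V a i)\<^sup>2) - (y i)\<^sup>2)"
    proof (intro sum.cong refl)
      fix i assume "i \<in> {..<D}"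
      have "(\<Sum>a\<in>P. w a * (e i + V a i - y i)\<^sup>2) =
        (\<Sum>a\<in>P. w a * (e i - y i)\<^sup>2 + 2 * (e i - y i) * (w a * V a i) + w a * (V a i)\<^sup>2)"
        by (intro sum.cong refl) (simp add: power2_eq_square algebra_simps)
      also have "\<dots> = (\<Sum>a\<in>P. w a) * (e i - y i)\<^sup>2 + 2 * (e i - y i) * (\<Sum>a\<in>P. w a * V a i) + (\<Sum>a\<in>P. w a * (V a i)\<^sup>2)"
        by (simp add: sum.distrib sum_distrib_left sum_distrib_right)
      also have "\<dots> = (e i)\<^sup>2 + (\<Sum>a\<in>P. w a * (V a i)\<^sup>2) - (y i)\<^sup>2"
        using y[of i] \<open>i \<in> _\<close> by (simp add: w(2) power2_eq_square algebra_simps)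
      finally show "(\<Sum>a\<in>P. w a * (e i + V a i - y i)\<^sup>2) = (e i)\<^sup>2 + (\<Sum>a\<in>P. w a * (V a i)\<^sup>2) - (y i)\<^sup>2" .
    qed
    also have "\<dots> \<le> (\<Sum>i<D. (e i)\<^sup>2 + (\<Sum>a\<in>P. w a * (V a i)\<^sup>2))"
      by (intro sum_mono) simp
    also have "\<dots> = (\<Sum>i<D. (e i)\<^sup>2) + (\<Sum>a\<in>P. w a * (\<Sum>i<D. (V a i)\<^sup>2))"
      by (simp add: sum.distrib sum_distrib_left sum.swap[of _ P])
    also have "(\<Sum>a\<in>P. w a * (\<Sum>i<D. (V a i)\<^sup>2)) \<le> (\<Sum>a\<in>P. w a * R2)"
      using w(1) V by (intro sum_mono mult_left_mono)
    also have "\<dots> = R2" by (simp add: w(2) flip: sum_distrib_right)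
    finally show ?thesis by simp
  qed
  \<comment> \<open>Some sample does no worse than the weighted mean: if all were worse, then so
    would be the mean, as some weight is positive.\<close>
  have "\<exists>a\<in>P. (\<Sum>i<D. (e i + V a i - y i)\<^sup>2) \<le> (\<Sum>i<D. (e i)\<^sup>2) + R2"
  proof (rule ccontr)
    assume "\<not> ?thesis"
    then have gt: "(\<Sum>i<D. (e i + V a i - y i)\<^sup>2) > (\<Sum>i<D. (e i)\<^sup>2) + R2" if "a \<in> P" for a
      using that by force
    obtain a0 where a0: "a0 \<in> P" "w a0 \<noteq> 0"
      using w(2) by (metis sum.neutral zero_neq_one)
    have "(\<Sum>a\<in>P. w a * ((\<Sum>i<D. (e i)\<^sup>2) + R2)) < (\<Sum>a\<in>P. w a * (\<Sum>i<D. (e i + V a i - y i)\<^sup>2))"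
    proof (rule sum_strict_mono_ex1[OF P])
      show "\<forall>a\<in>P. w a * ((\<Sum>i<D. (e i)\<^sup>2) + R2) \<le> w a * (\<Sum>i<D. (e i + V a i - y i)\<^sup>2)"
        using w(1) gt by (intro ballI mult_left_mono) (auto intro: less_imp_le)
      show "\<exists>a\<in>P. w a * ((\<Sum>i<D. (e i)\<^sup>2) + R2) < w a * (\<Sum>i<D. (e i + V a i - y i)\<^sup>2)"
        using a0 w(1)[OF a0(1)] gt[OF a0(1)] by (intro bexI[of _ a0] mult_strict_left_mono) auto
    qed
    with mean show False by (simp add: w(2) flip: sum_distrib_right)
  qed
  then obtain a where a: "a \<in> P" "(\<Sum>i<D. (e i + V a i - y i)\<^sup>2) \<le> (\<Sum>i<D. (e i)\<^sup>2) + R2" by blast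
  define s' where "s' = s(m := a)"
  have "(\<Sum>j<Suc m. V (s' j) i) - real (Suc m) * y i = e i + V a i - y i" for i
    by (simp add: s'_def e_def algebra_simps)
  then have "(\<Sum>i<D. ((\<Sum>j<Suc m. V (s' j) i) - real (Suc m) * y i)\<^sup>2) \<le> real (Suc m) * R2"
    using a s(2) by (simp add: e_def[symmetric] algebra_simps)
  moreover have "\<forall>j<Suc m. s' j \<in> P" using s a by (auto simp: s'_def less_Suc_eq)
  ultimately show ?case by blast
qed simp

text \<open>Completing the square, one variable at a time; in case \<open>B s s = 0\<close> the division below gives 0,
  and positivity forces the whole row of \<open>s\<close> to vanish.\<close>

lemma psd_sum_squares:
  fixes B :: "'i \<Rightarrow> 'i \<Rightarrow> real"
  assumes "finite S" "\<And>i j. i \<in> S \<Longrightarrow> j \<in> S \<Longrightarrow> B i j = B j i"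
    "\<And>x. 0 \<le> (\<Sum>i\<in>S. \<Sum>j\<in>S. B i j * x i * x j)"
  shows "\<exists>(N::nat) v. \<forall>i\<in>S. \<forall>j\<in>S. B i j = (\<Sum>l<N. v l i * v l j)"
  using assms
proof (induction S arbitrary: B)
  case (insert s S)
  note sym = insert.prems(1) and psd = insert.prems(2)
  have expand: "(\<Sum>i\<in>insert s S. \<Sum>j\<in>insert s S. B i j * x i * x j) =
      B s s * (x s)\<^sup>2 + 2 * x s * (\<Sum>j\<in>S. B s j * x j) + (\<Sum>i\<in>S. \<Sum>j\<in>S. B i j * x i * x j)" for x
  proof -
    have "(\<Sum>i\<in>S. B i s * x i * x s) = x s * (\<Sum>j\<in>S. B s j * x j)"
      unfolding sum_distrib_left using sym by (intro sum.cong refl) (simp add: mult_ac)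
    moreover have "(\<Sum>j\<in>S. B s j * x s * x j) = x s * (\<Sum>j\<in>S. B s j * x j)"
      unfolding sum_distrib_left by (intro sum.cong refl) (simp add: mult_ac)
    ultimately show ?thesis using insert.hyps
      by (simp add: sum.distrib power2_eq_square algebra_simps)
  qed
  have bs: "0 \<le> B s s"
  proof -
    have "(\<Sum>j\<in>S. B s j * (if j = s then 1 else 0)) = 0"
      "(\<Sum>i\<in>S. \<Sum>j\<in>S. B i j * (if i = s then 1 else 0) * (if j = s then 1 else 0)) = 0"
      using insert.hyps by (auto intro!: sum.neutral)
    then show ?thesis
      using psd[of "\<lambda>i. if i = s then 1 else 0"] expand[of "\<lambda>i. if i = s then 1 else 0"] by simp
  qed
  have row0: "B s j = 0" if "B s s = 0" "j \<in> S" for j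
  proof (rule ccontr)
    assume nz: "B s j \<noteq> 0"
    \<comment> \<open>Chosen so that the quadratic form takes the value \<open>- 1\<close> at the
      vector with entries \<open>t\<close> at \<open>s\<close> and 1 at \<open>j\<close>.\<close>
    define t where "t = - (B j j + 1) / (2 * B s j)"
    have js: "j \<noteq> s" using that insert.hyps by auto
    let ?x = "\<lambda>i. if i = s then t else if i = j then 1 else 0"
    have "(\<Sum>l\<in>S. B s l * ?x l) = B s j"
    proof -
      have "(\<Sum>l\<in>S. B s l * ?x l) = (\<Sum>l\<in>S. if l = j then B s l else 0)"
        using insert.hyps by (intro sum.cong refl) auto
      then show ?thesis using that insert.hyps by simp
    qed
    moreover have "(\<Sum>i\<in>S. \<Sum>l\<in>S. B i l * ?x i * ?x l) = B j j"
    proof -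
      have "(\<Sum>i\<in>S. \<Sum>l\<in>S. B i l * ?x i * ?x l) = (\<Sum>i\<in>S. \<Sum>l\<in>S. if l = j then (if i = j then B i l else 0) else 0)"
        using insert.hyps by (intro sum.cong refl) auto
      then show ?thesis using that insert.hyps by simp
    qed
    ultimately have "0 \<le> 2 * t * B s j + B j j"
      using psd[of ?x] expand[of ?x] that by simp
    moreover have "2 * t * B s j = - (B j j + 1)" using nz by (simp add: t_def)
    ultimately show False by simp
  qed
  \<comment> \<open>The Schur complement of the entry \<open>B s s\<close>.\<close>
  define C where "C i j = B i j - B i s * B s j / B s s" for i j
  have "\<exists>(N::nat) v. \<forall>i\<in>S. \<forall>j\<in>S. C i j = (\<Sum>l<N. v l i * v l j)"
  proof (rule insert.IH)
    fix i j assume "i \<in> S" "j \<in> S"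
    then have "B i j = B j i" "B i s = B s i" "B s j = B j s" using sym[of i j] sym[of i s] sym[of s j] by auto
    then show "C i j = C j i" by (simp add: C_def)
  next
    fix x :: "'i \<Rightarrow> real"
    define c where "c = (\<Sum>j\<in>S. B s j * x j)"
    \<comment> \<open>The value at \<open>s\<close> minimises the form given the other coordinates;
      the minimum is the form of \<open>C\<close>.\<close>
    define x' where "x' = x(s := - c / B s s)"
    have x': "x' i = x i" if "i \<in> S" for i using that insert.hyps by (auto simp: x'_def)
    have e: "0 \<le> B s s * (x' s)\<^sup>2 + 2 * x' s * c + (\<Sum>i\<in>S. \<Sum>j\<in>S. B i j * x i * x j)"
      using psd[of x'] unfolding expand by (simp add: x' c_def cong: sum.cong)
    have "(\<Sum>i\<in>S. \<Sum>j\<in>S. (B i s * B s j / B s s) * x i * x j) = c * c / B s s"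
    proof -
      have "(\<Sum>i\<in>S. \<Sum>j\<in>S. (B i s * B s j / B s s) * x i * x j) = (\<Sum>i\<in>S. \<Sum>j\<in>S. (B s i * x i) * (B s j * x j)) / B s s"
        unfolding sum_divide_distrib using sym by (intro sum.cong refl) simp
      then show ?thesis by (simp add: c_def sum_product)
    qed
    then have "(\<Sum>i\<in>S. \<Sum>j\<in>S. C i j * x i * x j) = (\<Sum>i\<in>S. \<Sum>j\<in>S. B i j * x i * x j) - c * c / B s s"
      by (simp add: C_def left_diff_distrib sum_subtractf)
    also have "\<dots> = B s s * (x' s)\<^sup>2 + 2 * x' s * c + (\<Sum>i\<in>S. \<Sum>j\<in>S. B i j * x i * x j)"
      by (cases "B s s = 0") (simp_all add: x'_def power2_eq_square)
    finally show "0 \<le> (\<Sum>i\<in>S. \<Sum>j\<in>S. C i j * x i * x j)" using e by simp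
  qed
  then obtain N :: nat and v where v: "\<And>i j. i \<in> S \<Longrightarrow> j \<in> S \<Longrightarrow> C i j = (\<Sum>l<N. v l i * v l j)" by blast
  define v' where "v' l i = (if l = N then B i s / sqrt (B s s) else if i = s then 0 else v l i)" for l i
  have "B i j = (\<Sum>l<Suc N. v' l i * v' l j)" if ij: "i \<in> insert s S" "j \<in> insert s S" for i j
  proof -
    have last: "v' N i * v' N j = B i s * B s j / B s s"
      using bs sym[of j s] ij by (simp add: v'_def)
    consider "i \<in> S" "j \<in> S" | "i = s" | "j = s" using ij by auto
    then show ?thesis
    proof cases
      case 1
      then have "i \<noteq> s" "j \<noteq> s" using insert.hyps by auto
      then have "(\<Sum>l<N. v' l i * v' l j) = (\<Sum>l<N. v l i * v l j)"
        by (intro sum.cong refl) (auto simp: v'_def)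
      then show ?thesis using v[OF 1] last by (simp add: C_def)
    next
      case 2
      then have "(\<Sum>l<N. v' l i * v' l j) = 0" by (intro sum.neutral) (auto simp: v'_def)
      then show ?thesis using last 2 row0[of j] ij by (cases "B s s = 0") auto
    next
      case 3
      then have "(\<Sum>l<N. v' l i * v' l j) = 0" by (intro sum.neutral) (auto simp: v'_def)
      then show ?thesis using last 3 row0[of i] sym[of i s] ij by (cases "B s s = 0") auto
    qed
  qed
  then show ?case by blast
qed simp

section \<open>Volumes of balls, caps and convex bodies\<close>

definition vball :: "nat \<Rightarrow> (nat \<Rightarrow> real) \<Rightarrow> real \<Rightarrow> (nat \<Rightarrow> real) set" where
  "vball D y r = {c \<in> {..<D} \<rightarrow>\<^sub>E UNIV. (\<Sum>i<D. (c i - y i)\<^sup>2) \<le> r\<^sup>2}"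

lemma vball_sets [measurable]: "vball D y r \<in> sets (lebesgue_n D)"
proof -
  have "vball D y r = {c \<in> space (lebesgue_n D). (\<Sum>i<D. (c i - y i)\<^sup>2) \<le> r\<^sup>2}"
    by (auto simp: vball_def space_PiM)
  also have "\<dots> \<in> sets (lebesgue_n D)" by measurable
  finally show ?thesis .
qed

lemma emeasure_vball:
  assumes "r > 0"
  shows "emeasure (lebesgue_n D) (vball D y r) = ennreal (unit_ball_vol (real D) * r ^ D)"
proof -
  let ?L = "lebesgue_n D" and ?T = "vec_affine D 1 (\<lambda>i. - y i)"
  have c: "vball D (\<lambda>_. 0) r = {f. sqrt (\<Sum>i<D. (f i)\<^sup>2) \<le> r} \<inter> space ?L"
  proof -
    have "sqrt (\<Sum>i<D. (f i)\<^sup>2) \<le> r \<longleftrightarrow> (\<Sum>i<D. (f i)\<^sup>2) \<le> r\<^sup>2" for f :: "nat \<Rightarrow> real"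
      using assms by (simp add: real_sqrt_le_iff[of _ "r\<^sup>2", simplified] sqrt_le_D real_le_lsqrt sum_nonneg iffI)
    then show ?thesis by (auto simp: vball_def space_PiM)
  qed
  have p: "vball D y r = ?T -` vball D (\<lambda>_. 0) r \<inter> space ?L"
    by (auto simp: vball_def vec_affine_def space_PiM)
  have "emeasure ?L (vball D y r) = emeasure (distr ?L ?L ?T) (vball D (\<lambda>_. 0) r)"
    unfolding p by (rule emeasure_distr[symmetric]) (rule vec_affine_measurable', rule vball_sets)
  also have "\<dots> = emeasure ?L (vball D (\<lambda>_. 0) r)"
    by (simp add: lebesgue_n_shift_reflect)
  also have "\<dots> = ennreal (unit_ball_vol (real D) * r ^ D)"
    unfolding c using emeasure_cball_aux[of "{..<D}" r] assms by simp
  finally show ?thesis .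
qed

lemma measure_vball: "r > 0 \<Longrightarrow> measure (lebesgue_n D) (vball D y r) = unit_ball_vol (real D) * r ^ D"
  by (simp add: measure_def emeasure_vball)

lemma emeasure_lebesgue_n_scale:
  assumes c: "c > 0" and A: "A \<in> sets (lebesgue_n n)"
  shows "emeasure (lebesgue_n n) A =
    ennreal (c ^ n) * emeasure (lebesgue_n n) (vec_affine n c (\<lambda>_. 0) -` A \<inter> space (lebesgue_n n))"
proof -
  interpret product_sigma_finite "\<lambda>_::nat. lborel :: real measure" ..
  let ?L = "lebesgue_n n" and ?T = "vec_affine n c (\<lambda>_. 0)"
  have "scale_measure (ennreal (c ^ n)) (distr ?L ?L ?T) = ?L"
  proof (rule PiM_eqI)
    fix A :: "nat \<Rightarrow> real set" assume A: "\<And>i. i \<in> {..<n} \<Longrightarrow> A i \<in> sets lborel"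
    have pre: "?T -` Pi\<^sub>E {..<n} A \<inter> space ?L = Pi\<^sub>E {..<n} (\<lambda>i. (\<lambda>y. 0 + c * y) -` A i \<inter> space lborel)"
      by (auto simp: vec_affine_def space_PiM PiE_iff)
    have m: "(\<lambda>y. 0 + c * y) -` A i \<inter> space lborel \<in> sets lborel" if "i < n" for i
      using A[of i] that by (intro measurable_sets[of _ lborel lborel]) auto
    have one: "ennreal c * emeasure lborel ((\<lambda>y. 0 + c * y) -` A i \<inter> space lborel) = emeasure lborel (A i)"
      if "i < n" for i
    proof -
      have Ai: "A i \<in> sets borel" using A[of i] that by simp
      have "emeasure lborel (A i) = emeasure (density (distr lborel borel (\<lambda>y. 0 + c * y)) (\<lambda>_. ennreal \<bar>c\<bar>)) (A i)"
        using lborel_real_affine[of c 0] c by simp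
      also have "\<dots> = ennreal c * emeasure (distr lborel borel (\<lambda>y. 0 + c * y)) (A i)"
        using c Ai by (subst emeasure_density) (auto simp: nn_integral_cmult)
      also have "emeasure (distr lborel borel (\<lambda>y. 0 + c * y)) (A i) =
          emeasure lborel ((\<lambda>y. 0 + c * y) -` A i \<inter> space lborel)"
        using Ai by (intro emeasure_distr) auto
      finally show ?thesis ..
    qed
    have "emeasure (scale_measure (ennreal (c ^ n)) (distr ?L ?L ?T)) (Pi\<^sub>E {..<n} A)
      = ennreal (c ^ n) * (\<Prod>i<n. emeasure lborel ((\<lambda>y. 0 + c * y) -` A i \<inter> space lborel))"
      using A m emeasure_PiM[of "{..<n}" "\<lambda>i. (\<lambda>y. 0 + c * y) -` A i \<inter> space lborel"]
      by (subst emeasure_scale_measure, subst emeasure_distr) (simp_all add: pre sets_PiM_I_finite del: space_lborel)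
    also have "\<dots> = (\<Prod>i<n. ennreal c * emeasure lborel ((\<lambda>y. 0 + c * y) -` A i \<inter> space lborel))"
      using c by (simp add: prod.distrib ennreal_power)
    also have "\<dots> = (\<Prod>i<n. emeasure lborel (A i))"
      using one by (intro prod.cong) auto
    finally show "emeasure (scale_measure (ennreal (c ^ n)) (distr ?L ?L ?T)) (Pi\<^sub>E {..<n} A)
      = (\<Prod>i\<in>{..<n}. emeasure lborel (A i))" by simp
  qed auto
  then have "emeasure ?L A = emeasure (scale_measure (ennreal (c ^ n)) (distr ?L ?L ?T)) A" by simp
  also have "\<dots> = ennreal (c ^ n) * emeasure (distr ?L ?L ?T) A" by simp
  also have "emeasure (distr ?L ?L ?T) A = emeasure ?L (?T -` A \<inter> space ?L)"
    by (rule emeasure_distr[OF vec_affine_measurable' A])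
  finally show ?thesis .
qed

lemma rational_point_in_vball:
  fixes x :: "nat \<Rightarrow> real"
  assumes "\<rho> > 0"
  shows "\<exists>q \<in> {..<D} \<rightarrow>\<^sub>E \<rat>. (\<Sum>i<D. (x i - q i)\<^sup>2) \<le> \<rho>\<^sup>2"
proof -
  have "\<exists>r\<in>\<rat>. \<bar>x i - r\<bar> \<le> \<rho> / (real D + 1)" for i
  proof -
    obtain r where "r \<in> \<rat>" "x i < r" "r < x i + \<rho> / (real D + 1)"
      using Rats_dense_in_real[of "x i" "x i + \<rho> / (real D + 1)"] assms by auto
    then show ?thesis by (intro bexI[of _ r]) auto
  qed
  then obtain r where r: "\<And>i. r i \<in> \<rat>" "\<And>i. \<bar>x i - r i\<bar> \<le> \<rho> / (real D + 1)" by metis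
  let ?q = "\<lambda>i\<in>{..<D}. r i"
  have "(\<Sum>i<D. (x i - ?q i)\<^sup>2) \<le> (\<Sum>i<D. (\<rho> / (real D + 1))\<^sup>2)"
  proof (rule sum_mono)
    fix i assume "i \<in> {..<D}"
    have "\<bar>x i - r i\<bar>\<^sup>2 \<le> (\<rho> / (real D + 1))\<^sup>2" by (intro power_mono r) auto
    with \<open>i \<in> _\<close> show "(x i - ?q i)\<^sup>2 \<le> (\<rho> / (real D + 1))\<^sup>2" by simp
  qed
  also have "\<dots> = \<rho>\<^sup>2 * (real D / (real D + 1)\<^sup>2)" by (simp add: power_divide)
  also have "\<dots> \<le> \<rho>\<^sup>2 * 1"
    by (intro mult_left_mono) (auto simp: power2_eq_square divide_le_eq algebra_simps)
  finally show ?thesis using r(1) by (intro bexI[of _ ?q]) auto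
qed

text \<open>The union \<open>U\<close> of the rational balls contained in \<open>K\<close> satisfies \<open>\<lambda> K \<subseteq> U \<subseteq> K\<close> for all \<open>\<lambda> < 1\<close>,
  so \<open>K\<close> differs from it by a null set.\<close>

lemma convex_body_sets_completion:
  assumes K: "K \<subseteq> {..<D} \<rightarrow>\<^sub>E UNIV"
    and conv: "\<And>x y t. x \<in> K \<Longrightarrow> y \<in> K \<Longrightarrow> 0 \<le> t \<Longrightarrow> t \<le> 1 \<Longrightarrow>
      (\<lambda>i\<in>{..<D}. t * x i + (1 - t) * y i) \<in> K"
    and \<delta>: "\<delta> > 0" "vball D (\<lambda>_. 0) \<delta> \<subseteq> K"
    and B: "K \<subseteq> B" "B \<in> sets (lebesgue_n D)" "emeasure (lebesgue_n D) B < \<infinity>"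
  shows "K \<in> sets (completion (lebesgue_n D))"
proof -
  let ?L = "lebesgue_n D"
  define I where "I = {(q, \<rho>). q \<in> {..<D} \<rightarrow>\<^sub>E \<rat> \<and> \<rho> \<in> \<rat> \<and> vball D q \<rho> \<subseteq> K}"
  define U where "U = (\<Union>(q, \<rho>)\<in>I. vball D q \<rho>)"
  have "I \<subseteq> ({..<D} \<rightarrow>\<^sub>E \<rat>) \<times> \<rat>" by (auto simp: I_def)
  then have "countable I"
    by (rule countable_subset) (intro countable_SIGMA countable_PiE countable_rat, simp)
  then have Us: "U \<in> sets ?L"
    unfolding U_def by (intro sets.countable_UN') auto
  have UK: "U \<subseteq> K" by (auto simp: U_def I_def)
  have inU: "vec_affine D l (\<lambda>_. 0) x \<in> U" if x: "x \<in> K" and l: "0 < l" "l < 1" for x l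
  proof -
    let ?lx = "vec_affine D l (\<lambda>_. 0) x"
    \<comment> \<open>Contracting towards a ball inside \<open>K\<close> leaves room: every point of
      this ball is a convex combination of \<open>x\<close> and a point of the
      \<open>\<delta>\<close>-ball.\<close>
    have sub: "vball D ?lx ((1 - l) * \<delta>) \<subseteq> K"
    proof
      fix u assume u: "u \<in> vball D ?lx ((1 - l) * \<delta>)"
      define v where "v = (\<lambda>i\<in>{..<D}. (u i - l * x i) / (1 - l))"
      have "(\<Sum>i<D. (v i)\<^sup>2) = (\<Sum>i<D. (u i - ?lx i)\<^sup>2) / (1 - l)\<^sup>2"
        unfolding sum_divide_distrib by (intro sum.cong refl) (simp add: v_def vec_affine_def power_divide)
      also have "\<dots> \<le> ((1 - l) * \<delta>)\<^sup>2 / (1 - l)\<^sup>2"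
        using u by (intro divide_right_mono) (auto simp: vball_def)
      also have "\<dots> = \<delta>\<^sup>2" using l by (simp add: power_mult_distrib)
      finally have "v \<in> vball D (\<lambda>_. 0) \<delta>" by (simp add: vball_def v_def)
      then have "v \<in> K" using \<delta> by blast
      then have "(\<lambda>i\<in>{..<D}. l * x i + (1 - l) * v i) \<in> K" using x l by (intro conv) auto
      also have "(\<lambda>i\<in>{..<D}. l * x i + (1 - l) * v i) = u"
        using u l by (auto simp: fun_eq_iff v_def vball_def PiE_def extensional_def)
      finally show "u \<in> K" .
    qed
    \<comment> \<open>A ball of radius \<open>\<rho>\<close> that contains the contracted point
      stays within distance \<open>2 * \<rho>\<close> of it; hence the half.\<close>
    obtain \<rho> where \<rho>: "\<rho> \<in> \<rat>" "0 < \<rho>" "\<rho> < (1 - l) * \<delta> / 2"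
      using Rats_dense_in_real[of 0 "(1 - l) * \<delta> / 2"] l \<delta> by auto
    obtain q where q: "q \<in> {..<D} \<rightarrow>\<^sub>E \<rat>" "(\<Sum>i<D. (?lx i - q i)\<^sup>2) \<le> \<rho>\<^sup>2"
      using rational_point_in_vball[OF \<rho>(2)] by blast
    have "vball D q \<rho> \<subseteq> vball D ?lx ((1 - l) * \<delta>)"
    proof
      fix u assume u: "u \<in> vball D q \<rho>"
      have "(u i - ?lx i)\<^sup>2 \<le> 2 * (u i - q i)\<^sup>2 + 2 * (?lx i - q i)\<^sup>2" for i
      proof -
        have "0 \<le> ((u i - q i) + (?lx i - q i))\<^sup>2" by simp
        then show ?thesis by (simp add: power2_eq_square algebra_simps)
      qed
      then have "(\<Sum>i<D. (u i - ?lx i)\<^sup>2) \<le> (\<Sum>i<D. 2 * (u i - q i)\<^sup>2 + 2 * (?lx i - q i)\<^sup>2)"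
        by (intro sum_mono)
      also have "\<dots> = 2 * (\<Sum>i<D. (u i - q i)\<^sup>2) + 2 * (\<Sum>i<D. (?lx i - q i)\<^sup>2)"
        by (simp add: sum.distrib sum_distrib_left)
      also have "\<dots> \<le> (2 * \<rho>)\<^sup>2" using u q by (simp add: vball_def power_mult_distrib)
      also have "\<dots> \<le> ((1 - l) * \<delta>)\<^sup>2" using \<rho> by (intro power_mono) auto
      finally show "u \<in> vball D ?lx ((1 - l) * \<delta>)" using u by (simp add: vball_def)
    qed
    then have "(q, \<rho>) \<in> I" using sub q \<rho> by (auto simp: I_def)
    moreover have "?lx \<in> vball D q \<rho>" using q(2) by (simp add: vball_def vec_affine_def)
    ultimately show ?thesis by (auto simp: U_def)
  qed
  \<comment> \<open>Factors strictly between 0 and 1 that tend to 1; the shift by 2 keeps the first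
    one positive.\<close>
  define l where "l j = 1 - 1 / (real j + 2)" for j
  have l: "0 < l j" "l j < 1" for j by (auto simp: l_def field_simps)
  \<comment> \<open>A measurable set around \<open>K\<close>: the points of \<open>B\<close> that
    every contraction sends into \<open>U\<close>. By scaling its volume is at most
    \<open>1 / l j ^ D\<close> times that of \<open>U\<close>, and \<open>B\<close> keeps it
    finite.\<close>
  define V where "V = (\<Inter>j. vec_affine D (l j) (\<lambda>_. 0) -` U \<inter> space ?L) \<inter> B"
  have Vj: "vec_affine D (l j) (\<lambda>_. 0) -` U \<inter> space ?L \<in> sets ?L" for j
    by (rule measurable_sets[OF vec_affine_measurable' Us])
  then have Vs: "V \<in> sets ?L" unfolding V_def by (intro sets.Int sets.countable_INT' B) auto
  have KV: "K \<subseteq> V" using inU[OF _ l] K B(1) by (auto simp: V_def space_PiM)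
  have fin: "emeasure ?L V < \<infinity>" "emeasure ?L U < \<infinity>"
  proof -
    have "V \<subseteq> B" "U \<subseteq> B" using UK B(1) by (auto simp: V_def)
    then show "emeasure ?L V < \<infinity>" "emeasure ?L U < \<infinity>"
      using emeasure_mono[OF _ B(2)] B(3) by (meson le_less_trans)+
  qed
  have le: "ennreal (l j ^ D) * emeasure ?L V \<le> emeasure ?L U" for j
  proof -
    have "ennreal (l j ^ D) * emeasure ?L V \<le>
        ennreal (l j ^ D) * emeasure ?L (vec_affine D (l j) (\<lambda>_. 0) -` U \<inter> space ?L)"
      by (intro mult_left_mono emeasure_mono Vj) (auto simp: V_def)
    also have "\<dots> = emeasure ?L U" using emeasure_lebesgue_n_scale[OF l(1) Us] by simp
    finally show ?thesis .
  qed
  have le': "l j ^ D * measure ?L V \<le> measure ?L U" for j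
  proof -
    have "ennreal (l j ^ D * measure ?L V) \<le> ennreal (measure ?L U)"
      using le[of j] fin l(1)[of j] by (simp add: ennreal_mult emeasure_eq_ennreal_measure less_top)
    then show ?thesis by (simp add: ennreal_le_iff)
  qed
  have "(\<lambda>j. 1 / (real j + 2)) \<longlonglongrightarrow> 0" 
    using LIMSEQ_ignore_initial_segment[OF lim_1_over_n, of 2] by (simp add: add.commute)
  then have "(\<lambda>j. (1 - 1 / (real j + 2)) ^ D * measure ?L V) \<longlonglongrightarrow> (1 - 0) ^ D * measure ?L V"
    by (intro tendsto_intros)
  then have "(\<lambda>j. l j ^ D * measure ?L V) \<longlonglongrightarrow> measure ?L V"
    by (simp add: l_def)
  then have "measure ?L V \<le> measure ?L U"
    by (rule LIMSEQ_le_const2) (use le' in auto)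
  then have "emeasure ?L V \<le> emeasure ?L U"
    using fin by (simp add: emeasure_eq_ennreal_measure less_top ennreal_leI)
  moreover have "U \<subseteq> V" using UK KV by blast
  ultimately have "emeasure ?L V = emeasure ?L U"
    using emeasure_mono[of U V ?L] Vs by (intro antisym) auto
  then have "emeasure ?L (V - U) = 0"
    using fin Us Vs \<open>U \<subseteq> V\<close> by (subst emeasure_Diff) auto
  then have null: "V - U \<in> null_sets ?L" using Us Vs by (auto intro: null_setsI)
  show ?thesis
    by (rule sets_completionI[OF _ _ null Us, of _ "K - U"]) (use UK KV in auto)
qed

text \<open>The smaller ball is centred at the point of the cutting hyperplane closest to the origin.\<close>

lemma cap_subset_vball:
  assumes t: "0 < t" "t < 1" and \<rho>: "\<rho> > 0" and u: "(\<Sum>i<D. (u i)\<^sup>2) \<le> s\<^sup>2" "s > 0"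
  shows "\<exists>y. {c \<in> vball D (\<lambda>_. 0) \<rho>. (\<Sum>i<D. c i * u i) < - (t * \<rho> * s)} \<subseteq> vball D y (\<rho> * sqrt (1 - t\<^sup>2))"
proof (cases "(\<Sum>i<D. (u i)\<^sup>2) = 0")
  case True
  then have "\<forall>i\<in>{..<D}. u i = 0" by (subst (asm) sum_nonneg_eq_0_iff) auto
  then have "(\<Sum>i<D. c i * u i) = 0" for c by (intro sum.neutral) auto
  then have "{c \<in> vball D (\<lambda>_. 0) \<rho>. (\<Sum>i<D. c i * u i) < - (t * \<rho> * s)} = {}"
    using t \<rho> u by (auto simp: not_less mult_nonneg_nonneg)
  then show ?thesis by (metis empty_subsetI)
next
  case False
  define w where "w = sqrt (\<Sum>i<D. (u i)\<^sup>2)"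
  have w2: "w\<^sup>2 = (\<Sum>i<D. (u i)\<^sup>2)" by (simp add: w_def sum_nonneg)
  have w: "w > 0" using False by (simp add: w_def less_le sum_nonneg)
  have ws: "w \<le> s" by (rule power2_le_imp_le) (use u(1) w2 u(2) in \<open>linarith+\<close>)
  define y where "y i = - (t * \<rho> / w) * u i" for i
  show ?thesis
  proof (intro exI[of _ y] subsetI)
    fix c assume "c \<in> {c \<in> vball D (\<lambda>_. 0) \<rho>. (\<Sum>i<D. c i * u i) < - (t * \<rho> * s)}"
    then have c: "c \<in> {..<D} \<rightarrow>\<^sub>E UNIV" "(\<Sum>i<D. (c i)\<^sup>2) \<le> \<rho>\<^sup>2" "(\<Sum>i<D. c i * u i) < - (t * \<rho> * s)"
      by (auto simp: vball_def)
    have "t * \<rho> * w \<le> t * \<rho> * s" using t \<rho> ws by (intro mult_left_mono) auto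
    then have cu: "(\<Sum>i<D. c i * u i) \<le> - (t * \<rho> * w)" using c(3) by simp
    \<comment> \<open>Moving the centre gains at least \<open>2 * t^2 * \<rho>^2\<close> through the
      inner product and costs \<open>t^2 * \<rho>^2\<close>.\<close>
    have "(\<Sum>i<D. (c i - y i)\<^sup>2) = (\<Sum>i<D. (c i)\<^sup>2 + 2 * (t * \<rho> / w) * (c i * u i) + (t * \<rho> / w)\<^sup>2 * (u i)\<^sup>2)"
      by (intro sum.cong refl) (simp add: y_def power2_eq_square algebra_simps)
    also have "\<dots> = (\<Sum>i<D. (c i)\<^sup>2) + 2 * (t * \<rho> / w) * (\<Sum>i<D. c i * u i) + (t * \<rho> / w)\<^sup>2 * w\<^sup>2"
      by (simp add: w2 sum.distrib sum_distrib_left)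
    also have "\<dots> \<le> \<rho>\<^sup>2 + 2 * (t * \<rho> / w) * - (t * \<rho> * w) + (t * \<rho> / w)\<^sup>2 * w\<^sup>2"
      using c(2) cu t \<rho> w by (intro add_mono mult_left_mono) auto
    also have "\<dots> = \<rho>\<^sup>2 * (1 - t\<^sup>2)"
      using w by (simp add: power2_eq_square field_simps)
    also have "\<dots> = (\<rho> * sqrt (1 - t\<^sup>2))\<^sup>2"
      using t by (simp add: power_mult_distrib power_le_one)
    finally show "c \<in> vball D y (\<rho> * sqrt (1 - t\<^sup>2))" using c(1) by (simp add: vball_def)
  qed
qed

text \<open>What \<open>K\<close> misses of the ball lies in one cap per violated constraint. Each
  cap fits into a ball of radius \<open>\<rho> * sqrt (1 - t^2)\<close>, so its relative volume is
  at most \<open>exp (- t^2 * D / 2)\<close>, and by \<open>small\<close> all caps together take at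
  most half.\<close>

lemma measure_ge_half_ball:
  assumes K: "K \<in> sets (completion (lebesgue_n D))" "K \<subseteq> B"
      "B \<in> sets (lebesgue_n D)" "emeasure (lebesgue_n D) B < \<infinity>"
    and F: "finite F" "\<And>u. u \<in> F \<Longrightarrow> (\<Sum>i<D. (u i)\<^sup>2) \<le> s\<^sup>2" and s: "s > 0"
    and t: "t > 0" and \<rho>: "\<rho> > 0"
    and small: "real (card F) * exp (- (t\<^sup>2 * real D / 2)) \<le> 1/2"
    and sub: "\<And>c. c \<in> vball D (\<lambda>_. 0) \<rho> \<Longrightarrow> (\<And>u. u \<in> F \<Longrightarrow> - (t * \<rho> * s) \<le> (\<Sum>i<D. c i * u i)) \<Longrightarrow> c \<in> K"
  shows "unit_ball_vol (real D) * \<rho> ^ D / 2 \<le> measure (completion (lebesgue_n D)) K"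
proof -
  let ?L = "lebesgue_n D" and ?C = "completion (lebesgue_n D)"
  let ?v = "unit_ball_vol (real D)"
  have v: "?v > 0" by simp
  have Kfin: "K \<in> fmeasurable ?C"
    using K emeasure_mono[of K B ?C] by (auto intro!: fmeasurableI simp: emeasure_completion)
  have bfin: "vball D y r \<in> fmeasurable ?C" if "r > 0" for y r
    using that by (auto intro!: fmeasurableI simp: emeasure_vball)
  have mb: "measure ?C (vball D y r) = ?v * r ^ D" if "r > 0" for y r
    using that by (simp add: measure_vball)
  show ?thesis
  proof (cases "t < 1")
    \<comment> \<open>For \<open>t \<ge> 1\<close> no cap exists: by Cauchy-Schwarz every constraint
      holds on the whole ball.\<close>
    case False
    have "vball D (\<lambda>_. 0) \<rho> \<subseteq> K"
    proof
      fix c assume c: "c \<in> vball D (\<lambda>_. 0) \<rho>"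
      show "c \<in> K"
      proof (rule sub[OF c])
        fix u assume u: "u \<in> F"
        have "(\<Sum>i<D. c i * u i)\<^sup>2 \<le> (\<Sum>i<D. (c i)\<^sup>2) * (\<Sum>i<D. (u i)\<^sup>2)" by (rule Cauchy_Schwarz_ineq_sum)
        also have "\<dots> \<le> \<rho>\<^sup>2 * s\<^sup>2" using c F(2)[OF u] by (intro mult_mono) (auto simp: vball_def sum_nonneg)
        finally have "\<bar>\<Sum>i<D. c i * u i\<bar> \<le> \<rho> * s"
          using \<rho> s by (intro power2_le_imp_le[of "\<bar>_\<bar>"]) (simp_all add: power_mult_distrib)
        moreover have "1 * (\<rho> * s) \<le> t * (\<rho> * s)" using False \<rho> s by (intro mult_right_mono) auto
        ultimately show "- (t * \<rho> * s) \<le> (\<Sum>i<D. c i * u i)" by (simp add: mult.assoc)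
      qed
    qed
    then have "measure ?C (vball D (\<lambda>_. 0) \<rho>) \<le> measure ?C K"
      using Kfin bfin[OF \<rho>] by (intro measure_mono_fmeasurable) auto
    then have "?v * \<rho> ^ D \<le> measure ?C K" by (simp only: mb[OF \<rho>])
    moreover have "0 \<le> ?v * \<rho> ^ D" using \<rho> by simp
    ultimately show ?thesis by linarith
  next
    case t1: True
    define r where "r = \<rho> * sqrt (1 - t\<^sup>2)"
    have t2: "t\<^sup>2 < 1" using t t1 by (simp add: power_less_one_iff abs_square_less_1)
    then have r: "r > 0" using \<rho> by (simp add: r_def)
    have "\<forall>u\<in>F. \<exists>y. {c \<in> vball D (\<lambda>_. 0) \<rho>. (\<Sum>i<D. c i * u i) < - (t * \<rho> * s)} \<subseteq> vball D y r"
      unfolding r_def by (intro ballI cap_subset_vball[OF t t1 \<rho> F(2) s])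
    from bchoice[OF this] obtain y where y: "\<And>u. u \<in> F \<Longrightarrow>
        {c \<in> vball D (\<lambda>_. 0) \<rho>. (\<Sum>i<D. c i * u i) < - (t * \<rho> * s)} \<subseteq> vball D (y u) r"
      by auto
    have cover: "vball D (\<lambda>_. 0) \<rho> \<subseteq> K \<union> (\<Union>u\<in>F. vball D (y u) r)"
    proof
      fix c assume c: "c \<in> vball D (\<lambda>_. 0) \<rho>"
      show "c \<in> K \<union> (\<Union>u\<in>F. vball D (y u) r)"
      proof (cases "\<forall>u\<in>F. - (t * \<rho> * s) \<le> (\<Sum>i<D. c i * u i)")
        case True
        then show ?thesis using sub[OF c] by auto
      next
        case False
        then obtain u where "u \<in> F" "(\<Sum>i<D. c i * u i) < - (t * \<rho> * s)" by (auto simp: not_le)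
        then show ?thesis using y[of u] c by blast
      qed
    qed
    have Ufin: "(\<Union>u\<in>F. vball D (y u) r) \<in> fmeasurable ?C"
      using F(1) bfin[OF r] by (intro fmeasurable.finite_UN) auto
    have "?v * \<rho> ^ D = measure ?C (vball D (\<lambda>_. 0) \<rho>)" by (simp add: mb[OF \<rho>])
    also have "\<dots> \<le> measure ?C (K \<union> (\<Union>u\<in>F. vball D (y u) r))"
      using bfin[OF \<rho>] cover Kfin Ufin by (intro measure_mono_fmeasurable fmeasurable.Un) auto
    also have "\<dots> \<le> measure ?C K + measure ?C (\<Union>u\<in>F. vball D (y u) r)"
      using Kfin Ufin by (intro measure_Un_le) auto
    also have "measure ?C (\<Union>u\<in>F. vball D (y u) r) \<le> (\<Sum>u\<in>F. measure ?C (vball D (y u) r))"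
      using F(1) bfin[OF r] by (intro measure_UNION_le) auto
    also have "\<dots> = real (card F) * (?v * r ^ D)" by (simp add: mb[OF r])
    also have "\<dots> \<le> ?v * \<rho> ^ D / 2"
    proof -
      have "sqrt (1 - t\<^sup>2) \<le> exp (- (t\<^sup>2 / 2))"
      proof (rule real_le_lsqrt)
        have "1 - t\<^sup>2 \<le> exp (- t\<^sup>2)" using exp_ge_add_one_self[of "- t\<^sup>2"] by simp
        also have "\<dots> = (exp (- (t\<^sup>2 / 2)))\<^sup>2" by (simp flip: exp_of_nat_mult)
        finally show "1 - t\<^sup>2 \<le> (exp (- (t\<^sup>2 / 2)))\<^sup>2" .
      qed auto
      then have "sqrt (1 - t\<^sup>2) ^ D \<le> exp (- (t\<^sup>2 / 2)) ^ D" using t2 by (intro power_mono) auto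
      also have "\<dots> = exp (- (t\<^sup>2 * real D / 2))" by (simp flip: exp_of_nat_mult)
      finally have "real (card F) * sqrt (1 - t\<^sup>2) ^ D \<le> 1/2"
        using small mult_left_mono[of "sqrt (1 - t\<^sup>2) ^ D" "exp (- (t\<^sup>2 * real D / 2))" "real (card F)"] by linarith
      then have "(?v * \<rho> ^ D) * (real (card F) * sqrt (1 - t\<^sup>2) ^ D) \<le> (?v * \<rho> ^ D) * (1/2)"
        using v \<rho> by (intro mult_left_mono) auto
      then show ?thesis by (simp add: r_def power_mult_distrib mult_ac)
    qed
    finally show ?thesis by simp
  qed
qed

section \<open>Volume of the section\<close>

definition radial_form :: "nat \<Rightarrow> nat \<Rightarrow> rpoly" where
  "radial_form n k = (\<Sum>i<n. (var i)\<^sup>2) ^ k"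

lemma radial_form_in_forms: "radial_form n k \<in> forms n (2 * k)"
proof -
  have "(\<Sum>i<n. (var i)\<^sup>2) \<in> forms n (1 * 2)"
    by (intro subspace_sum subspace_forms power_in_forms var_in_forms) simp
  from power_in_forms[OF this, of k] show ?thesis by (simp add: radial_form_def)
qed

lemma eval_radial_form: "eval_poly (radial_form n k) x = (\<Sum>i<n. (x i)\<^sup>2) ^ k"
  by (simp add: radial_form_def eval_poly_power eval_poly_sum eval_poly_var)

lemma eval_radial_form_sphere:
  assumes "x \<in> unit_sphere n"
  shows "eval_poly (radial_form n k) x = 1"
  using assms by (simp add: eval_radial_form unit_sphere_def euclid_norm_def)

text \<open>On the sphere the radial form is the constant 1, so translating by it does not affect
  coordinates in the space of zero mean forms.\<close>

lemma form_inner_radial_form: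
  assumes "n \<ge> 1" "f \<in> zero_mean_forms n k"
  shows "form_inner n (radial_form n k) f = 0"
proof -
  have "form_inner n (radial_form n k) f = sphere_mean n (eval_poly f)"
    unfolding form_inner_sphere_mean sphere_mean_def
    by (intro Bochner_Integration.integral_cong refl) (simp add: space_sphere_measure eval_radial_form_sphere)
  then show ?thesis using assms(2) by (simp add: zero_mean_forms_def sphere_mean_def)
qed

lemma bessel_forms:
  assumes n: "n \<ge> 1" and b: "orthonormal_forms n r b" "\<And>i. i < r \<Longrightarrow> b i \<in> forms n m"
    and h: "h \<in> forms n m"
  shows "(\<Sum>i<r. (form_inner n h (b i))\<^sup>2) \<le> form_inner n h h"
proof -
  let ?c = "\<lambda>i. form_inner n h (b i)"
  define p where "p = (\<Sum>i<r. ?c i *\<^sub>R b i)"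
  have p: "p \<in> forms n m" unfolding p_def by (intro subspace_sum subspace_scale subspace_forms b) simp
  have pp: "form_inner n p p = (\<Sum>i<r. (?c i)\<^sup>2)"
    unfolding p_def by (rule form_inner_orthonormal_self[OF n b])
  have hp: "form_inner n p h = (\<Sum>i<r. (?c i)\<^sup>2)"
    unfolding p_def
    by (subst form_inner_sum_left[OF n _ h])
      (auto intro: subspace_scale subspace_forms b simp: form_inner_scaleR_left form_inner_commute[of n "b _"] power2_eq_square)
  define d where "d = h - p"
  have d: "d \<in> forms n m" unfolding d_def by (intro subspace_diff subspace_forms h p)
  have hd: "h = d + p" by (simp add: d_def)
  have 1: "form_inner n h h = form_inner n d h + form_inner n p h"
    using form_inner_add_left[OF n d p h] hd by simp
  have 2: "form_inner n h d = form_inner n d d + form_inner n p d"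
    using form_inner_add_left[OF n d p d] hd by simp
  have 3: "form_inner n h p = form_inner n d p + form_inner n p p"
    using form_inner_add_left[OF n d p p] hd by simp
  have "form_inner n d p = 0" using 3 pp hp by (simp add: form_inner_commute[of n h p])
  then have "form_inner n h h = form_inner n d d + form_inner n p p"
    using 1 2 hp pp by (simp add: form_inner_commute[of n d h] form_inner_commute[of n p d])
  then show ?thesis using pp form_inner_self_nonneg[of n d] by simp
qed

lemma form_product_norm_le:
  assumes n: "n \<ge> 1" and f: "f \<in> forms n k" and g: "g \<in> forms n k"
  shows "form_inner n (f * g) (f * g) \<le> 40 ^ k * ((form_inner n f f)\<^sup>2 + (form_inner n g g)\<^sup>2) / 2"
  using tform_product_mean_le[OF n sym_coeff_tensor sym_coeff_tensor, of k n k f n k g]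
  by (simp add: form_inner_sphere_mean eval_poly_mult eval_poly_form[OF f] eval_poly_form[OF g]
      tmean_def power2_eq_square)

text \<open>Integrate the representation: the radial form has mean 1 and \<open>f\<close> mean 0.
  The squared norms of the summands thus serve as convex weights.\<close>

lemma form_inner_square_sum_mean:
  assumes n: "n \<ge> 1" and f: "f \<in> zero_mean_forms n k"
    and g: "\<And>j. j < N \<Longrightarrow> g j \<in> forms n k" and e: "f + radial_form n k = (\<Sum>j<N. (g j)\<^sup>2)"
  shows "(\<Sum>j<N. form_inner n (g j) (g j)) = 1"
proof -
  have "(\<Sum>j<N. form_inner n (g j) (g j)) = sphere_mean n (\<lambda>x. \<Sum>j<N. eval_poly (g j) x * eval_poly (g j) x)"
    unfolding form_inner_sphere_mean
    by (rule sphere_mean_sum[symmetric]) (use g in \<open>auto intro: integrable_eval_mult[OF n]\<close>)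
  also have "(\<lambda>x. \<Sum>j<N. eval_poly (g j) x * eval_poly (g j) x) = (\<lambda>x. eval_poly f x + eval_poly (radial_form n k) x)"
    unfolding eval_poly_add[symmetric] e by (simp add: eval_poly_sum eval_poly_mult power2_eq_square)
  also have "sphere_mean n \<dots> = sphere_mean n (eval_poly f) + sphere_mean n (eval_poly (radial_form n k))"
    using f zero_mean_forms_subset
    by (intro sphere_mean_add integrable_eval[OF n radial_form_in_forms] integrable_eval[OF n]) auto
  also have "sphere_mean n (eval_poly (radial_form n k)) = sphere_mean n (\<lambda>x. 1)"
    unfolding sphere_mean_def
    by (intro Bochner_Integration.integral_cong refl) (simp add: space_sphere_measure eval_radial_form_sphere)
  also have "sphere_mean n (\<lambda>x. 1) = 1" by (rule sphere_mean_const[OF n])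
  also have "sphere_mean n (eval_poly f) = 0" using f by (simp add: zero_mean_forms_def sphere_mean_def)
  finally show ?thesis by simp
qed

section \<open>Coordinates and the covering of the section\<close>

locale zero_mean_basis =
  fixes n k :: nat and b :: "nat \<Rightarrow> rpoly"
  assumes n: "n \<ge> 2" and k: "k \<ge> 1" and basis: "orthonormal_basis n k b"
begin

definition D where "D = dim (zero_mean_forms n k)"

definition coords :: "rpoly set \<Rightarrow> (nat \<Rightarrow> real) set" where
  "coords A = {c \<in> {..<D} \<rightarrow>\<^sub>E UNIV. (\<Sum>i<D. c i *\<^sub>R b i) \<in> A}"

abbreviation form_of :: "(nat \<Rightarrow> real) \<Rightarrow> rpoly" where
  "form_of c \<equiv> (\<Sum>i<D. c i *\<^sub>R b i)"

lemma n1: "n \<ge> 1"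
  using n by simp

lemma span_b: "span (b ` {..<D}) = zero_mean_forms n k"
  using basis by (simp add: orthonormal_basis_def D_def)

lemma orth_b: "orthonormal_forms n D b"
  using basis by (simp add: orthonormal_basis_def orthonormal_forms_def D_def)

lemma b_zero_mean: "i < D \<Longrightarrow> b i \<in> zero_mean_forms n k"
  unfolding span_b[symmetric] by (intro span_base) simp

lemma b_forms: "i < D \<Longrightarrow> b i \<in> forms n (2 * k)"
  using b_zero_mean zero_mean_forms_subset by blast

lemma form_of_zero_mean: "form_of c \<in> zero_mean_forms n k"
  by (intro subspace_sum subspace_scale subspace_zero_mean_forms n1 b_zero_mean) simp

lemma form_of_forms: "form_of c \<in> forms n (2 * k)"
  using form_of_zero_mean zero_mean_forms_subset by blast

lemma form_inner_form_of: "form_inner n (form_of c) (form_of c) = (\<Sum>i<D. (c i)\<^sup>2)"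
  by (rule form_inner_orthonormal_self[OF n1 orth_b b_forms])

lemma form_inner_form_of_basis: "i < D \<Longrightarrow> form_inner n (form_of c) (b i) = c i"
  by (rule form_inner_orthonormal_sum[OF n1 orth_b b_forms])

lemma D_ge: "(real n / real (2 * k)) ^ (2 * k) \<le> real D"
  unfolding D_def by (rule dim_zero_mean_forms_ge[OF n k])

lemma D_pos: "D > 0"
proof -
  have "0 < (real n / real (2 * k)) ^ (2 * k)" using n k by (intro zero_less_power) auto
  then show ?thesis using D_ge by linarith
qed

lemma coords_zero_mean_ball: "coords (zero_mean_ball n k) = vball D (\<lambda>_. 0) 1"
  using form_of_zero_mean by (auto simp: coords_def zero_mean_ball_def form_inner_form_of vball_def)

text \<open>The number \<open>M\<close> of squares is not bounded, but their squared norms sum to 1,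
  so all of them merge into one convex combination over pairs of net points. The centres in
  \<open>Y\<close> are averages of \<open>m\<close> elements, each with at most
  \<open>48 ^ (2 * d)\<close> choices.\<close>

lemma coords_Sq_tilde_cover:
  fixes m :: nat
  assumes m: "m \<ge> 1"
  defines "r \<equiv> sqrt (16 * 40 ^ k / real m)"
  obtains Y where "finite Y" "real (card Y) \<le> 48 ^ (2 * n ^ k * m)"
    "coords (Sq_tilde n k) \<subseteq> (\<Union>y\<in>Y. vball D y r)"
proof -
  define d where "d = dim (forms n k)"
  obtain e where e: "span (e ` {..<d}) = forms n k" "orthonormal_forms n d e"
    unfolding d_def using orthonormal_basis_exists(1)[OF n1 subspace_forms order_refl] by blast
  have d: "d \<le> n ^ k" unfolding d_def using orthonormal_basis_exists(2)[OF n1 subspace_forms order_refl] .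
  have ef: "e l \<in> forms n k" if "l < d" for l
    unfolding e(1)[symmetric] using that by (intro span_base) simp
  define N where "N = lattice_net {..<d}"
  have finN: "finite N" and cardN: "real (card N) \<le> 48 ^ d"
    using card_lattice_net[of "{..<d}"] by (simp_all add: N_def)
  \<comment> \<open>For each coordinate \<open>i\<close>, the matrix of the bilinear map sending two
    forms of degree \<open>k\<close> to the \<open>i\<close>-th coordinate of their product.\<close>
  define T where "T i l l' = form_inner n (e l * e l') (b i)" for i l l'
  define q where "q z = (\<Sum>l<d. real_of_int (z l) *\<^sub>R e l)" for z :: "nat \<Rightarrow> int"
  have qf: "q z \<in> forms n k" for z
    unfolding q_def by (intro subspace_sum subspace_scale subspace_forms ef) simp
  have qT: "form_inner n ((\<Sum>l<d. u l *\<^sub>R e l) * (\<Sum>l<d. v l *\<^sub>R e l)) (b i) = (\<Sum>l<d. \<Sum>l'<d. T i l l' * u l * v l')"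
    if "i < D" for i and u v :: "nat \<Rightarrow> real"
  proof -
    have ee: "e l * e l' \<in> forms n (2 * k)" if "l < d" "l' < d" for l l'
      using mult_in_forms[OF ef[OF that(1)] ef[OF that(2)]] by (simp add: mult_2)
    have "eval_poly ((\<Sum>l<d. u l *\<^sub>R e l) * (\<Sum>l<d. v l *\<^sub>R e l)) x * eval_poly (b i) x =
        (\<Sum>l<d. \<Sum>l'<d. (u l * v l') * (eval_poly (e l * e l') x * eval_poly (b i) x))" for x
      unfolding eval_poly_mult eval_poly_sum eval_poly_scaleR unfolding sum_product unfolding sum_distrib_right
      by (simp only: mult_ac)
    then have "form_inner n ((\<Sum>l<d. u l *\<^sub>R e l) * (\<Sum>l<d. v l *\<^sub>R e l)) (b i) =
      sphere_mean n (\<lambda>x. \<Sum>l<d. \<Sum>l'<d. (u l * v l') * (eval_poly (e l * e l') x * eval_poly (b i) x))"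
      by (simp add: form_inner_sphere_mean)
    also have "\<dots> = (\<Sum>l<d. \<Sum>l'<d. sphere_mean n (\<lambda>x. (u l * v l') * (eval_poly (e l * e l') x * eval_poly (b i) x)))"
      by (rule sphere_mean_sum2, rule Bochner_Integration.integrable_mult_right,
        rule integrable_eval_mult[OF n1 ee b_forms[OF that]]) auto
    also have "\<dots> = (\<Sum>l<d. \<Sum>l'<d. T i l l' * u l * v l')"
      by (simp add: sphere_mean_cmult T_def form_inner_sphere_mean mult_ac)
    finally show ?thesis .
  qed
  define P where "P = N \<times> N"
  define V where "V a i = form_inner n (q (fst a) * q (snd a)) (b i) / real d" for a and i :: nat
  have finP: "finite P" using finN by (simp add: P_def)
  have qnorm: "form_inner n (q z) (q z) \<le> 4 * real d" if "z \<in> N" for z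
  proof -
    have "form_inner n (q z) (q z) = (\<Sum>l<d. (real_of_int (z l))\<^sup>2)"
      unfolding q_def by (rule form_inner_orthonormal_self[OF n1 e(2) ef])
    also have "\<dots> = real_of_int (\<Sum>l<d. (z l)\<^sup>2)" by simp
    also have "\<dots> \<le> real_of_int (4 * int d)" using that by (simp only: of_int_le_iff) (simp add: N_def lattice_net_def)
    finally show ?thesis by simp
  qed
  \<comment> \<open>Net points have squared norm at most \<open>4 * d\<close>, so by
    hypercontractivity a product has squared norm at most \<open>40 ^ k * (4 * d)^2\<close>. Bessel
    passes to the coordinates, and the division by \<open>d\<close> in \<open>V\<close> leaves
    \<open>16 * 40 ^ k\<close>. For \<open>d = 0\<close> the division makes \<open>V\<close>
    vanish.\<close>
  have Vbound: "(\<Sum>i<D. (V a i)\<^sup>2) \<le> 16 * 40 ^ k" if "a \<in> P" for a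
  proof (cases "d = 0")
    case False
    have z: "fst a \<in> N" "snd a \<in> N" using that by (auto simp: P_def)
    have qq: "q (fst a) * q (snd a) \<in> forms n (2 * k)"
      using mult_in_forms[OF qf qf] by (simp add: mult_2)
    have "(\<Sum>i<D. (V a i)\<^sup>2) = (\<Sum>i<D. (form_inner n (q (fst a) * q (snd a)) (b i))\<^sup>2) / (real d)\<^sup>2"
      by (simp add: V_def power_divide sum_divide_distrib)
    also have "\<dots> \<le> form_inner n (q (fst a) * q (snd a)) (q (fst a) * q (snd a)) / (real d)\<^sup>2"
      by (intro divide_right_mono bessel_forms[OF n1 orth_b b_forms qq]) auto
    also have "\<dots> \<le> (40 ^ k * ((form_inner n (q (fst a)) (q (fst a)))\<^sup>2 + (form_inner n (q (snd a)) (q (snd a)))\<^sup>2) / 2) / (real d)\<^sup>2"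
      by (intro divide_right_mono form_product_norm_le[OF n1 qf qf]) auto
    also have "\<dots> \<le> (40 ^ k * ((4 * real d)\<^sup>2 + (4 * real d)\<^sup>2) / 2) / (real d)\<^sup>2"
      using qnorm z by (intro divide_right_mono mult_left_mono add_mono power_mono form_inner_self_nonneg) auto
    also have "\<dots> = 16 * 40 ^ k" using False by (simp add: power2_eq_square)
    finally show ?thesis .
  qed (simp add: V_def)
  define yy where "yy s i = (\<Sum>j<m. V (s j) i) / real m" for s :: "nat \<Rightarrow> (nat \<Rightarrow> int) \<times> (nat \<Rightarrow> int)" and i :: nat
  define Y where "Y = yy ` Pi\<^sub>E {..<m} (\<lambda>_. P)"
  show ?thesis
  proof (rule that)
    show "finite Y" unfolding Y_def using finP by (intro finite_imageI finite_PiE) auto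
    have "card Y \<le> card (Pi\<^sub>E {..<m} (\<lambda>_. P))"
      unfolding Y_def using finP by (intro card_image_le finite_PiE) auto
    also have "\<dots> = card P ^ m" by (simp add: card_PiE)
    finally have "real (card Y) \<le> real (card P) ^ m" by (simp flip: of_nat_power)
    also have "\<dots> \<le> (48 ^ (2 * n ^ k)) ^ m"
    proof (rule power_mono)
      have "real (card P) = real (card N) * real (card N)" by (simp add: P_def card_cartesian_product)
      also have "\<dots> \<le> 48 ^ d * 48 ^ d" using cardN by (intro mult_mono) auto
      also have "\<dots> = 48 ^ (2 * d)" by (simp add: mult_2 power_add)
      also have "\<dots> \<le> 48 ^ (2 * n ^ k)" using d by (intro power_increasing) auto
      finally show "real (card P) \<le> 48 ^ (2 * n ^ k)" .
    qed simp
    finally show "real (card Y) \<le> 48 ^ (2 * n ^ k * m)" by (simp add: power_mult)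
    show "coords (Sq_tilde n k) \<subseteq> (\<Union>y\<in>Y. vball D y r)"
    proof
      fix c assume c: "c \<in> coords (Sq_tilde n k)"
      define f where "f = form_of c"
      have fM: "f \<in> zero_mean_forms n k" unfolding f_def by (rule form_of_zero_mean)
      have "f + radial_form n k \<in> Sq n k"
        using c by (simp add: coords_def Sq_tilde_def f_def radial_form_def)
      then obtain M :: nat and g where g: "\<And>j. j < M \<Longrightarrow> g j \<in> forms n k"
        "f + radial_form n k = (\<Sum>j<M. (g j)\<^sup>2)" by (auto simp: Sq_def)
      define x where "x j l = form_inner n (g j) (e l)" for j l
      have gx: "g j = (\<Sum>l<d. x j l *\<^sub>R e l)" if "j < M" for j
        unfolding x_def using g(1)[OF that] e(1)
        by (intro orthonormal_forms_expand[OF n1 e(2) ef]) auto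
      have gg: "form_inner n (g j) (g j) = (\<Sum>l<d. (x j l)\<^sup>2)" if "j < M" for j
        by (subst (1 2) gx[OF that]) (rule form_inner_orthonormal_self[OF n1 e(2) ef])
      have sum1: "(\<Sum>j<M. \<Sum>l<d. (x j l)\<^sup>2) = 1"
        using form_inner_square_sum_mean[OF n1 fM g(1) g(2)] gg by simp
      have dpos: "d > 0"
      proof (rule ccontr)
        assume "\<not> ?thesis" then have "d = 0" by simp
        with sum1 show False by simp
      qed
      \<comment> \<open>For each \<open>j\<close> the weights are fixed before the matrix, so that
        the same \<open>w j\<close> can be used with \<open>T i\<close> for every coordinate
        \<open>i\<close>.\<close>
      have "\<forall>j. \<exists>w. (\<forall>z. 0 \<le> w z) \<and> (\<Sum>z\<in>N. w z) = 1 \<and> (\<forall>A.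
          (\<Sum>l<d. (x j l)\<^sup>2) * (\<Sum>z\<in>N. \<Sum>z'\<in>N. w z * w z' *
            (\<Sum>l<d. \<Sum>l'<d. A l l' * real_of_int (z l) * real_of_int (z' l')))
          = real d * (\<Sum>l<d. \<Sum>l'<d. A l l' * x j l * x j l'))"
      proof
        fix j
        show "\<exists>w. (\<forall>z. 0 \<le> w z) \<and> (\<Sum>z\<in>N. w z) = 1 \<and> (\<forall>A.
          (\<Sum>l<d. (x j l)\<^sup>2) * (\<Sum>z\<in>N. \<Sum>z'\<in>N. w z * w z' *
            (\<Sum>l<d. \<Sum>l'<d. A l l' * real_of_int (z l) * real_of_int (z' l')))
          = real d * (\<Sum>l<d. \<Sum>l'<d. A l l' * x j l * x j l'))"
        proof (rule bilinear_lattice_net[of "{..<d}" "x j"])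
          fix w
          assume w: "\<And>z. 0 \<le> w z" "(\<Sum>z\<in>lattice_net {..<d}. w z) = 1"
            "\<And>A. (\<Sum>l<d. (x j l)\<^sup>2) * (\<Sum>z\<in>lattice_net {..<d}. \<Sum>z'\<in>lattice_net {..<d}. w z * w z' *
              (\<Sum>l<d. \<Sum>l'<d. A l l' * real_of_int (z l) * real_of_int (z' l')))
            = real (card {..<d}) * (\<Sum>l<d. \<Sum>l'<d. A l l' * x j l * x j l')"
          from w(3) show ?thesis
            unfolding N_def card_lessThan by (intro exI[of _ w] conjI allI w(1,2))
        qed simp
      qed
      from choice[OF this] obtain w where w: "\<forall>j. (\<forall>z. 0 \<le> w j z) \<and> (\<Sum>z\<in>N. w j z) = 1 \<and> (\<forall>A.
          (\<Sum>l<d. (x j l)\<^sup>2) * (\<Sum>z\<in>N. \<Sum>z'\<in>N. w j z * w j z' *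
            (\<Sum>l<d. \<Sum>l'<d. A l l' * real_of_int (z l) * real_of_int (z' l')))
          = real d * (\<Sum>l<d. \<Sum>l'<d. A l l' * x j l * x j l'))"
        by (rule exE)
      note w1 = conjunct1[OF spec[OF w], rule_format]
        and w2 = conjunct1[OF conjunct2[OF spec[OF w]]]
        and w3 = conjunct2[OF conjunct2[OF spec[OF w]], rule_format]
      define s2 where "s2 j = (\<Sum>l<d. (x j l)\<^sup>2)" for j
      \<comment> \<open>The product weights of the individual squares, mixed in proportion to their
        squared norms.\<close>
      define W where "W a = (\<Sum>j<M. s2 j * (w j (fst a) * w j (snd a)))" for a
      have sumP: "(\<Sum>a\<in>P. h (fst a) (snd a)) = (\<Sum>z\<in>N. \<Sum>z'\<in>N. h z z')" for h :: "(nat \<Rightarrow> int) \<Rightarrow> (nat \<Rightarrow> int) \<Rightarrow> real"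
        unfolding P_def by (simp add: sum.cartesian_product case_prod_beta)
      have W0: "0 \<le> W a" for a
        unfolding W_def s2_def by (intro sum_nonneg mult_nonneg_nonneg w1) auto
      have W1: "(\<Sum>a\<in>P. W a) = 1"
      proof -
        have "(\<Sum>a\<in>P. W a) = (\<Sum>j<M. \<Sum>a\<in>P. s2 j * (w j (fst a) * w j (snd a)))"
          unfolding W_def by (rule sum.swap)
        also have "\<dots> = (\<Sum>j<M. s2 j * ((\<Sum>z\<in>N. w j z) * (\<Sum>z\<in>N. w j z)))"
        proof (intro sum.cong refl)
          fix j
          show "(\<Sum>a\<in>P. s2 j * (w j (fst a) * w j (snd a))) = s2 j * ((\<Sum>z\<in>N. w j z) * (\<Sum>z\<in>N. w j z))"
            using sumP[of "\<lambda>z z'. w j z * w j z'"] by (simp only: sum_product sum_distrib_left[symmetric])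
        qed
        also have "\<dots> = 1" using sum1 by (simp add: w2 s2_def)
        finally show ?thesis .
      qed
      have ci: "c i = (\<Sum>a\<in>P. W a * V a i)" if i: "i < D" for i
      proof -
        have gsq: "(g j)\<^sup>2 \<in> forms n (2 * k)" if "j < M" for j
          using power_in_forms[OF g(1)[OF that], of 2] by (simp add: mult.commute)
        \<comment> \<open>The second summand is 0; adding it turns \<open>f\<close> into the sum of
          squares.\<close>
        have "c i = form_inner n f (b i) + form_inner n (radial_form n k) (b i)"
          using form_inner_form_of_basis[OF i] form_inner_radial_form[OF n1 b_zero_mean[OF i]]
          by (simp add: f_def)
        also have "\<dots> = form_inner n (f + radial_form n k) (b i)"
          unfolding f_def by (rule form_inner_add_left[OF n1 form_of_forms radial_form_in_forms b_forms[OF i], symmetric])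
        also have "\<dots> = (\<Sum>j<M. form_inner n ((g j)\<^sup>2) (b i))"
          unfolding g(2) using gsq by (intro form_inner_sum_left[OF n1 _ b_forms[OF i]]) auto
        also have "\<dots> = (\<Sum>j<M. \<Sum>l<d. \<Sum>l'<d. T i l l' * x j l * x j l')"
        proof (intro sum.cong refl)
          fix j assume "j \<in> {..<M}"
          then show "form_inner n ((g j)\<^sup>2) (b i) = (\<Sum>l<d. \<Sum>l'<d. T i l l' * x j l * x j l')"
            unfolding power2_eq_square using gx[of j] qT[OF i, of "x j" "x j"] by simp
        qed
        also have "\<dots> = (\<Sum>j<M. s2 j * (\<Sum>z\<in>N. \<Sum>z'\<in>N. w j z * w j z' *
            (\<Sum>l<d. \<Sum>l'<d. T i l l' * real_of_int (z l) * real_of_int (z' l'))) / real d)"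
          unfolding s2_def w3 using dpos by simp
        also have "\<dots> = (\<Sum>j<M. s2 j * (\<Sum>z\<in>N. \<Sum>z'\<in>N. w j z * w j z' * V (z, z') i))"
          unfolding V_def q_def fst_conv snd_conv qT[OF i]
          by (simp only: times_divide_eq_right sum_divide_distrib[symmetric])
        also have "\<dots> = (\<Sum>j<M. \<Sum>a\<in>P. s2 j * (w j (fst a) * w j (snd a)) * V a i)"
        proof (intro sum.cong refl)
          fix j
          show "s2 j * (\<Sum>z\<in>N. \<Sum>z'\<in>N. w j z * w j z' * V (z, z') i) = (\<Sum>a\<in>P. s2 j * (w j (fst a) * w j (snd a)) * V a i)"
          proof -
            have "(\<Sum>z\<in>N. \<Sum>z'\<in>N. w j z * w j z' * V (z, z') i) = (\<Sum>a\<in>P. w j (fst a) * w j (snd a) * V a i)"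
              using sumP[of "\<lambda>z z'. w j z * w j z' * V (z, z') i"] by simp
            then show ?thesis by (simp only: sum_distrib_left mult.assoc)
          qed
        qed
        also have "\<dots> = (\<Sum>a\<in>P. W a * V a i)"
          unfolding W_def sum_distrib_right by (rule sum.swap)
        finally show ?thesis .
      qed
      obtain s where s: "\<forall>j<m. s j \<in> P" "(\<Sum>i<D. ((\<Sum>j<m. V (s j) i) - real m * c i)\<^sup>2) \<le> real m * (16 * 40 ^ k)"
        using empirical_approximation[OF finP W0 W1 ci Vbound, where m = m] by blast
      \<comment> \<open>Restriction turns the sample sequence into a member of the finite function
        space that indexes \<open>Y\<close>.\<close>
      define s' where "s' = restrict s {..<m}"
      have s': "s' \<in> Pi\<^sub>E {..<m} (\<lambda>_. P)" using s(1) by (auto simp: s'_def)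
      have "(\<Sum>i<D. (c i - yy s' i)\<^sup>2) = (\<Sum>i<D. ((\<Sum>j<m. V (s j) i) - real m * c i)\<^sup>2) / (real m)\<^sup>2"
        unfolding sum_divide_distrib
      proof (intro sum.cong refl)
        fix i
        have "yy s' i = (\<Sum>j<m. V (s j) i) / real m" by (simp add: yy_def s'_def)
        then have "c i - yy s' i = - (((\<Sum>j<m. V (s j) i) - real m * c i) / real m)"
          using m by (simp add: field_simps)
        then show "(c i - yy s' i)\<^sup>2 = ((\<Sum>j<m. V (s j) i) - real m * c i)\<^sup>2 / (real m)\<^sup>2"
          by (simp add: power_divide)
      qed
      also have "\<dots> \<le> (real m * (16 * 40 ^ k)) / (real m)\<^sup>2"
        using s(2) by (intro divide_right_mono) auto
      also have "\<dots> = r\<^sup>2" using m by (simp add: r_def power2_eq_square)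
      finally have "c \<in> vball D (yy s') r" using c by (simp add: vball_def coords_def)
      then show "c \<in> (\<Union>y\<in>Y. vball D y r)" using s' by (auto simp: Y_def)
    qed
  qed
qed

end

section \<open>Sums of squares and Gram matrices\<close>

lemma sum_idx_add: "(\<Sum>K\<in>idx n (p + q). h K) = (\<Sum>I\<in>idx n p. \<Sum>J\<in>idx n q. h (I @ J))"
  by (induction p arbitrary: h) (simp_all add: sum_idx_Suc)

lemma sum_idx_monomial_sq: "(\<Sum>I\<in>idx n k. (\<Prod>i\<leftarrow>I. x i)\<^sup>2) = (\<Sum>i<n. (x i)\<^sup>2) ^ k" for x :: "nat \<Rightarrow> real"
proof (induction k)
  case (Suc k)
  have "(\<Sum>I\<in>idx n (Suc k). (\<Prod>i\<leftarrow>I. x i)\<^sup>2) = (\<Sum>i<n. (x i)\<^sup>2 * (\<Sum>I\<in>idx n k. (\<Prod>i\<leftarrow>I. x i)\<^sup>2))"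
    by (simp add: sum_idx_Suc power_mult_distrib sum_distrib_left)
  then show ?case by (simp add: Suc sum_distrib_right)
qed simp

text \<open>Membership in the cone can be checked by evaluation, which is how a Gram matrix presents
  a form.\<close>

lemma SqI:
  fixes N :: nat
  assumes n: "n \<ge> 1" and f: "f \<in> forms n (2 * k)" and g: "\<And>j. j < N \<Longrightarrow> g j \<in> forms n k"
    and e: "\<And>x. eval_poly f x = (\<Sum>j<N. (eval_poly (g j) x)\<^sup>2)"
  shows "f \<in> Sq n k"
proof -
  have "(g j)\<^sup>2 \<in> forms n (2 * k)" if "j < N" for j
    using power_in_forms[OF g[OF that], of 2] by (simp add: mult.commute)
  then have "(\<Sum>j<N. (g j)\<^sup>2) \<in> forms n (2 * k)" by (intro subspace_sum subspace_forms) auto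
  then have "f = (\<Sum>j<N. (g j)\<^sup>2)"
    by (intro form_eqI[OF n f]) (simp_all add: e eval_poly_sum eval_poly_power)
  then show ?thesis using f g by (auto simp: Sq_def)
qed

lemma sum_lessThan_add: "(\<Sum>j<N + M. F j) = (\<Sum>j<N. F j) + (\<Sum>j<M. F (N + j))"
  for F :: "nat \<Rightarrow> real" and N M :: nat
  by (induction M) (simp_all add: add.assoc)

lemma Sq_cone:
  assumes n: "n \<ge> 1" and f: "f \<in> Sq n k" and h: "h \<in> Sq n k" and ab: "0 \<le> a" "0 \<le> b"
  shows "a *\<^sub>R f + b *\<^sub>R h \<in> Sq n k"
proof -
  obtain N :: nat and g where g: "f \<in> forms n (2 * k)" "\<And>j. j < N \<Longrightarrow> g j \<in> forms n k" "f = (\<Sum>j<N. (g j)\<^sup>2)"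
    using f by (auto simp: Sq_def)
  obtain M :: nat and p where p: "h \<in> forms n (2 * k)" "\<And>j. j < M \<Longrightarrow> p j \<in> forms n k" "h = (\<Sum>j<M. (p j)\<^sup>2)"
    using h by (auto simp: Sq_def)
  define q where "q j = (if j < N then sqrt a *\<^sub>R g j else sqrt b *\<^sub>R p (j - N))" for j
  show ?thesis
  proof (rule SqI[OF n, of _ k "N + M" q])
    show "a *\<^sub>R f + b *\<^sub>R h \<in> forms n (2 * k)"
      by (intro subspace_add subspace_scale subspace_forms g p)
    show "q j \<in> forms n k" if "j < N + M" for j
      using that g(2)[of j] p(2)[of "j - N"] by (auto simp: q_def intro!: subspace_scale subspace_forms)
    fix x
    show "eval_poly (a *\<^sub>R f + b *\<^sub>R h) x = (\<Sum>j<N + M. (eval_poly (q j) x)\<^sup>2)"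
      using ab unfolding sum_lessThan_add
      by (simp add: q_def g(3) p(3) eval_poly_add eval_poly_scaleR eval_poly_sum eval_poly_power
          power_mult_distrib sum_distrib_left)
  qed
qed

context zero_mean_basis
begin

text \<open>Convexity is the source of measurability, through
  \<open>convex_body_sets_completion\<close>.\<close>

lemma coords_Sq_tilde_convex:
  assumes x: "x \<in> coords (Sq_tilde n k)" and y: "y \<in> coords (Sq_tilde n k)" and t: "0 \<le> t" "t \<le> 1"
  shows "(\<lambda>i\<in>{..<D}. t * x i + (1 - t) * y i) \<in> coords (Sq_tilde n k)"
proof -
  have e: "form_of (\<lambda>i\<in>{..<D}. t * x i + (1 - t) * y i) = t *\<^sub>R form_of x + (1 - t) *\<^sub>R form_of y"
    by (simp add: scaleR_add_left sum.distrib scaleR_sum_right)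
  have "form_of (\<lambda>i\<in>{..<D}. t * x i + (1 - t) * y i) + radial_form n k =
      t *\<^sub>R (form_of x + radial_form n k) + (1 - t) *\<^sub>R (form_of y + radial_form n k)"
    unfolding e by (simp add: algebra_simps)
  also have "\<dots> \<in> Sq n k"
    using x y t by (intro Sq_cone n1) (auto simp: coords_def Sq_tilde_def radial_form_def)
  finally show ?thesis
    using form_of_zero_mean[of "\<lambda>i\<in>{..<D}. t * x i + (1 - t) * y i"]
    by (simp add: coords_def Sq_tilde_def radial_form_def)
qed

definition gram_pairing :: "(nat \<Rightarrow> real) \<Rightarrow> (nat list \<Rightarrow> int) \<Rightarrow> (nat list \<Rightarrow> int) \<Rightarrow> real" where
  "gram_pairing c z z' = (\<Sum>I\<in>idx n k. \<Sum>J\<in>idx n k.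
     coeff_tensor n (2 * k) (form_of c) (I @ J) * real_of_int (z I) * real_of_int (z' J))"

abbreviation net where "net \<equiv> lattice_net (idx n k)"

text \<open>The symmetric coefficient tensor of \<open>f\<close>, read as a matrix indexed by \<open>idx n k\<close>, is a Gram matrix of
  \<open>f\<close>, and the identity is one of \<open>r\<^sup>2\<^sup>k\<close>; so \<open>f + r\<^sup>2\<^sup>k\<close> is a sum of squares as soon as the former is
  bounded below by \<open>- 1\<close>, which can be tested on the net.\<close>

lemma coords_Sq_tildeI:
  assumes c: "c \<in> {..<D} \<rightarrow>\<^sub>E UNIV"
    and net: "\<And>z z'. z \<in> net \<Longrightarrow> z' \<in> net \<Longrightarrow> - real (n ^ k) \<le> gram_pairing c z z'"
  shows "c \<in> coords (Sq_tilde n k)"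
proof -
  let ?f = "form_of c" and ?S = "idx n k"
  define A where "A I J = coeff_tensor n (2 * k) ?f (I @ J)" for I J
  define B where "B I J = A I J + (if I = J then 1 else 0)" for I J
  have Bsum: "(\<Sum>I\<in>?S. \<Sum>J\<in>?S. B I J * x I * x J) = (\<Sum>I\<in>?S. \<Sum>J\<in>?S. A I J * x I * x J) + (\<Sum>I\<in>?S. (x I)\<^sup>2)"
    for x :: "nat list \<Rightarrow> real"
  proof -
    have "(\<Sum>I\<in>?S. \<Sum>J\<in>?S. B I J * x I * x J) =
       (\<Sum>I\<in>?S. \<Sum>J\<in>?S. A I J * x I * x J + (if I = J then x I * x J else 0))"
      by (intro sum.cong refl) (simp add: B_def distrib_right)
    then show ?thesis by (simp add: sum.distrib power2_eq_square)
  qed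
  have "\<exists>(N::nat) v. \<forall>I\<in>?S. \<forall>J\<in>?S. B I J = (\<Sum>l<N. v l I * v l J)"
  proof (rule psd_sum_squares[OF finite_idx])
    fix I J :: "nat list"
    have "mset (I @ J) = mset (J @ I)" by simp
    then have "A I J = A J I" using sym_coeff_tensor unfolding A_def sym_tensor_def by blast
    then show "B I J = B J I" by (simp add: B_def)
  next
    fix x :: "nat list \<Rightarrow> real"
    have "- (\<Sum>I\<in>?S. (x I)\<^sup>2) \<le> (\<Sum>I\<in>?S. \<Sum>J\<in>?S. A I J * x I * x J)"
      using net unfolding gram_pairing_def A_def[symmetric]
      by (intro quadratic_form_ge_lattice_net) (simp_all add: card_idx)
    then show "0 \<le> (\<Sum>I\<in>?S. \<Sum>J\<in>?S. B I J * x I * x J)" unfolding Bsum by simp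
  qed
  then obtain N :: nat and v where v: "\<And>I J. I \<in> ?S \<Longrightarrow> J \<in> ?S \<Longrightarrow> B I J = (\<Sum>l<N. v l I * v l J)"
    by blast
  define g where "g l = (\<Sum>I\<in>?S. v l I *\<^sub>R mono_poly I)" for l
  have "?f + radial_form n k \<in> Sq n k"
  proof (rule SqI[OF n1, of _ k N g])
    show "?f + radial_form n k \<in> forms n (2 * k)"
      by (intro subspace_add subspace_forms form_of_forms radial_form_in_forms)
    show "g l \<in> forms n k" for l
      unfolding g_def by (intro subspace_sum subspace_scale subspace_forms mono_poly_in_forms)
    fix x :: "nat \<Rightarrow> real"
    let ?m = "\<lambda>I. \<Prod>i\<leftarrow>I. x i"
    have "eval_poly ?f x = (\<Sum>K\<in>idx n (k + k). coeff_tensor n (2 * k) ?f K * ?m K)"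
      unfolding eval_poly_form[OF form_of_forms] by (simp add: tform_def mult_2)
    also have "\<dots> = (\<Sum>I\<in>?S. \<Sum>J\<in>?S. A I J * ?m I * ?m J)"
      unfolding sum_idx_add A_def by (simp add: mult.assoc)
    finally have "eval_poly (?f + radial_form n k) x = (\<Sum>I\<in>?S. \<Sum>J\<in>?S. B I J * ?m I * ?m J)"
      unfolding Bsum by (simp add: eval_poly_add eval_radial_form sum_idx_monomial_sq)
    also have "\<dots> = (\<Sum>I\<in>?S. \<Sum>J\<in>?S. \<Sum>l<N. (v l I * ?m I) * (v l J * ?m J))"
      by (intro sum.cong refl) (simp only: v sum_distrib_right, simp only: mult_ac)
    also have "\<dots> = (\<Sum>I\<in>?S. \<Sum>l<N. \<Sum>J\<in>?S. (v l I * ?m I) * (v l J * ?m J))"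
      by (intro sum.cong refl, rule sum.swap)
    also have "\<dots> = (\<Sum>l<N. \<Sum>I\<in>?S. \<Sum>J\<in>?S. (v l I * ?m I) * (v l J * ?m J))"
      by (rule sum.swap)
    also have "\<dots> = (\<Sum>l<N. (eval_poly (g l) x)\<^sup>2)"
      by (simp add: g_def eval_poly_sum eval_poly_scaleR eval_mono_poly power2_eq_square sum_product)
    finally show "eval_poly (?f + radial_form n k) x = (\<Sum>l<N. (eval_poly (g l) x)\<^sup>2)" .
  qed
  then show ?thesis using c form_of_zero_mean[of c] by (simp add: coords_def Sq_tilde_def radial_form_def)
qed

text \<open>The product of the odd numbers up to \<open>4 * k - 1\<close>: what remains free of
  \<open>n\<close> when \<open>n + 2 * j \<le> n * (1 + 2 * j)\<close> is applied in
  \<open>coeff_tensor_norm_le\<close>.\<close>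

definition odd_product :: real where "odd_product = (\<Prod>j<2 * k. 1 + 2 * real j)"

text \<open>Bounds the norm of the functional that pairs the Gram matrix with two net points: these
  have norm at most \<open>2 * sqrt (n ^ k)\<close> each, and the coefficient tensor has norm at
  most \<open>n ^ k * sqrt odd_product\<close> times that of the form.\<close>

definition gram_bound :: real where "gram_bound = 4 * real n ^ (2 * k) * sqrt odd_product"

lemma odd_product_pos: "odd_product > 0"
  unfolding odd_product_def by (intro prod_pos) (simp add: add_pos_nonneg)

lemma gram_bound_pos: "gram_bound > 0"
  unfolding gram_bound_def using odd_product_pos n1 by simp

lemma gram_pairing_sq_le:
  assumes z: "z \<in> net" "z' \<in> net"
  shows "(gram_pairing c z z')\<^sup>2 \<le> gram_bound\<^sup>2 * (\<Sum>i<D. (c i)\<^sup>2)"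
proof -
  let ?a = "coeff_tensor n (2 * k) (form_of c)" and ?S = "idx n k"
  have zn: "(\<Sum>I\<in>?S. (real_of_int (w I))\<^sup>2) \<le> 4 * real n ^ k" if "w \<in> net" for w
  proof -
    have "real_of_int (\<Sum>I\<in>?S. (w I)\<^sup>2) \<le> real_of_int (4 * int (card ?S))"
      using that by (simp only: of_int_le_iff) (simp add: lattice_net_def)
    then show ?thesis by (simp add: card_idx)
  qed
  have tensor: "(\<Sum>K\<in>idx n (2 * k). (?a K)\<^sup>2) \<le> real n ^ (2 * k) * odd_product * (\<Sum>i<D. (c i)\<^sup>2)"
  proof -
    have "(\<Sum>K\<in>idx n (2 * k). (?a K)\<^sup>2) \<le> fact (2 * k) * (\<Sum>K\<in>idx n (2 * k). (?a K)\<^sup>2)"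
      using mult_right_mono[OF fact_ge_1[of "2 * k", where 'a = real], of "\<Sum>K\<in>idx n (2 * k). (?a K)\<^sup>2"]
      by (simp add: sum_nonneg)
    also have "\<dots> \<le> (\<Prod>j<2 * k. real n + 2 * real j) * (\<Sum>i<D. (c i)\<^sup>2)"
      using coeff_tensor_norm_le[OF n1 form_of_forms] by (simp only: form_inner_form_of)
    also have "\<dots> \<le> (\<Prod>j<2 * k. real n * (1 + 2 * real j)) * (\<Sum>i<D. (c i)\<^sup>2)"
    proof (intro mult_right_mono prod_mono conjI sum_nonneg)
      fix j
      have "1 * (2 * real j) \<le> real n * (2 * real j)" using n1 by (intro mult_right_mono) auto
      then show "real n + 2 * real j \<le> real n * (1 + 2 * real j)" by (simp add: distrib_left)
    qed auto
    also have "(\<Prod>j<2 * k. real n * (1 + 2 * real j)) = real n ^ (2 * k) * odd_product"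
      by (simp add: prod.distrib odd_product_def)
    finally show ?thesis .
  qed
  have "gram_pairing c z z' = (\<Sum>(I, J)\<in>?S \<times> ?S. ?a (I @ J) * (real_of_int (z I) * real_of_int (z' J)))"
    unfolding gram_pairing_def by (simp add: sum.cartesian_product mult.assoc)
  then have "(gram_pairing c z z')\<^sup>2 \<le> (\<Sum>p\<in>?S \<times> ?S. (?a (fst p @ snd p))\<^sup>2) *
      (\<Sum>p\<in>?S \<times> ?S. (real_of_int (z (fst p)) * real_of_int (z' (snd p)))\<^sup>2)"
    using Cauchy_Schwarz_ineq_sum[of "\<lambda>p. ?a (fst p @ snd p)" "\<lambda>p. real_of_int (z (fst p)) * real_of_int (z' (snd p))" "?S \<times> ?S"]
    by (simp add: case_prod_beta)
  also have "(\<Sum>p\<in>?S \<times> ?S. (?a (fst p @ snd p))\<^sup>2) = (\<Sum>K\<in>idx n (2 * k). (?a K)\<^sup>2)"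
    by (simp add: mult_2 sum_idx_add sum.cartesian_product case_prod_beta)
  also have "(\<Sum>p\<in>?S \<times> ?S. (real_of_int (z (fst p)) * real_of_int (z' (snd p)))\<^sup>2) =
      (\<Sum>I\<in>?S. (real_of_int (z I))\<^sup>2) * (\<Sum>I\<in>?S. (real_of_int (z' I))\<^sup>2)"
    by (simp add: sum_product sum.cartesian_product case_prod_beta power_mult_distrib)
  also have "(\<Sum>K\<in>idx n (2 * k). (?a K)\<^sup>2) * ((\<Sum>I\<in>?S. (real_of_int (z I))\<^sup>2) * (\<Sum>I\<in>?S. (real_of_int (z' I))\<^sup>2))
    \<le> (real n ^ (2 * k) * odd_product * (\<Sum>i<D. (c i)\<^sup>2)) * ((4 * real n ^ k) * (4 * real n ^ k))"
    using odd_product_pos by (intro mult_mono tensor zn z mult_nonneg_nonneg sum_nonneg) auto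
  also have "\<dots> = gram_bound\<^sup>2 * (\<Sum>i<D. (c i)\<^sup>2)"
    using odd_product_pos by (simp add: gram_bound_def power_mult_distrib mult_2 power_add power2_eq_square)
  finally show ?thesis .
qed

definition gram_vec :: "(nat list \<Rightarrow> int) \<Rightarrow> (nat list \<Rightarrow> int) \<Rightarrow> nat \<Rightarrow> real" where
  "gram_vec z z' i = (\<Sum>I\<in>idx n k. \<Sum>J\<in>idx n k.
     coeff_tensor n (2 * k) (b i) (I @ J) * real_of_int (z I) * real_of_int (z' J))"

lemma gram_pairing_eq: "gram_pairing c z z' = (\<Sum>i<D. c i * gram_vec z z' i)"
proof -
  have "gram_pairing c z z' = (\<Sum>I\<in>idx n k. \<Sum>J\<in>idx n k. \<Sum>i<D.
      c i * (coeff_tensor n (2 * k) (b i) (I @ J) * real_of_int (z I) * real_of_int (z' J)))"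
    unfolding gram_pairing_def
    by (simp add: coeff_tensor_sum coeff_tensor_scaleR sum_distrib_right mult.assoc)
  also have "\<dots> = (\<Sum>I\<in>idx n k. \<Sum>i<D. \<Sum>J\<in>idx n k.
      c i * (coeff_tensor n (2 * k) (b i) (I @ J) * real_of_int (z I) * real_of_int (z' J)))"
    by (intro sum.cong refl, rule sum.swap)
  also have "\<dots> = (\<Sum>i<D. \<Sum>I\<in>idx n k. \<Sum>J\<in>idx n k.
      c i * (coeff_tensor n (2 * k) (b i) (I @ J) * real_of_int (z I) * real_of_int (z' J)))"
    by (rule sum.swap)
  finally show ?thesis by (simp add: gram_vec_def sum_distrib_left)
qed

text \<open>Duality: the functional is evaluated at its own representing vector.\<close>

lemma gram_vec_norm_le:
  assumes "z \<in> net" "z' \<in> net"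
  shows "(\<Sum>i<D. (gram_vec z z' i)\<^sup>2) \<le> gram_bound\<^sup>2"
proof -
  let ?u = "\<Sum>i<D. (gram_vec z z' i)\<^sup>2"
  have "?u\<^sup>2 \<le> gram_bound\<^sup>2 * ?u"
    using gram_pairing_sq_le[OF assms, of "gram_vec z z'"]
    by (simp add: gram_pairing_eq flip: power2_eq_square)
  then have "?u * ?u \<le> gram_bound\<^sup>2 * ?u" by (simp only: power2_eq_square)
  moreover have "0 \<le> ?u" by (intro sum_nonneg) simp
  ultimately show ?thesis
  proof (cases "?u = 0")
    case False
    with \<open>0 \<le> ?u\<close> have "0 < ?u" by linarith
    with \<open>?u * ?u \<le> gram_bound\<^sup>2 * ?u\<close> show ?thesis by (rule mult_right_le_imp_le)
  qed (simp only: zero_le_power2)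
qed

text \<open>The worst case by Cauchy-Schwarz. The radius is only of order \<open>n^(- k)\<close>,
  too small for the volume bound, but an inner ball of any size suffices for measurability.\<close>

lemma vball_subset_coords: "vball D (\<lambda>_. 0) (real n ^ k / gram_bound) \<subseteq> coords (Sq_tilde n k)"
proof
  fix c assume c: "c \<in> vball D (\<lambda>_. 0) (real n ^ k / gram_bound)"
  show "c \<in> coords (Sq_tilde n k)"
  proof (rule coords_Sq_tildeI)
    show "c \<in> {..<D} \<rightarrow>\<^sub>E UNIV" using c by (simp add: vball_def)
    fix z z' assume z: "z \<in> net" "z' \<in> net"
    have "(gram_pairing c z z')\<^sup>2 \<le> gram_bound\<^sup>2 * (\<Sum>i<D. (c i)\<^sup>2)" by (rule gram_pairing_sq_le[OF z])
    also have "\<dots> \<le> gram_bound\<^sup>2 * (real n ^ k / gram_bound)\<^sup>2" using c by (intro mult_left_mono) (auto simp: vball_def)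
    also have "\<dots> = (real n ^ k)\<^sup>2" using gram_bound_pos by (simp add: power_divide)
    finally have "\<bar>gram_pairing c z z'\<bar> \<le> real n ^ k"
      by (intro power2_le_imp_le[of "\<bar>_\<bar>"]) simp_all
    then show "- real (n ^ k) \<le> gram_pairing c z z'" by simp
  qed
qed

lemma emeasure_vball_union_finite:
  assumes "finite Y" "r > 0"
  shows "(\<Union>y\<in>Y. vball D y r) \<in> sets (lebesgue_n D)"
    "emeasure (lebesgue_n D) (\<Union>y\<in>Y. vball D y r) < \<infinity>"
    "measure (lebesgue_n D) (\<Union>y\<in>Y. vball D y r) \<le> real (card Y) * (unit_ball_vol (real D) * r ^ D)"
proof -
  have fm: "vball D y r \<in> fmeasurable (lebesgue_n D)" for y
    using assms by (auto intro!: fmeasurableI simp: emeasure_vball)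
  then have U: "(\<Union>y\<in>Y. vball D y r) \<in> fmeasurable (lebesgue_n D)"
    using assms by (intro fmeasurable.finite_UN) auto
  show "(\<Union>y\<in>Y. vball D y r) \<in> sets (lebesgue_n D)"
    "emeasure (lebesgue_n D) (\<Union>y\<in>Y. vball D y r) < \<infinity>"
    using fmeasurableD[OF U] fmeasurableD2[OF U] by (auto simp: less_top)
  have "measure (lebesgue_n D) (\<Union>y\<in>Y. vball D y r) \<le> (\<Sum>y\<in>Y. measure (lebesgue_n D) (vball D y r))"
    using assms fm by (intro measure_UNION_le) auto
  then show "measure (lebesgue_n D) (\<Union>y\<in>Y. vball D y r) \<le> real (card Y) * (unit_ball_vol (real D) * r ^ D)"
    using assms by (simp add: measure_vball)
qed

section \<open>Volume bounds in terms of the dimension\<close>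

abbreviation vol :: "rpoly set \<Rightarrow> real" where
  "vol A \<equiv> measure (completion (lebesgue_n D)) (coords A)"

lemma vol_zero_mean_ball: "vol (zero_mean_ball n k) = unit_ball_vol (real D)"
  by (simp add: coords_zero_mean_ball measure_vball)

lemma vol_Sq_tilde_le:
  assumes m: "m \<ge> 1"
  shows "vol (Sq_tilde n k) \<le>
    48 ^ (2 * n ^ k * m) * (unit_ball_vol (real D) * sqrt (16 * 40 ^ k / real m) ^ D)"
proof -
  let ?r = "sqrt (16 * 40 ^ k / real m)"
  have r: "?r > 0" using m by simp
  obtain Y where Y: "finite Y" "real (card Y) \<le> 48 ^ (2 * n ^ k * m)"
    "coords (Sq_tilde n k) \<subseteq> (\<Union>y\<in>Y. vball D y ?r)"
    using coords_Sq_tilde_cover[OF m] by blast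
  note U = emeasure_vball_union_finite[OF Y(1) r]
  have "vol (Sq_tilde n k) \<le> measure (completion (lebesgue_n D)) (\<Union>y\<in>Y. vball D y ?r)"
  \<comment> \<open>Outside the measurable sets \<open>measure\<close> is 0 by convention and the
    bound is trivial.\<close>
  proof (cases "coords (Sq_tilde n k) \<in> sets (completion (lebesgue_n D))")
    case True
    then show ?thesis
      using U by (intro measure_mono_fmeasurable Y(3) fmeasurableI) (simp_all add: emeasure_completion)
  qed (simp add: measure_notin_sets)
  also have "\<dots> \<le> real (card Y) * (unit_ball_vol (real D) * ?r ^ D)" using U by simp
  also have "\<dots> \<le> 48 ^ (2 * n ^ k * m) * (unit_ball_vol (real D) * ?r ^ D)"
    using Y(2) r by (intro mult_right_mono) auto
  finally show ?thesis .
qed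

text \<open>There are at most \<open>48 ^ (2 * d) \<le> exp (12 * d)\<close> constraints for
  \<open>d = n ^ k\<close>, and 26 makes \<open>t^2 * D / 2 = 13 * d\<close>, so the caps take at
  most \<open>exp (- d) \<le> 1/2\<close> of the ball. The radius is the one for which the cap
  height \<open>t * \<rho> * gram_bound\<close> equals the threshold \<open>n ^ k\<close> of
  \<open>coords_Sq_tildeI\<close>.\<close>

lemma vol_Sq_tilde_ge:
  defines "t \<equiv> sqrt (26 * real n ^ k / real D)"
  shows "unit_ball_vol (real D) * (real n ^ k / (t * gram_bound)) ^ D / 2 \<le> vol (Sq_tilde n k)"
proof -
  let ?K = "coords (Sq_tilde n k)"
  define d where "d = n ^ k"
  have d: "real d \<ge> 1" using n1 by (simp add: d_def)
  have t: "t > 0" using n1 D_pos by (simp add: t_def)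
  define \<rho> where "\<rho> = real n ^ k / (t * gram_bound)"
  have \<rho>: "\<rho> > 0" using t gram_bound_pos n1 by (simp add: \<rho>_def)
  have r: "sqrt (16 * 40 ^ k / real 1) > 0" by simp
  \<comment> \<open>The cover with \<open>m = 1\<close> serves here only as a measurable set of
    finite volume around the section.\<close>
  have "\<exists>Y. finite Y \<and> ?K \<subseteq> (\<Union>y\<in>Y. vball D y (sqrt (16 * 40 ^ k / real 1)))"
    by (rule coords_Sq_tilde_cover[OF order_refl[of 1]]) (intro exI conjI)
  then obtain Y where Y: "finite Y" "?K \<subseteq> (\<Union>y\<in>Y. vball D y (sqrt (16 * 40 ^ k / real 1)))"
    by (elim exE conjE)
  note B = emeasure_vball_union_finite(1,2)[OF Y(1) r]
  define F where "F = (\<lambda>(z, z'). gram_vec z z') ` (net \<times> net)"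
  have netf: "finite net" "real (card net) \<le> 48 ^ d"
    using card_lattice_net[OF finite_idx, of n k] by (simp_all add: card_idx d_def)
  have Kc: "?K \<in> sets (completion (lebesgue_n D))"
  proof (rule convex_body_sets_completion[OF _ coords_Sq_tilde_convex _ vball_subset_coords Y(2) B])
    show "?K \<subseteq> {..<D} \<rightarrow>\<^sub>E UNIV" by (auto simp: coords_def)
    show "0 < real n ^ k / gram_bound" using gram_bound_pos n1 by simp
  qed
  have small: "real (card F) * exp (- (t\<^sup>2 * real D / 2)) \<le> 1/2"
  proof -
    have "card F \<le> card (net \<times> net)" unfolding F_def using netf by (intro card_image_le) auto
    then have "real (card F) \<le> real (card net) * real (card net)"
      by (simp add: card_cartesian_product flip: of_nat_mult)
    also have "\<dots> \<le> 48 ^ d * 48 ^ d" using netf by (intro mult_mono) auto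
    also have "\<dots> \<le> exp 6 ^ d * exp 6 ^ d"
    proof -
      have "(2::real) \<le> exp 1" using exp_ge_add_one_self[of 1] by simp
      then have "(2::real) ^ 6 \<le> exp 1 ^ 6" by (rule power_mono) simp
      then have "(48::real) \<le> exp 6" by (simp flip: exp_of_nat_mult)
      then show ?thesis by (intro mult_mono power_mono) auto
    qed
    also have "\<dots> = exp (12 * real d)" by (simp flip: exp_of_nat_mult exp_add)
    finally have F: "real (card F) \<le> exp (12 * real d)" .
    have "t\<^sup>2 * real D / 2 = 13 * real d"
      using D_pos by (simp add: t_def d_def)
    then have "real (card F) * exp (- (t\<^sup>2 * real D / 2)) \<le> exp (12 * real d) * exp (- (13 * real d))"
      using F by (simp only:) (rule mult_right_mono, auto)
    also have "exp (12 * real d) * exp (- (13 * real d)) = exp (- real d)"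
      by (simp flip: exp_add)
    also have "\<dots> \<le> exp (- 1)" using d by simp
    also have "\<dots> \<le> 1/2" using exp_ge_add_one_self[of 1] by (simp add: exp_minus field_simps)
    finally show ?thesis .
  qed
  have "unit_ball_vol (real D) * \<rho> ^ D / 2 \<le> measure (completion (lebesgue_n D)) ?K"
  proof (rule measure_ge_half_ball[OF Kc Y(2) B _ _ gram_bound_pos t \<rho> small])
    show "finite F" unfolding F_def using netf by simp
    show "(\<Sum>i<D. (u i)\<^sup>2) \<le> gram_bound\<^sup>2" if "u \<in> F" for u
      using that gram_vec_norm_le by (auto simp: F_def)
    fix c assume c: "c \<in> vball D (\<lambda>_. 0) \<rho>" and u: "\<And>u. u \<in> F \<Longrightarrow> - (t * \<rho> * gram_bound) \<le> (\<Sum>i<D. c i * u i)"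
    show "c \<in> ?K"
    proof (rule coords_Sq_tildeI)
      show "c \<in> {..<D} \<rightarrow>\<^sub>E UNIV" using c by (simp add: vball_def)
      fix z z' assume "z \<in> net" "z' \<in> net"
      then have "gram_vec z z' \<in> F" by (auto simp: F_def)
      from u[OF this] show "- real (n ^ k) \<le> gram_pairing c z z'"
        using t gram_bound_pos by (simp add: gram_pairing_eq \<rho>_def)
    qed
  qed
  then show ?thesis by (simp add: \<rho>_def)
qed

end

section \<open>Uniform constants and the final comparison\<close>

lemma power_powr_inverse:
  fixes y :: real
  assumes "y > 0" "m > 0"
  shows "(y ^ m) powr (1 / real m) = y"
  using assms by (simp add: powr_powr flip: powr_realpow)

lemma form_vol_eq:
  assumes "zero_mean_basis n k (SOME b. orthonormal_basis n k b)"
  shows "form_vol n k A = measure (completion (lebesgue_n (zero_mean_basis.D n k)))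
    (zero_mean_basis.coords n k (SOME b. orthonormal_basis n k b) A)"
  unfolding form_vol_def Let_def zero_mean_basis.coords_def[OF assms] zero_mean_basis.D_def[OF assms] ..

theorem theorem2p2:
  fixes k :: nat
  assumes "k \<ge> 1"
  shows "\<exists>\<alpha>\<^sub>2 \<beta>\<^sub>2 :: real. \<alpha>\<^sub>2 > 0 \<and> \<beta>\<^sub>2 > 0 \<and>
    (\<forall>n::nat. n \<ge> 2 \<longrightarrow>
      \<beta>\<^sub>2 * real n powr (- real k / 2)
        \<le> (form_vol n k (Sq_tilde n k) / form_vol n k (zero_mean_ball n k))
             powr (1 / real (dim (zero_mean_forms n k))) \<and>
      (form_vol n k (Sq_tilde n k) / form_vol n k (zero_mean_ball n k))
             powr (1 / real (dim (zero_mean_forms n k)))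
        \<le> \<alpha>\<^sub>2 * real n powr (- real k / 2))"
proof -
  \<comment> \<open>By \<open>D_ge\<close> this bounds the ratio of \<open>n ^ (2 * k)\<close> to
    the dimension.\<close>
  define q :: real where "q = real (2 * k) ^ (2 * k)"
  define g :: real where "g = (\<Prod>j<2 * k. 1 + 2 * real j)"
  \<comment> \<open>The first factor bounds the \<open>D\<close>-th root of the number of balls, the
    second their radius for \<open>m\<close> close to \<open>D / n ^ k\<close>.\<close>
  define \<alpha> :: real where "\<alpha> = 48 powr (2 + 2 * q) * sqrt (16 * 40 ^ k * q)"
  \<comment> \<open>The 8 combines the 4 of \<open>gram_bound\<close> with a factor 2 for the lost
    half of the ball; \<open>sqrt 26\<close> comes from \<open>t\<close> and \<open>sqrt g\<close>
    from \<open>gram_bound\<close>.\<close>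
  define \<beta> :: real where "\<beta> = 1 / (8 * sqrt 26 * sqrt g * sqrt q)"
  have q: "q > 0" using assms by (simp add: q_def)
  have g: "g > 0" unfolding g_def by (intro prod_pos) (simp add: add_pos_nonneg)
  have pos: "\<alpha> > 0" "\<beta> > 0" using q g by (simp_all add: \<alpha>_def \<beta>_def)
  have main: "\<beta> * real n powr (- real k / 2)
        \<le> (form_vol n k (Sq_tilde n k) / form_vol n k (zero_mean_ball n k))
             powr (1 / real (dim (zero_mean_forms n k))) \<and>
      (form_vol n k (Sq_tilde n k) / form_vol n k (zero_mean_ball n k))
             powr (1 / real (dim (zero_mean_forms n k)))
        \<le> \<alpha> * real n powr (- real k / 2)" if n: "n \<ge> 2" for n :: nat
  proof -
    have n1: "n \<ge> 1" using n by simp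
    have "\<exists>b. orthonormal_basis n k b"
      using orthonormal_basis_exists(1)[OF n1 subspace_zero_mean_forms[OF n1] zero_mean_forms_subset]
      by (simp add: orthonormal_basis_def orthonormal_forms_def)
    then have "orthonormal_basis n k (SOME b. orthonormal_basis n k b)" by (rule someI_ex)
    then interpret zero_mean_basis n k "SOME b. orthonormal_basis n k b"
      using n assms by unfold_locales
    define x where "x = real n ^ k"
    have x: "x \<ge> 1" unfolding x_def using n1 by (intro one_le_power) simp
    have nx: "real n powr (- real k / 2) = 1 / sqrt x"
    proof -
      have "sqrt x = x powr (1/2)" using x by (simp add: powr_half_sqrt)
      also have "\<dots> = real n powr (real k / 2)"
        unfolding x_def using n1 by (simp add: powr_powr flip: powr_realpow)
      finally show ?thesis by (simp add: powr_minus_divide)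
    qed
    have xD: "x * x \<le> q * real D"
    proof -
      have "x * x = real n ^ (2 * k)" by (simp add: x_def mult_2 power_add)
      also have "\<dots> = q * (real n / real (2 * k)) ^ (2 * k)"
        using assms by (simp add: q_def power_divide)
      also have "\<dots> \<le> q * real D" using D_ge q by (intro mult_left_mono) auto
      finally show ?thesis .
    qed
    define V where "V = unit_ball_vol (real D)"
    have V: "V > 0" by (simp add: V_def)
    define R where "R = vol (Sq_tilde n k) / V"
    have ratio: "form_vol n k (Sq_tilde n k) / form_vol n k (zero_mean_ball n k) = R"
      by (simp add: form_vol_eq[OF zero_mean_basis_axioms] vol_zero_mean_ball R_def V_def)
    have dimD: "dim (zero_mean_forms n k) = D" by (simp add: D_def)
    have xD': "x / real D \<le> q / x" using xD x D_pos by (simp add: field_simps)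
    have lower: "\<beta> * (1 / sqrt x) \<le> R powr (1 / real D)"
    proof -
      define \<rho> where "\<rho> = real n ^ k / (sqrt (26 * real n ^ k / real D) * gram_bound)"
      have "real n ^ (2 * k) = x * x" by (simp add: x_def mult_2 power_add)
      then have "gram_bound = 4 * (x * x) * sqrt g" by (simp only: gram_bound_def odd_product_def g_def)
      then have "\<rho> = x / (sqrt 26 * sqrt x / sqrt (real D) * (4 * (x * x) * sqrt g))"
        by (simp only: \<rho>_def x_def[symmetric] real_sqrt_divide real_sqrt_mult)
      also have "\<dots> = sqrt (real D) / (4 * sqrt 26 * sqrt x * x * sqrt g)"
        using x D_pos by (simp add: field_simps)
      also have "\<dots> \<ge> (x / sqrt q) / (4 * sqrt 26 * sqrt x * x * sqrt g)"
      proof (rule divide_right_mono)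
        have "x \<le> sqrt (q * real D)" using xD x by (intro real_le_rsqrt) (simp add: power2_eq_square)
        then show "x / sqrt q \<le> sqrt (real D)" using q by (simp add: real_sqrt_mult field_simps)
      qed (use x g in simp)
      finally have \<rho>: "2 * (\<beta> * (1 / sqrt x)) \<le> \<rho>"
        using x by (simp add: \<beta>_def field_simps)
      have b0: "0 < \<beta> * (1 / sqrt x)" using pos x by simp
      \<comment> \<open>Halving the radius more than pays for the factor \<open>1/2\<close> in the
        volume, since \<open>2 ^ D \<ge> 2\<close> for positive \<open>D\<close>.\<close>
      have "(\<beta> * (1 / sqrt x)) ^ D \<le> (\<rho> / 2) ^ D" by (rule power_mono) (use \<rho> b0 in linarith)+
      also have "\<dots> = \<rho> ^ D / 2 ^ D" by (simp add: power_divide)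
      also have "\<dots> \<le> \<rho> ^ D / 2"
        using \<rho> b0 D_pos self_le_power[of "2::real" D] by (intro divide_left_mono) auto
      also have "\<dots> \<le> R"
        using vol_Sq_tilde_ge V by (simp add: R_def V_def \<rho>_def field_simps)
      finally have "((\<beta> * (1 / sqrt x)) ^ D) powr (1 / real D) \<le> R powr (1 / real D)"
        using b0 by (intro powr_mono2) auto
      moreover have "((\<beta> * (1 / sqrt x)) ^ D) powr (1 / real D) = \<beta> * (1 / sqrt x)"
        by (rule power_powr_inverse[OF b0 D_pos])
      ultimately show ?thesis by simp
    qed
    have upper: "R powr (1 / real D) \<le> \<alpha> * (1 / sqrt x)"
    proof -
      \<comment> \<open>Rounding up gives \<open>m \<ge> 1\<close> even when \<open>D < x\<close>.
        It costs at most \<open>x\<close> in \<open>x * m \<le> D + x\<close>, so the exponent of 48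
        per dimension stays below \<open>2 + 2 * q\<close>.\<close>
      define m where "m = nat \<lceil>real D / x\<rceil>"
      have Dx: "real D / x > 0" using D_pos x by simp
      then have m: "real m \<ge> real D / x" "real m \<le> real D / x + 1" "m \<ge> 1"
        unfolding m_def by linarith+
      define r where "r = sqrt (16 * 40 ^ k / real m)"
      have r: "r > 0" using m by (simp add: r_def)
      have "R \<le> 48 ^ (2 * n ^ k * m) * r ^ D"
        using vol_Sq_tilde_le[OF m(3)] V by (simp add: R_def V_def r_def field_simps)
      then have "R powr (1 / real D) \<le> (48 ^ (2 * n ^ k * m) * r ^ D) powr (1 / real D)"
        using V by (intro powr_mono2) (auto simp: R_def)
      also have "\<dots> = (48 ^ (2 * n ^ k * m)) powr (1 / real D) * (r ^ D) powr (1 / real D)"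
        by (rule powr_mult)
      also have "(r ^ D) powr (1 / real D) = r"
        by (rule power_powr_inverse[OF r D_pos])
      also have "((48::real) ^ (2 * n ^ k * m)) powr (1 / real D) = 48 powr (2 * x * real m / real D)"
        by (simp add: powr_powr x_def flip: powr_realpow)
      also have "48 powr (2 * x * real m / real D) * r \<le> 48 powr (2 + 2 * q) * (sqrt (16 * 40 ^ k * q) * (1 / sqrt x))"
      proof (rule mult_mono)
        have "x * real m \<le> x * (real D / x + 1)" using m(2) x by (intro mult_left_mono) auto
        also have "\<dots> = real D + x" using x by (simp add: field_simps)
        finally have "x * real m / real D \<le> (real D + x) / real D" by (intro divide_right_mono) auto
        also have "\<dots> = 1 + x / real D" using D_pos by (simp add: add_divide_distrib)
        also have "\<dots> \<le> 1 + q / x" using xD' by simp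
        also have "q / x \<le> q" using q x by (simp add: divide_le_eq)
        finally show "48 powr (2 * x * real m / real D) \<le> 48 powr (2 + 2 * q)"
          by (intro powr_mono) auto
        have "r \<le> sqrt (16 * 40 ^ k * (q / x))"
          unfolding r_def
        proof (rule real_sqrt_le_mono)
          have "0 < real m * (real D / x)" using m(1) Dx by (intro mult_pos_pos) linarith+
          then have "1 / real m \<le> 1 / (real D / x)" by (rule divide_left_mono[OF m(1) zero_le_one])
          also have "\<dots> = x / real D" by simp
          also note xD'
          finally have "16 * 40 ^ k * (1 / real m) \<le> 16 * 40 ^ k * (q / x)" by (intro mult_left_mono) auto
          then show "16 * 40 ^ k / real m \<le> 16 * 40 ^ k * (q / x)" by simp
        qed
        also have "\<dots> = sqrt (16 * 40 ^ k * q) * (1 / sqrt x)"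
          by (simp add: real_sqrt_mult real_sqrt_divide)
        finally show "r \<le> sqrt (16 * 40 ^ k * q) * (1 / sqrt x)" .
      qed (use r in auto)
      finally show ?thesis by (simp add: \<alpha>_def mult.assoc)
    qed
    show ?thesis unfolding ratio dimD nx using lower upper by simp
  qed
  show ?thesis using pos main by (intro exI[of _ \<alpha>] exI[of _ \<beta>]) simp
qed

end
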